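(* Fix $p$. Let $NLL_1,NLL_2,\dots$ be IID random functions $\mathbb{R}^p\to\mathbb{R}$, let $f_n$ be the (random) posterior density $$f_n(\boldsymbol\theta)\propto\exp\left(-\phi_0(\boldsymbol\theta)-\sum_{i=1}^nNLL_i(\boldsymbol\theta)\right),$$ let $g_{LAP,n}$ be the Laplace approximation of $f_n$, and let $J=\mathbb{E}[H\,NLL(\boldsymbol\theta_0)]$ be the Hessian-based Fisher information. Suppose that $J>0$ (positive definite), that $\phi_0$ and all $NLL_i$ are convex, and that their third derivatives are controlled in the sense that the quantities $$\Delta^{(0)}=\max_{\boldsymbol\theta,v_1,v_2,v_3}\frac{|\phi_0^{(3)}(\boldsymbol\theta)[J^{1/2}v_1,J^{1/2}v_2,J^{1/2}v_3]|}{\|v_1\|_2\|v_2\|_2\|v_3\|_2},\qquad \Delta^{(i)}=\max_{\boldsymbol\theta,v_1,v_2,v_3}\frac{|NLL_i^{(3)}(\boldsymbol\theta)[J^{1/2}v_1,J^{1/2}v_2,J^{1/2}v_3]|}{\|v_1\|_2\|v_2\|_2\|v_3\|_2}$$ satisfy $\Delta^{(0)}<\infty$ and $\mathbb{E}(\Delta^{(i)})<\infty$. Then, as $n\to\infty$, $\Delta_{3,n}\,p^{3/2}=\mathcal{O}_P(1/\sqrt n)$, and $$KL(g_{LAP,n},f_n)=\mathcal{O}_P\left(\frac1n\right).$$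
   Context: $\phi_0:\mathbb{R}^p\to\mathbb{R}$ is a deterministic negative log-prior; $\phi_0$ and the $NLL_i$ (negative log-likelihoods) are three times differentiable. $\phi_n=\phi_0+\sum_{i=1}^nNLL_i$. $H$ denotes the Hessian, and third derivatives are viewed as trilinear forms. Standing assumptions: $\boldsymbol\theta_0=\mathrm{argmin}_{\boldsymbol\theta}\,\mathbb{E}(NLL(\boldsymbol\theta))$ exists and is unique (no correct model specification is assumed), and the gradient-based Fisher matrix $I=\mathbb{E}[\nabla NLL(\boldsymbol\theta_0)\nabla^TNLL(\boldsymbol\theta_0)]$ exists (finite) and is positive definite. Laplace approximation: $g_{LAP,n}$ is the Gaussian density with mean $\hat{\boldsymbol\theta}_n=\mathrm{argmin}\,\phi_n$ and covariance $\Sigma_n=[H\phi_n(\hat{\boldsymbol\theta}_n)]^{-1}$ (defined with probability tending to $1$). $\Delta_{3,n}$ (written $\Delta_3$ in the paper) is $$\Delta_{3,n}=\max_{\tilde{\boldsymbol\theta},v_1,v_2,v_3}\frac{|\tilde\phi_n^{(3)}(\tilde{\boldsymbol\theta})[v_1,v_2,v_3]|}{\|v_1\|_2\|v_2\|_2\|v_3\|_2},\qquad\tilde\phi_n(\tilde{\boldsymbol\theta})=\phi_n(\hat{\boldsymbol\theta}_n+\Sigma_n^{1/2}\tilde{\boldsymbol\theta}).$$ $KL(g,f)=\mathbb{E}_{\boldsymbol\theta\sim g}[\log(g(\boldsymbol\theta)/f(\boldsymbol\theta))]$. $X_n=\mathcal{O}_P(a_n)$ means $X_n/a_n$ is bounded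 in probability. *)

theory Defs
  imports "HOL-Probability.Probability"
begin

definition D1 :: "(real^'p \<Rightarrow> real) \<Rightarrow> real^'p \<Rightarrow> real^'p \<Rightarrow> real" where
  "D1 f x u = frechet_derivative f (at x) u"

definition D2 :: "(real^'p \<Rightarrow> real) \<Rightarrow> real^'p \<Rightarrow> real^'p \<Rightarrow> real^'p \<Rightarrow> real" where
  "D2 f x u v = frechet_derivative (\<lambda>y. D1 f y u) (at x) v"

definition D3 :: "(real^'p \<Rightarrow> real) \<Rightarrow> real^'p \<Rightarrow> real^'p \<Rightarrow> real^'p \<Rightarrow> real^'p \<Rightarrow> real" where
  "D3 f x u v w = frechet_derivative (\<lambda>y. D2 f y u v) (at x) w"

text \<open>In finite dimension a map into the linear (bilinear) forms is differentiable iff all its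
  evaluations at fixed arguments are, so this is three-fold Frechet differentiability.
  Continuity of the third derivative is not required.\<close>

definition three_times_differentiable :: "(real^'p \<Rightarrow> real) \<Rightarrow> bool" where
  "three_times_differentiable f \<longleftrightarrow>
     f differentiable_on UNIV \<and>
     (\<forall>u. (\<lambda>x. D1 f x u) differentiable_on UNIV) \<and>
     (\<forall>u v. (\<lambda>x. D2 f x u v) differentiable_on UNIV)"

definition grad :: "(real^'p \<Rightarrow> real) \<Rightarrow> real^'p \<Rightarrow> real^'p" where
  "grad f x = (\<chi> i. D1 f x (axis i 1))"

definition hessian :: "(real^'p \<Rightarrow> real) \<Rightarrow> real^'p \<Rightarrow> real^'p^'p" where
  "hessian f x = (\<chi> i j. D2 f x (axis i 1) (axis j 1))"

definition outer :: "real^'p \<Rightarrow> real^'p \<Rightarrow> real^'p^'p" where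
  "outer u v = (\<chi> i j. u $ i * v $ j)"

text \<open>The maxima of normalized third derivatives range over an unbounded set and are read
  as suprema in \<open>[0, \<infinity>]\<close>.\<close>

definition third_sup :: "(real^'p \<Rightarrow> real^'p \<Rightarrow> real^'p \<Rightarrow> real^'p \<Rightarrow> real) \<Rightarrow> ennreal" where
  "third_sup T = (SUP (\<theta>, v1, v2, v3) \<in> UNIV \<times> (- {0}) \<times> (- {0}) \<times> (- {0}).
     ennreal (\<bar>T \<theta> v1 v2 v3\<bar> / (norm v1 * norm v2 * norm v3)))"

definition pos_def :: "real^'p^'p \<Rightarrow> bool" where
  "pos_def A \<longleftrightarrow> transpose A = A \<and> (\<forall>x. x \<noteq> 0 \<longrightarrow> x \<bullet> (A *v x) > 0)"

definition pos_semidef :: "real^'p^'p \<Rightarrow> bool" where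
  "pos_semidef A \<longleftrightarrow> transpose A = A \<and> (\<forall>x. x \<bullet> (A *v x) \<ge> 0)"

text \<open>The symmetric square root; it exists and is unique when the argument is positive
  semidefinite, and is only used there.\<close>

definition msqrt :: "real^'p^'p \<Rightarrow> real^'p^'p" where
  "msqrt A = (THE B. pos_semidef B \<and> B ** B = A)"

definition neg_log_post ::
  "(real^'p \<Rightarrow> real) \<Rightarrow> (nat \<Rightarrow> 'w \<Rightarrow> real^'p \<Rightarrow> real) \<Rightarrow> nat \<Rightarrow> 'w \<Rightarrow> real^'p \<Rightarrow> real" where
  "neg_log_post \<phi>0 NLL n \<omega> \<theta> = \<phi>0 \<theta> + (\<Sum>i=1..n. NLL i \<omega> \<theta>)"

definition proper_posterior :: "(real^'p \<Rightarrow> real) \<Rightarrow> bool" where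
  "proper_posterior \<phi> \<longleftrightarrow> integrable lborel (\<lambda>\<theta>. exp (- \<phi> \<theta>))"

definition posterior_density :: "(real^'p \<Rightarrow> real) \<Rightarrow> real^'p \<Rightarrow> real" where
  "posterior_density \<phi> \<theta> = exp (- \<phi> \<theta>) / (\<integral>\<theta>'. exp (- \<phi> \<theta>') \<partial>lborel)"

definition gaussian_density :: "real^'p \<Rightarrow> real^'p^'p \<Rightarrow> real^'p \<Rightarrow> real" where
  "gaussian_density \<mu> S \<theta> =
     exp (- ((\<theta> - \<mu>) \<bullet> (matrix_inv S *v (\<theta> - \<mu>))) / 2) / sqrt ((2 * pi) ^ CARD('p) * det S)"

definition unique_arg_min :: "('a \<Rightarrow> real) \<Rightarrow> 'a \<Rightarrow> bool" where
  "unique_arg_min f x \<longleftrightarrow> (\<forall>y. is_arg_min f (\<lambda>_. True) y \<longleftrightarrow> y = x)"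

definition lap_mean :: "(real^'p \<Rightarrow> real) \<Rightarrow> real^'p" where
  "lap_mean \<phi> = arg_min \<phi> (\<lambda>_. True)"

definition lap_cov :: "(real^'p \<Rightarrow> real) \<Rightarrow> real^'p^'p" where
  "lap_cov \<phi> = matrix_inv (hessian \<phi> (lap_mean \<phi>))"

definition laplace_defined :: "(real^'p \<Rightarrow> real) \<Rightarrow> bool" where
  "laplace_defined \<phi> \<longleftrightarrow>
     unique_arg_min \<phi> (lap_mean \<phi>) \<and> pos_def (hessian \<phi> (lap_mean \<phi>))"

definition laplace_density :: "(real^'p \<Rightarrow> real) \<Rightarrow> real^'p \<Rightarrow> real" where
  "laplace_density \<phi> = gaussian_density (lap_mean \<phi>) (lap_cov \<phi>)"

definition standardized :: "(real^'p \<Rightarrow> real) \<Rightarrow> real^'p \<Rightarrow> real" where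
  "standardized \<phi> \<theta> = \<phi> (lap_mean \<phi> + msqrt (lap_cov \<phi>) *v \<theta>)"

definition Delta3 :: "(real^'p \<Rightarrow> real) \<Rightarrow> ennreal" where
  "Delta3 \<phi> = third_sup (D3 (standardized \<phi>))"

text \<open>The library's \<^const>\<open>KL_divergence\<close> integrates with respect to its last argument, so the
  arguments are swapped.\<close>

definition KL :: "(real^'p \<Rightarrow> real) \<Rightarrow> (real^'p \<Rightarrow> real) \<Rightarrow> real" where
  "KL g f = KL_divergence (exp 1) (density lborel f) (density lborel g)"

definition KL_finite :: "(real^'p \<Rightarrow> real) \<Rightarrow> (real^'p \<Rightarrow> real) \<Rightarrow> bool" where
  "KL_finite g f \<longleftrightarrow> integrable (density lborel g) (\<lambda>\<theta>. ln (g \<theta> / f \<theta>))"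

lemma KL_eq_expectation:
  fixes f g :: "real^'p \<Rightarrow> real"
  assumes [measurable]: "f \<in> borel_measurable borel" "g \<in> borel_measurable borel"
    and "\<And>\<theta>. f \<theta> > 0" "\<And>\<theta>. g \<theta> > 0"
  shows "KL g f = (\<integral>\<theta>. ln (g \<theta> / f \<theta>) \<partial>density lborel g)"
proof -
  have "KL g f = (\<integral>\<theta>. g \<theta> * log (exp 1) (g \<theta> / f \<theta>) \<partial>lborel)"
    unfolding KL_def
    by (rule lborel.KL_density_density)
       (use assms in \<open>auto simp: less_imp_le less_imp_neq[symmetric]\<close>)
  also have "\<dots> = (\<integral>\<theta>. ln (g \<theta> / f \<theta>) \<partial>density lborel g)"
    using assms by (subst integral_density) (auto simp: less_imp_le log_def)
  finally show ?thesis .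
qed

text \<open>Both notions ask for a measurable event of probability at least \<open>1 - \<epsilon>\<close> on which the
  property holds. When the set in question is itself measurable this is the usual notion (see
  the lemmas below); otherwise it avoids the value \<^term>\<open>0\<close> that \<^const>\<open>measure\<close> assigns to
  nonmeasurable sets.\<close>

definition with_prob_tending_to_1 :: "'w measure \<Rightarrow> (nat \<Rightarrow> 'w \<Rightarrow> bool) \<Rightarrow> bool" where
  "with_prob_tending_to_1 M P \<longleftrightarrow>
     (\<forall>\<epsilon>>0. \<forall>\<^sub>F n in sequentially.
        \<exists>A\<in>sets M. measure M A \<ge> 1 - \<epsilon> \<and> (\<forall>\<omega>\<in>A. P n \<omega>))"

definition bigO_P :: "'w measure \<Rightarrow> (nat \<Rightarrow> 'w \<Rightarrow> ereal) \<Rightarrow> (nat \<Rightarrow> real) \<Rightarrow> bool" where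
  "bigO_P M X a \<longleftrightarrow>
     (\<forall>\<epsilon>>0. \<exists>C. \<forall>\<^sub>F n in sequentially.
        \<exists>A\<in>sets M. measure M A \<ge> 1 - \<epsilon> \<and> (\<forall>\<omega>\<in>A. \<bar>X n \<omega>\<bar> \<le> ereal (C * a n)))"

lemma (in prob_space) with_prob_tending_to_1_iff:
  assumes "\<And>n. {\<omega> \<in> space M. P n \<omega>} \<in> events"
  shows "with_prob_tending_to_1 M P \<longleftrightarrow> (\<lambda>n. prob {\<omega> \<in> space M. P n \<omega>}) \<longlonglongrightarrow> 1"
proof -
  have *: "(\<exists>A\<in>events. prob A \<ge> c \<and> (\<forall>\<omega>\<in>A. P n \<omega>)) \<longleftrightarrow> prob {\<omega> \<in> space M. P n \<omega>} \<ge> c" for n c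
  proof
    assume "\<exists>A\<in>events. prob A \<ge> c \<and> (\<forall>\<omega>\<in>A. P n \<omega>)"
    then obtain A where A: "A \<in> events" "prob A \<ge> c" "\<forall>\<omega>\<in>A. P n \<omega>" by blast
    have "prob A \<le> prob {\<omega> \<in> space M. P n \<omega>}"
      using A assms sets.sets_into_space[OF A(1)] by (intro finite_measure_mono) auto
    with A show "prob {\<omega> \<in> space M. P n \<omega>} \<ge> c" by simp
  qed (use assms in auto)
  have "(\<forall>\<epsilon>>0. \<forall>\<^sub>F n in sequentially. prob {\<omega> \<in> space M. P n \<omega>} \<ge> 1 - \<epsilon>) \<longleftrightarrow>
        (\<lambda>n. prob {\<omega> \<in> space M. P n \<omega>}) \<longlonglongrightarrow> 1" (is "?L \<longleftrightarrow> ?R")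
  proof
    assume L: ?L
    show ?R
    proof (rule order_tendstoI)
      fix y :: real assume "y < 1"
      then have "(1 - y) / 2 > 0" by simp
      with L have "\<forall>\<^sub>F n in sequentially. prob {\<omega> \<in> space M. P n \<omega>} \<ge> 1 - (1 - y) / 2" by blast
      then show "\<forall>\<^sub>F n in sequentially. y < prob {\<omega> \<in> space M. P n \<omega>}"
        by eventually_elim (use \<open>y < 1\<close> in \<open>simp add: field_simps\<close>)
    next
      fix y :: real assume "1 < y"
      then show "\<forall>\<^sub>F n in sequentially. prob {\<omega> \<in> space M. P n \<omega>} < y"
        by (intro always_eventually allI) (meson le_less_trans prob_le_1)
    qed
  next
    assume R: ?R
    show ?L
    proof (intro allI impI)
      fix \<epsilon> :: real assume "\<epsilon> > 0"
      then have "\<forall>\<^sub>F n in sequentially. 1 - \<epsilon> < prob {\<omega> \<in> space M. P n \<omega>}"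
        using order_tendstoD(1)[OF R, of "1 - \<epsilon>"] by simp
      then show "\<forall>\<^sub>F n in sequentially. prob {\<omega> \<in> space M. P n \<omega>} \<ge> 1 - \<epsilon>"
        by eventually_elim simp
    qed
  qed
  then show ?thesis by (simp add: with_prob_tending_to_1_def *)
qed

lemma (in prob_space) bigO_P_iff:
  assumes [measurable]: "\<And>n. X n \<in> borel_measurable M"
  shows "bigO_P M X a \<longleftrightarrow>
    (\<forall>\<epsilon>>0. \<exists>C. \<forall>\<^sub>F n in sequentially. prob {\<omega> \<in> space M. \<bar>X n \<omega>\<bar> > ereal (C * a n)} \<le> \<epsilon>)"
proof -
  have "(\<exists>A\<in>events. prob A \<ge> 1 - \<epsilon> \<and> (\<forall>\<omega>\<in>A. \<bar>X n \<omega>\<bar> \<le> c)) \<longleftrightarrow>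
        prob {\<omega> \<in> space M. \<bar>X n \<omega>\<bar> > c} \<le> \<epsilon>" (is "?L \<longleftrightarrow> ?R") for n c \<epsilon>
  proof -
    have eq: "prob {\<omega> \<in> space M. \<bar>X n \<omega>\<bar> > c} = 1 - prob {\<omega> \<in> space M. \<bar>X n \<omega>\<bar> \<le> c}"
      by (subst prob_compl[symmetric]) (auto intro!: arg_cong[where f=prob])
    show ?thesis
    proof
      assume ?L
      then obtain A where A: "A \<in> events" "prob A \<ge> 1 - \<epsilon>" "\<forall>\<omega>\<in>A. \<bar>X n \<omega>\<bar> \<le> c" by blast
      have "prob A \<le> prob {\<omega> \<in> space M. \<bar>X n \<omega>\<bar> \<le> c}"
        using A sets.sets_into_space[OF A(1)] by (intro finite_measure_mono) auto
      with A eq show ?R by simp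
    next
      assume ?R
      with eq show ?L
        by (intro bexI[of _ "{\<omega> \<in> space M. \<bar>X n \<omega>\<bar> \<le> c}"]) auto
    qed
  qed
  then show ?thesis by (simp add: bigO_P_def)
qed

end

theory Submission
  imports Defs
begin

text \<open>
  Write \<open>\<phi>\<close> for \<open>\<phi>\<^sub>n\<close>. The argument separates a deterministic estimate for a single convex function from
  a probabilistic statement about the sample.

  \<^bold>\<open>Deterministic part\<close> (\<open>KL_laplace_bound\<close>). In the coordinates \<open>\<theta> = m + B y\<close>, with \<open>m\<close> the
  minimiser and \<open>B\<close> the root of the inverse Hessian there, the Laplace approximation is the standard
  normal law \<open>\<gamma>\<close>, and \<open>\<phi>(\<theta>) = \<phi>(m) + |y|\<^sup>2/2 + r(y)\<close> with \<open>|r(y)| \<le> \<Delta>\<^sub>3 |y|\<^sup>3\<close> by Taylor. The normalising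
  constants combine to the formula \<open>KL = E\<^sub>\<gamma> r + ln E\<^sub>\<gamma> exp(-r)\<close>. This is nonnegative by
  Jensen, and since \<open>ln x \<le> x - 1\<close> it is at most \<open>E\<^sub>\<gamma> (exp(-r) - 1 + r) \<le> E\<^sub>\<gamma> (r\<^sup>2 (1 + exp(-r)))\<close>, which is of
  second order in \<open>\<Delta>\<^sub>3\<close>. The factor \<open>exp(-r)\<close> is dangerous, because a cubic can beat the Gaussian
  weight. Convexity saves the integral: if \<open>\<Delta>\<^sub>3 \<le> 1\<close>, the standardised function exceeds its minimum by
  at least \<open>1/3\<close> on the unit sphere, hence by at least \<open>|y|/3\<close> outside the unit ball, and
  \<open>exp(-|y|\<^sup>2/2 - r(y))\<close> decays exponentially. So \<open>KL \<le> c\<^sub>p \<Delta>\<^sub>3\<^sup>2\<close> as soon as \<open>\<Delta>\<^sub>3 \<le> 1\<close>, and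
  everything reduces to \<open>\<Delta>\<^sub>3 = O\<^sub>P(1/sqrt n)\<close>.

  \<^bold>\<open>Control of\<close> \<open>\<Delta>\<^sub>3\<close> (\<open>laplace_regular\<close>). Suppose that at \<open>\<theta>\<^sub>0\<close> the Hessian of \<open>\<phi>\<close> is at least \<open>\<alpha> n\<close>, that the
  third derivative is everywhere at most \<open>L n\<close>, and that the gradient at \<open>\<theta>\<^sub>0\<close> is less than
  \<open>\<alpha>\<^sup>2 n / (8 L)\<close>. Then \<open>\<phi>\<close> exceeds \<open>\<phi>(\<theta>\<^sub>0)\<close> on the sphere of radius \<open>\<alpha> / (2 L)\<close> around \<open>\<theta>\<^sub>0\<close>, so the minimiser
  lies inside it, where the Hessian is still at least \<open>\<alpha> n / 2\<close>. Rescaling each of the three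
  arguments by \<open>(\<alpha> n / 2)\<^sup>-\<^sup>1\<^sup>/\<^sup>2\<close> turns \<open>L n\<close> into a constant times \<open>1/sqrt n\<close>.

  \<^bold>\<open>Probabilistic part\<close> (\<open>laplace_regular_in_probability\<close>). The three hypotheses hold with probability
  close to one. The third derivatives add up and have finite mean, so Markov's inequality gives the
  bound \<open>L n\<close>. The expected gradient at \<open>\<theta>\<^sub>0\<close> vanishes, because \<open>\<theta>\<^sub>0\<close> minimises the expected loss and
  convexity justifies differentiating under the expectation; Chebyshev's inequality, with the
  second moments provided by the Fisher matrix, makes the gradient sum \<open>o(n)\<close>. Only a first moment
  of the Hessian is available, but a lower bound suffices, and by convexity each
  summand is positive semidefinite: summands with large Hessians may be dropped, and Chebyshev
  applies to the bounded remainder, whose mean is close to \<open>J\<close>.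

  Two technical devices recur. Bounds on third derivatives are handled through third-order
  differences (\<open>third_bounded\<close>): these are linear in the function, transform well under affine maps,
  involve point evaluations only, and so give a random variable on path space even though the supremum of
  third derivatives is not evidently one. Matrix roots come from a spectral theorem for real symmetric
  matrices, which also yields the linear change of variables through the rotation invariance of
  Lebesgue measure.
\<close>

section \<open>Spectral theorem and matrix square roots\<close>

lemma symmetric_matrix_inner:
  fixes A :: "real^'p^'p"
  assumes "transpose A = A"
  shows "x \<bullet> (A *v y) = (A *v x) \<bullet> y"
  by (metis assms dot_lmul_matrix vector_transpose_matrix)

text \<open>The orthogonal complement of a set of eigenvectors is invariant, and a maximiser of the Rayleigh
  quotient over its unit sphere is an eigenvector.\<close>

lemma symmetric_eigenvector_orthogonal:
  fixes A :: "real^'p^'p"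
  assumes sym: "transpose A = A"
    and eig: "\<And>e. e \<in> E \<Longrightarrow> \<exists>l. A *v e = l *\<^sub>R e"
    and small: "finite E" "card E < CARD('p)"
  shows "\<exists>x l. norm x = 1 \<and> (\<forall>e\<in>E. x \<bullet> e = 0) \<and> A *v x = l *\<^sub>R x"
proof -
  define S where "S = {x. \<forall>e\<in>E. x \<bullet> e = 0}"
  have sub: "subspace S"
    by (auto simp: subspace_def S_def inner_left_distrib)
  have "dim (span E) < DIM(real^'p)"
    using small dim_le_card'[of E] by simp
  then have "span E \<noteq> UNIV" using dim_UNIV by fastforce
  then obtain z where z: "z \<noteq> 0" "\<And>y. y \<in> span E \<Longrightarrow> z \<bullet> y = 0"
    using span_not_UNIV_orthogonal[of E] by blast
  then have zS: "z \<in> S" by (simp add: S_def span_base)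
  have "closed S" using sub by (rule closed_subspace)
  then have "compact (S \<inter> sphere 0 1)" by (intro closed_Int_compact) auto
  moreover have "z /\<^sub>R norm z \<in> S \<inter> sphere 0 1"
    using z(1) zS sub by (simp add: subspace_scale)
  moreover have "continuous_on (S \<inter> sphere 0 1) (\<lambda>x. x \<bullet> (A *v x))"
    by (intro continuous_intros linear_continuous_on) (simp add: linear_linear)
  ultimately obtain x where x: "x \<in> S" "norm x = 1"
      and sup: "\<And>y. y \<in> S \<Longrightarrow> norm y = 1 \<Longrightarrow> y \<bullet> (A *v y) \<le> x \<bullet> (A *v x)"
    using continuous_attains_sup[of "S \<inter> sphere 0 1" "\<lambda>x. x \<bullet> (A *v x)"]
    by (metis (no_types, lifting) IntD1 IntD2 IntI emptyE mem_sphere_0)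
  define l where "l = x \<bullet> (A *v x)"
  have xx: "x \<bullet> x = 1" using x(2) by (simp add: dot_square_norm)
  have bound: "y \<bullet> (A *v y) \<le> l * (y \<bullet> y)" if "y \<in> S" for y
  proof (cases "y = 0")
    case False
    have "(y /\<^sub>R norm y) \<bullet> (A *v (y /\<^sub>R norm y)) \<le> l"
      unfolding l_def using False that sub by (intro sup) (auto simp: subspace_scale)
    then have "(y \<bullet> (A *v y)) / (norm y)^2 \<le> l"
      by (simp add: matrix_vector_mult_scaleR power2_eq_square divide_inverse mult_ac)
    then show ?thesis using False by (simp add: divide_le_eq dot_square_norm)
  qed simp
  define y where "y = A *v x - l *\<^sub>R x"
  have AxS: "A *v x \<in> S"
    unfolding S_def
  proof (clarify)
    fix e assume e: "e \<in> E"
    obtain k where "A *v e = k *\<^sub>R e" using eig e by blast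
    then show "(A *v x) \<bullet> e = 0"
      using symmetric_matrix_inner[OF sym, of x e] x(1) e by (simp add: S_def)
  qed
  have yS: "y \<in> S" unfolding y_def using AxS x(1) sub by (simp add: subspace_diff subspace_scale)
  have yx: "y \<bullet> x = 0" 
    unfolding y_def inner_diff_left inner_scaleR_left xx l_def by (simp add: inner_commute)
  have yAx: "y \<bullet> (A *v x) = y \<bullet> y"
    using yx by (simp add: y_def inner_diff_right)
  \<comment> \<open>First variation of the Rayleigh quotient at its maximiser in the direction of the residual.\<close>
  have var: "2 * t * (y \<bullet> y) \<le> t^2 * (l * (y \<bullet> y) - y \<bullet> (A *v y))" for t
  proof -
    have "x + t *\<^sub>R y \<in> S" using x(1) yS sub by (simp add: subspace_add subspace_scale)
    from bound[OF this] have
      "(x + t *\<^sub>R y) \<bullet> (A *v x + t *\<^sub>R (A *v y)) \<le> l * ((x + t *\<^sub>R y) \<bullet> (x + t *\<^sub>R y))"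
      by (simp add: matrix_vector_right_distrib matrix_vector_mult_scaleR)
    moreover have "x \<bullet> (A *v y) = y \<bullet> y"
      using symmetric_matrix_inner[OF sym, of x y] yAx by (simp add: inner_commute)
    ultimately show ?thesis
      using yx yAx xx by (simp add: inner_add_left inner_add_right inner_commute[of x y]
          l_def[symmetric] power2_eq_square algebra_simps)
  qed
  have "y \<bullet> y = 0"
  proof (rule ccontr)
    assume "y \<bullet> y \<noteq> 0"
    then have yy: "y \<bullet> y > 0" by simp
    define m where "m = \<bar>l * (y \<bullet> y) - y \<bullet> (A *v y)\<bar> + 1"
    define t where "t = (y \<bullet> y) / m"
    have m: "m > 0" by (simp add: m_def)
    then have t: "t > 0" using yy by (simp add: t_def)
    have "2 * t * (y \<bullet> y) \<le> t^2 * m"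
      by (rule order_trans[OF var]) (simp add: m_def mult_left_mono)
    also have "t^2 * m = t * (y \<bullet> y)" using m by (simp add: t_def power2_eq_square)
    finally show False using t yy by simp
  qed
  then have "A *v x = l *\<^sub>R x" by (simp add: y_def)
  with x show ?thesis by (auto simp: S_def)
qed

lemma symmetric_eigenbasis:
  fixes A :: "real^'p^'p"
  assumes sym: "transpose A = A"
  shows "\<exists>E. finite E \<and> card E = CARD('p) \<and> pairwise orthogonal E \<and>
    (\<forall>e\<in>E. norm e = 1 \<and> (\<exists>l. A *v e = l *\<^sub>R e))"
proof -
  have "\<exists>E. finite E \<and> card E = k \<and> pairwise orthogonal E \<and>
    (\<forall>e\<in>E. norm e = 1 \<and> (\<exists>l. A *v e = l *\<^sub>R e))" if "k \<le> CARD('p)" for k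
    using that
  proof (induction k)
    case 0
    then show ?case by (intro exI[of _ "{}"]) auto
  next
    case (Suc k)
    then obtain E where E: "finite E" "card E = k" "pairwise orthogonal E"
      "\<And>e. e \<in> E \<Longrightarrow> norm e = 1" "\<And>e. e \<in> E \<Longrightarrow> \<exists>l. A *v e = l *\<^sub>R e"
      by auto
    have "card E < CARD('p)" using E(2) Suc.prems by simp
    from symmetric_eigenvector_orthogonal[OF sym E(5) E(1) this]
    obtain x l where x: "norm x = 1" "\<And>e. e \<in> E \<Longrightarrow> x \<bullet> e = 0" "A *v x = l *\<^sub>R x" by auto
    have "x \<notin> E" using x(1,2) by (metis norm_eq_1 zero_neq_one)
    then show ?case
      using E x by (intro exI[of _ "insert x E"])
        (auto simp: pairwise_insert orthogonal_def inner_commute pairwise_def)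
  qed
  from this[of "CARD('p)"] show ?thesis by simp
qed

definition diag_matrix :: "('p \<Rightarrow> real) \<Rightarrow> real^'p^'p" where
  "diag_matrix d = (\<chi> i j. if i = j then d i else 0)"

lemma diag_matrix_mult_vec: "diag_matrix d *v x = (\<chi> i. d i * x $ i)"
  by (simp add: diag_matrix_def matrix_vector_mult_def vec_eq_iff if_distrib[of "\<lambda>a. a * _"] cong: if_cong)

lemma symmetric_diagonalisation:
  fixes A :: "real^'p^'p"
  assumes sym: "transpose A = A"
  obtains Q d where "orthogonal_matrix Q" "A = Q ** diag_matrix d ** transpose Q"
proof -
  obtain E where E: "finite E" "card E = CARD('p)" "pairwise orthogonal E"
      "\<And>e. e \<in> E \<Longrightarrow> norm e = 1" "\<And>e. e \<in> E \<Longrightarrow> \<exists>l. A *v e = l *\<^sub>R e"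
    using symmetric_eigenbasis[OF sym] by blast
  obtain b where b: "bij_betw b (UNIV :: 'p set) E"
    using finite_same_card_bij[of "UNIV :: 'p set" E] E(1,2) by auto
  have bE: "b i \<in> E" for i using b by (auto simp: bij_betw_def)
  obtain d where d: "\<And>i. A *v b i = d i *\<^sub>R b i"
    using E(5)[OF bE] by metis
  define Q where "Q = (\<chi> i j. b j $ i)"
  have col: "column j Q = b j" for j by (simp add: column_def Q_def vec_eq_iff)
  have orthon: "b i \<bullet> b j = (if i = j then 1 else 0)" for i j
  proof (cases "i = j")
    case True then show ?thesis using E(4)[OF bE[of j]] by (simp add: norm_eq_1)
  next
    case False
    then have "b i \<noteq> b j" using b by (auto simp: bij_betw_def inj_on_def)
    then show ?thesis using E(3) bE False by (auto simp: pairwise_def orthogonal_def)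
  qed
  have QtQ: "transpose Q ** Q = mat 1"
    using orthon by (simp add: matrix_matrix_mult_def transpose_def Q_def mat_def vec_eq_iff inner_vec_def)
  then have Q: "orthogonal_matrix Q" by (simp add: orthogonal_matrix)
  have "A ** Q = Q ** diag_matrix d"
  proof -
    have "(A ** Q) $ i $ j = (A *v b j) $ i" for i j
      by (simp add: matrix_matrix_mult_def matrix_vector_mult_def Q_def)
    moreover have "(Q ** diag_matrix d) $ i $ j = (d j *\<^sub>R b j) $ i" for i j
      by (simp add: matrix_matrix_mult_def diag_matrix_def Q_def if_distrib[of "\<lambda>a. _ * a"] cong: if_cong)
    ultimately show ?thesis using d by (simp add: vec_eq_iff)
  qed
  then have "A ** (Q ** transpose Q) = Q ** diag_matrix d ** transpose Q"
    by (simp add: matrix_mul_assoc)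
  then have "A = Q ** diag_matrix d ** transpose Q"
    using Q by (simp add: orthogonal_matrix_def)
  with Q show thesis by (rule that)
qed

text \<open>If \<open>w = C v - b v\<close>, then \<open>C w = - b w\<close>, which is incompatible with \<open>C \<ge> 0\<close> and \<open>b > 0\<close> unless \<open>w = 0\<close>.
  For \<open>b = 0\<close>, the hypothesis reads \<open>C\<^sup>2 v = 0\<close> and thus \<open>|C v|\<^sup>2 = 0\<close>.\<close>

lemma psd_root_eigenvector:
  fixes C :: "real^'p^'p"
  assumes C: "pos_semidef C" and b: "b \<ge> 0" and v: "C *v (C *v v) = b^2 *\<^sub>R v"
  shows "C *v v = b *\<^sub>R v"
proof -
  define w where "w = C *v v - b *\<^sub>R v"
  have Cw: "C *v w = - b *\<^sub>R w"
    by (simp add: w_def matrix_vector_mult_diff_distrib matrix_vector_mult_scaleR v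
        scaleR_diff_right power2_eq_square)
  have ww: "w \<bullet> (C *v w) \<ge> 0" using C by (simp add: pos_semidef_def)
  have "w = 0"
  proof (cases "b = 0")
    case True
    have "w \<bullet> w = (C *v v) \<bullet> (C *v v)" using True by (simp add: w_def)
    also have "\<dots> = v \<bullet> (C *v (C *v v))"
      using C symmetric_matrix_inner[of C v "C *v v"] by (simp add: pos_semidef_def)
    finally show ?thesis using True v by simp
  next
    case False
    with ww b Cw have "w \<bullet> w \<le> 0"
      by (simp add: mult_le_0_iff)
    then show ?thesis by (metis inner_ge_zero inner_eq_zero_iff order_antisym)
  qed
  then show ?thesis by (simp add: w_def)
qed

text \<open>By the preceding lemma, two roots of the same matrix agree on an eigenbasis of one of them.\<close>

lemma psd_root_unique:
  fixes B C :: "real^'p^'p"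
  assumes B: "pos_semidef B" and C: "pos_semidef C" and eq: "B ** B = C ** C"
  shows "B = C"
proof -
  have symB: "transpose B = B" using B by (simp add: pos_semidef_def)
  obtain E where E: "finite E" "card E = CARD('p)" "pairwise orthogonal E"
      "\<And>e. e \<in> E \<Longrightarrow> norm e = 1" "\<And>e. e \<in> E \<Longrightarrow> \<exists>l. B *v e = l *\<^sub>R e"
    using symmetric_eigenbasis[OF symB] by blast
  have "0 \<notin> E" using E(4) by force
  then have indep: "independent E" using E(3) by (simp add: pairwise_orthogonal_independent)
  have span: "span E = UNIV"
    using card_ge_dim_independent[of E UNIV] E(2) indep by (auto simp: dim_UNIV)
  have agree: "B *v e = C *v e" if "e \<in> E" for e
  proof -
    obtain l where l: "B *v e = l *\<^sub>R e" using E(5)[OF \<open>e \<in> E\<close>] by blast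
    have "0 \<le> e \<bullet> (B *v e)" using B by (simp add: pos_semidef_def)
    then have "l \<ge> 0" using l E(4)[OF that] by (simp add: norm_eq_1)
    moreover have "C *v (C *v e) = l^2 *\<^sub>R e"
    proof -
      have "C *v (C *v e) = B *v (B *v e)" by (simp add: matrix_vector_mul_assoc eq)
      then show ?thesis by (simp add: l matrix_vector_mult_scaleR power2_eq_square)
    qed
    ultimately show ?thesis using psd_root_eigenvector[OF C, of l e] l by simp
  qed
  have "B *v x = C *v x" for x
  proof (rule linear_eq_on[of "(*v) B" "(*v) C"])
    show "x \<in> span E" using span by simp
  qed (auto intro: agree)
  then show ?thesis by (simp add: matrix_eq)
qed

lemma psd_root_exists:
  fixes A :: "real^'p^'p"
  assumes A: "pos_semidef A"
  shows "\<exists>B. pos_semidef B \<and> B ** B = A"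
proof -
  obtain Q d where Q: "orthogonal_matrix Q" and AQ: "A = Q ** diag_matrix d ** transpose Q"
    using symmetric_diagonalisation A by (auto simp: pos_semidef_def)
  have QtQ: "transpose Q ** Q = mat 1" using Q by (simp add: orthogonal_matrix)
  have quad: "x \<bullet> ((Q ** diag_matrix e ** transpose Q) *v x) = (\<Sum>i\<in>UNIV. e i * ((transpose Q *v x) $ i)^2)" for e x
  proof -
    have "x \<bullet> ((Q ** diag_matrix e ** transpose Q) *v x) = (transpose Q *v x) \<bullet> (diag_matrix e *v (transpose Q *v x))"
      by (metis dot_lmul_matrix matrix_vector_mul_assoc vector_transpose_matrix transpose_transpose)
    then show ?thesis
      by (simp add: diag_matrix_mult_vec inner_vec_def power2_eq_square mult_ac)
  qed
  have d: "d i \<ge> 0" for i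
  proof -
    have "transpose Q *v (Q *v axis i 1) = axis i 1"
      by (simp add: matrix_vector_mul_assoc QtQ)
    then have "(Q *v axis i 1) \<bullet> (A *v (Q *v axis i 1)) = (\<Sum>j\<in>UNIV. d j * ((axis i 1 :: real^'p) $ j)^2)"
      unfolding AQ quad by simp
    also have "\<dots> = d i"
      by (simp add: axis_def if_distrib[of "\<lambda>x. x^2"] if_distrib[of "\<lambda>x. _ * x"] cong: if_cong)
    finally show ?thesis using A by (metis pos_semidef_def)
  qed
  define B where "B = Q ** diag_matrix (\<lambda>i. sqrt (d i)) ** transpose Q"
  have diag_sym: "transpose (diag_matrix e) = diag_matrix e" for e :: "'p \<Rightarrow> real"
    by (auto simp: transpose_def diag_matrix_def vec_eq_iff)
  have "transpose B = B"
    by (simp add: B_def matrix_transpose_mul diag_sym matrix_mul_assoc)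
  moreover have "x \<bullet> (B *v x) \<ge> 0" for x
    unfolding B_def quad by (intro sum_nonneg) (simp add: d)
  moreover have "B ** B = A"
  proof -
    have dd: "diag_matrix (\<lambda>i. sqrt (d i)) ** diag_matrix (\<lambda>i. sqrt (d i)) = diag_matrix d"
      using d by (simp add: diag_matrix_def matrix_matrix_mult_def vec_eq_iff if_distrib[of "\<lambda>a. a * _"] cong: if_cong)
    have "B ** B = Q ** diag_matrix (\<lambda>i. sqrt (d i)) ** (transpose Q ** Q) ** diag_matrix (\<lambda>i. sqrt (d i)) ** transpose Q"
      by (simp add: B_def matrix_mul_assoc)
    also have "\<dots> = Q ** (diag_matrix (\<lambda>i. sqrt (d i)) ** diag_matrix (\<lambda>i. sqrt (d i))) ** transpose Q"
      by (simp add: QtQ matrix_mul_assoc)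
    finally show ?thesis by (simp add: dd AQ)
  qed
  ultimately show ?thesis unfolding pos_semidef_def by blast
qed

lemma pos_def_imp_semidef: "pos_def A \<Longrightarrow> pos_semidef A"
  unfolding pos_def_def pos_semidef_def
  by (metis inner_zero_left order_less_imp_le order_refl)

lemma msqrt_root:
  assumes "pos_def A"
  shows "pos_semidef (msqrt A)" "msqrt A ** msqrt A = A"
proof -
  have "\<exists>!B. pos_semidef B \<and> B ** B = A"
    using psd_root_exists[OF pos_def_imp_semidef[OF assms]] psd_root_unique by metis
  from theI'[OF this] show "pos_semidef (msqrt A)" "msqrt A ** msqrt A = A"
    by (auto simp: msqrt_def)
qed

lemma pos_def_invertible:
  fixes A :: "real^'p^'p"
  assumes "pos_def A" shows "invertible A"
proof -
  have "A *v x = 0 \<Longrightarrow> x = 0" for x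
    using assms unfolding pos_def_def by (metis inner_zero_right less_irrefl)
  then show ?thesis by (simp add: invertible_left_inverse matrix_left_invertible_ker)
qed

lemma matrix_inv_inverse:
  fixes A :: "real^'p^'p"
  assumes "invertible A"
  shows "A ** matrix_inv A = mat 1" "matrix_inv A ** A = mat 1"
  using someI_ex[OF assms[unfolded invertible_def]] by (simp_all add: matrix_inv_def)

lemma pos_def_matrix_inv:
  fixes A :: "real^'p^'p"
  assumes A: "pos_def A" shows "pos_def (matrix_inv A)"
proof -
  note inv = matrix_inv_inverse[OF pos_def_invertible[OF A]]
  have sym: "transpose A = A" using A by (simp add: pos_def_def)
  have "transpose (matrix_inv A) ** A = mat 1"
    by (metis inv(1) matrix_transpose_mul sym transpose_mat)
  then have "transpose (matrix_inv A) = matrix_inv A"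
    by (metis inv(1) matrix_mul_assoc matrix_mul_lid matrix_mul_rid)
  moreover have "x \<bullet> (matrix_inv A *v x) > 0" if "x \<noteq> 0" for x
  proof -
    define z where "z = matrix_inv A *v x"
    have Az: "A *v z = x" by (simp add: z_def matrix_vector_mul_assoc inv)
    then have "z \<noteq> 0" using that by auto
    then have "z \<bullet> (A *v z) > 0" using A by (simp add: pos_def_def)
    then show ?thesis by (simp add: Az) (simp add: z_def inner_commute)
  qed
  ultimately show ?thesis by (simp add: pos_def_def)
qed

lemma msqrt_invertible:
  fixes A :: "real^'p^'p"
  assumes "pos_def A" shows "invertible (msqrt A)"
proof -
  have "det (msqrt A) * det (msqrt A) \<noteq> 0"
    using pos_def_invertible[OF assms] msqrt_root(2)[OF assms]
    by (metis det_mul invertible_det_nz)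
  then show ?thesis by (simp add: invertible_det_nz)
qed

text \<open>Writing \<open>B\<close> for the root of \<open>H\<inverse>\<close>, the quadratic form of \<open>H\<close> becomes the identity in
  the coordinates \<open>y \<mapsto> B y\<close>.\<close>

lemma msqrt_inv_whitens:
  fixes H :: "real^'p^'p"
  assumes H: "pos_def H"
  defines "B \<equiv> msqrt (matrix_inv H)"
  shows "(B *v u) \<bullet> (H *v (B *v v)) = u \<bullet> v"
proof -
  note root = msqrt_root[OF pos_def_matrix_inv[OF H], folded B_def]
  have "B ** (B ** H) = mat 1"
    by (simp add: matrix_mul_assoc root matrix_inv_inverse[OF pos_def_invertible[OF H]])
  then have "B ** H ** B = mat 1" using matrix_left_right_inverse by blast
  then have "B *v (H *v (B *v v)) = v"
    by (metis matrix_vector_mul_assoc matrix_vector_mul_lid)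
  moreover have "(B *v u) \<bullet> (H *v (B *v v)) = u \<bullet> (B *v (H *v (B *v v)))"
    using root(1) symmetric_matrix_inner[of B] by (simp add: pos_semidef_def)
  ultimately show ?thesis by simp
qed

text \<open>In the whitened coordinates, the lower bound on the quadratic form of \<open>H\<close> becomes an upper bound
  on the operator norm of \<open>B\<close>.\<close>

lemma norm_msqrt_inv_le:
  fixes H :: "real^'p^'p"
  assumes H: "pos_def H" and c: "c > 0" and lower: "\<And>z. z \<bullet> (H *v z) \<ge> c * (norm z)^2"
  shows "norm (msqrt (matrix_inv H) *v y) \<le> norm y / sqrt c"
proof -
  define z where "z = msqrt (matrix_inv H) *v y"
  have "c * (norm z)^2 \<le> (norm y)^2"
    using lower[of z] msqrt_inv_whitens[OF H, of y y] by (simp add: z_def dot_square_norm)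
  then have "(norm z)^2 \<le> (norm y / sqrt c)^2"
    using c by (simp add: power_divide field_simps)
  moreover have "0 \<le> norm y / sqrt c" using c by simp
  ultimately show ?thesis unfolding z_def by (rule power2_le_imp_le)
qed

section \<open>Gaussian integrals and linear changes of variables\<close>

lemma nn_integral_lborel_translate:
  fixes h :: "'a::euclidean_space \<Rightarrow> ennreal"
  assumes [measurable]: "h \<in> borel_measurable borel"
  shows "(\<integral>\<^sup>+x. h (a + x) \<partial>lborel) = (\<integral>\<^sup>+x. h x \<partial>lborel)"
  by (subst (2) lborel_distr_plus[of a, symmetric]) (simp add: nn_integral_distr)

text \<open>The uniqueness argument for Haar measure. Both \<open>\<lambda>\<close> and its image \<open>\<nu>\<close> are translation invariant, so
  evaluating the double integral of \<open>1\<^sub>U(x) 1\<^sub>X(x + y)\<close> with respect to \<open>\<lambda>(dx) \<nu>(dy)\<close> in two ways gives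
  \<open>\<lambda>(U) \<nu>(X) = \<lambda>(X) \<nu>(U)\<close> for a set \<open>U = - U\<close>. The unit ball has \<open>\<nu>(U) = \<lambda>(U)\<close>, because \<open>f\<close> preserves
  norms.\<close>

lemma lborel_orthogonal_transformation:
  fixes f :: "'a::euclidean_space \<Rightarrow> 'a"
  assumes f: "orthogonal_transformation f"
  shows "distr lborel borel f = lborel"
proof (rule measure_eqI)
  have lin: "linear f" using f by (rule orthogonal_transformation_linear)
  have nf: "norm (f x) = norm x" for x using f by (rule orthogonal_transformation_norm)
  have [measurable]: "f \<in> borel_measurable borel"
    by (intro borel_measurable_continuous_onI linear_continuous_on) (simp add: linear_linear lin)
  fix X :: "'a set" assume "X \<in> sets (distr lborel borel f)"
  then have X[measurable]: "X \<in> sets borel" by simp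
  define U where "U = (ball 0 1 :: 'a set)"
  have U[measurable]: "U \<in> sets borel" by (simp add: U_def)
  have trans: "(\<integral>\<^sup>+y. h (f y + x) \<partial>lborel) = (\<integral>\<^sup>+y. h (f y) \<partial>lborel)"
    if [measurable]: "h \<in> borel_measurable borel" for h :: "'a \<Rightarrow> ennreal" and x
  proof -
    obtain a where "f a = x" using orthogonal_transformation_surj[OF f] by (metis surjD)
    then have "f y + x = f (a + y)" for y using lin by (simp add: linear_add add.commute)
    then show ?thesis using nn_integral_lborel_translate[of "\<lambda>y. h (f y)" a] by simp
  qed
  have "emeasure lborel U * (\<integral>\<^sup>+y. indicator X (f y) \<partial>lborel)
      = (\<integral>\<^sup>+x. indicator U x * (\<integral>\<^sup>+y. indicator X (f y + x) \<partial>lborel) \<partial>lborel)"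
    by (simp add: trans nn_integral_multc)
  also have "\<dots> = (\<integral>\<^sup>+x. \<integral>\<^sup>+y. indicator U x * indicator X (f y + x) \<partial>lborel \<partial>lborel)"
    by (simp add: nn_integral_cmult)
  also have "\<dots> = (\<integral>\<^sup>+y. \<integral>\<^sup>+x. indicator U x * indicator X (f y + x) \<partial>lborel \<partial>lborel)"
    by (rule lborel_pair.Fubini'[symmetric]) simp
  also have "\<dots> = (\<integral>\<^sup>+y. \<integral>\<^sup>+x. indicator U (x - f y) * indicator X x \<partial>lborel \<partial>lborel)"
  proof (rule nn_integral_cong)
    fix y
    show "(\<integral>\<^sup>+x. indicator U x * indicator X (f y + x) \<partial>lborel)
        = (\<integral>\<^sup>+x. indicator U (x - f y) * indicator X x \<partial>lborel)"
      using nn_integral_lborel_translate[of "\<lambda>x. indicator U (x - f y) * indicator X x" "f y"] by simp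
  qed
  also have "\<dots> = (\<integral>\<^sup>+x. \<integral>\<^sup>+y. indicator U (x - f y) * indicator X x \<partial>lborel \<partial>lborel)"
    by (rule lborel_pair.Fubini') simp
  also have "\<dots> = (\<integral>\<^sup>+x. (\<integral>\<^sup>+y. indicator U (f y + (- x)) \<partial>lborel) * indicator X x \<partial>lborel)"
  proof (rule nn_integral_cong)
    fix x
    have "indicator U (x - f y) = (indicator U (f y + (- x)) :: ennreal)" for y
      by (simp add: indicator_def U_def norm_minus_commute)
    then show "(\<integral>\<^sup>+y. indicator U (x - f y) * indicator X x \<partial>lborel)
        = (\<integral>\<^sup>+y. indicator U (f y + (- x)) \<partial>lborel) * indicator X x"
      by (simp add: nn_integral_multc)
  qed
  also have "\<dots> = (\<integral>\<^sup>+x. (\<integral>\<^sup>+y. indicator U (f y) \<partial>lborel) * indicator X x \<partial>lborel)"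
    by (intro nn_integral_cong arg_cong2[where f="(*)"] trans) auto
  also have "\<dots> = emeasure lborel U * emeasure lborel X"
  proof -
    have "indicator U (f y) = (indicator U y :: ennreal)" for y
      by (simp add: U_def nf indicator_def)
    then show ?thesis by (simp add: nn_integral_cmult)
  qed
  finally have "emeasure lborel U * (\<integral>\<^sup>+y. indicator X (f y) \<partial>lborel) = emeasure lborel U * emeasure lborel X" .
  moreover have "emeasure lborel U \<noteq> 0"
    unfolding U_def using content_ball_pos[of 1 "0::'a"] by (auto simp: measure_def)
  moreover have "emeasure lborel U \<noteq> \<top>"
    unfolding U_def using emeasure_lborel_ball_finite by (metis infinity_ennreal_def less_irrefl)
  ultimately have "(\<integral>\<^sup>+y. indicator X (f y) \<partial>lborel) = emeasure lborel X"
    by (metis ennreal_mult_cancel_left)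
  moreover have "(\<integral>\<^sup>+y. indicator X (f y) \<partial>lborel) = emeasure (distr lborel borel f) X"
    using nn_integral_distr[of f lborel borel "indicator X"] by simp
  ultimately show "emeasure (distr lborel borel f) X = emeasure lborel X" by simp
qed simp

lemma Basis_vec_eq_axis: "(Basis :: (real^'p) set) = range (\<lambda>i. axis i 1)"
  by (auto simp: Basis_vec_def)

lemma inj_axis_one: "inj (\<lambda>i. axis i 1 :: real^'p)"
  by (auto simp: inj_def axis_eq_axis)

lemma det_diag_matrix: "det (diag_matrix d) = (\<Prod>i\<in>UNIV. d i)"
  by (subst det_diagonal) (auto simp: diag_matrix_def)

lemma nn_integral_lborel_diag:
  fixes h :: "real^'p \<Rightarrow> ennreal"
  assumes [measurable]: "h \<in> borel_measurable borel" and d: "\<And>i. d i \<noteq> 0"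
  shows "(\<integral>\<^sup>+x. h x \<partial>lborel) = ennreal \<bar>det (diag_matrix d)\<bar> * (\<integral>\<^sup>+x. h (diag_matrix d *v x) \<partial>lborel)"
proof -
  define c where "c = (\<lambda>j::real^'p. j \<bullet> (\<chi> i. d i))"
  have c_axis: "c (axis i 1) = d i" for i by (simp add: c_def inner_axis')
  have T: "0 + (\<Sum>j\<in>Basis. (c j * (x \<bullet> j)) *\<^sub>R j) = diag_matrix d *v x" for x
    unfolding Basis_vec_eq_axis sum.reindex[OF inj_axis_one] o_def c_axis
    by (simp add: inner_axis diag_matrix_mult_vec vec_eq_iff)
      (simp add: axis_def if_distrib[of "\<lambda>a. _ * a"] cong: if_cong)
  have "c j \<noteq> 0" if "j \<in> Basis" for j using that d c_axis by (auto simp: Basis_vec_eq_axis)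
  then have "lborel = density (distr lborel borel (\<lambda>x. 0 + (\<Sum>j\<in>Basis. (c j * (x \<bullet> j)) *\<^sub>R j))) 
      (\<lambda>_. ennreal (\<Prod>j\<in>Basis. \<bar>c j\<bar>))"
    by (rule lborel_affine_euclidean)
  then have *: "lborel = density (distr lborel borel ((*v) (diag_matrix d))) (\<lambda>_. ennreal \<bar>det (diag_matrix d)\<bar>)"
    unfolding T by (simp add: Basis_vec_eq_axis prod.reindex[OF inj_axis_one] c_axis det_diag_matrix abs_prod)
  have [measurable]: "(*v) (diag_matrix d) \<in> borel_measurable borel"
    by (intro borel_measurable_continuous_onI linear_continuous_on) (simp add: linear_linear)
  show ?thesis
    by (subst *) (simp add: nn_integral_density nn_integral_distr nn_integral_cmult)
qed

text \<open>A diagonalisation \<open>B = Q D Q\<^sup>T\<close> splits the map into two rotations, which preserve Lebesgue measure,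
  a coordinatewise scaling, and a translation.\<close>

lemma lborel_symmetric_affine:
  fixes B :: "real^'p^'p"
  assumes sym: "transpose B = B" and inv: "invertible B"
  shows "lborel = density (distr lborel borel (\<lambda>y. m + B *v y)) (\<lambda>_. ennreal \<bar>det B\<bar>)"
proof (rule measure_eqI)
  have mB[measurable]: "(\<lambda>y. A *v y) \<in> borel_measurable borel" for A :: "real^'p^'p"
    by (intro borel_measurable_continuous_onI linear_continuous_on) (simp add: linear_linear)
  obtain Q d where Q: "orthogonal_matrix Q" and BQ: "B = Q ** diag_matrix d ** transpose Q"
    using symmetric_diagonalisation[OF sym] .
  have detQ: "\<bar>det Q\<bar> = 1" using det_orthogonal_matrix[OF Q] by auto
  have det: "\<bar>det B\<bar> = \<bar>det (diag_matrix d)\<bar>" by (simp add: BQ det_mul abs_mult detQ)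
  then have "det (diag_matrix d) \<noteq> 0" using inv by (auto simp: invertible_det_nz)
  then have d: "d i \<noteq> 0" for i by (auto simp: det_diag_matrix)
  have orth: "orthogonal_transformation ((*v) Q)" "orthogonal_transformation ((*v) (transpose Q))"
    using Q by (simp_all add: orthogonal_transformation_matrix orthogonal_matrix_transpose)
  have Qint: "(\<integral>\<^sup>+x. h (A *v x) \<partial>lborel) = (\<integral>\<^sup>+x. h x \<partial>lborel)"
    if "orthogonal_transformation ((*v) A)" and [measurable]: "h \<in> borel_measurable borel"
    for A :: "real^'p^'p" and h :: "real^'p \<Rightarrow> ennreal"
    by (subst (2) lborel_orthogonal_transformation[OF that(1), symmetric]) (simp add: nn_integral_distr)
  have [measurable]: "(\<lambda>y. m + B *v y) \<in> borel_measurable borel" by measurable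
  fix X :: "(real^'p) set" assume "X \<in> sets lborel"
  then have X[measurable]: "X \<in> sets borel" by simp
  define h where "h = (\<lambda>x. indicator X x :: ennreal)"
  have [measurable]: "h \<in> borel_measurable borel" by (simp add: h_def)
  have "(\<integral>\<^sup>+x. h x \<partial>lborel) = (\<integral>\<^sup>+x. h (m + x) \<partial>lborel)"
    by (simp add: nn_integral_lborel_translate)
  also have "\<dots> = (\<integral>\<^sup>+x. h (m + Q *v x) \<partial>lborel)"
    by (rule Qint[OF orth(1), symmetric]) simp
  also have "\<dots> = ennreal \<bar>det B\<bar> * (\<integral>\<^sup>+x. h (m + Q *v (diag_matrix d *v x)) \<partial>lborel)"
    unfolding det by (rule nn_integral_lborel_diag[OF _ d]) simp
  also have "\<dots> = ennreal \<bar>det B\<bar> * (\<integral>\<^sup>+x. h (m + Q *v (diag_matrix d *v (transpose Q *v x))) \<partial>lborel)"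
    by (subst Qint[OF orth(2)]) simp_all
  also have "\<dots> = ennreal \<bar>det B\<bar> * (\<integral>\<^sup>+x. h (m + B *v x) \<partial>lborel)"
    by (simp only: BQ matrix_vector_mul_assoc matrix_mul_assoc)
  finally have "emeasure lborel X = ennreal \<bar>det B\<bar> * (\<integral>\<^sup>+x. h (m + B *v x) \<partial>lborel)"
    by (simp add: h_def)
  moreover have "(\<integral>\<^sup>+x. h (m + B *v x) \<partial>lborel) = emeasure (distr lborel borel (\<lambda>y. m + B *v y)) X"
    using nn_integral_distr[of "\<lambda>y. m + B *v y" lborel borel h] by (simp add: h_def)
  ultimately show "emeasure lborel X = emeasure (density (distr lborel borel (\<lambda>y. m + B *v y)) (\<lambda>_. ennreal \<bar>det B\<bar>)) X"
    by (simp add: emeasure_density nn_integral_cmult)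
qed simp

lemma
  fixes B :: "real^'p^'p" and h :: "real^'p \<Rightarrow> real"
  assumes sym: "transpose B = B" and inv: "invertible B"
    and [measurable]: "h \<in> borel_measurable borel"
  shows integrable_symmetric_affine:
      "integrable lborel h \<longleftrightarrow> integrable lborel (\<lambda>y. h (m + B *v y))"
    and integral_symmetric_affine:
      "(\<integral>x. h x \<partial>lborel) = \<bar>det B\<bar> * (\<integral>y. h (m + B *v y) \<partial>lborel)"
proof -
  have [measurable]: "(\<lambda>y. m + B *v y) \<in> borel_measurable borel"
    by (intro borel_measurable_continuous_onI continuous_intros linear_continuous_on)
      (simp add: linear_linear)
  have nz: "det B \<noteq> 0" using inv by (simp add: invertible_det_nz)
  show "integrable lborel h \<longleftrightarrow> integrable lborel (\<lambda>y. h (m + B *v y))"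
    using nz by (subst lborel_symmetric_affine[OF sym inv, of m])
      (simp add: integrable_density integrable_distr_eq)
  show "(\<integral>x. h x \<partial>lborel) = \<bar>det B\<bar> * (\<integral>y. h (m + B *v y) \<partial>lborel)"
    by (subst lborel_symmetric_affine[OF sym inv, of m])
      (simp add: integral_density integral_distr)
qed

lemma norm_sq_Basis: "(norm x)\<^sup>2 = (\<Sum>b\<in>Basis. (x \<bullet> b)\<^sup>2)" for x :: "'a::euclidean_space"
  by (subst power2_norm_eq_inner, subst euclidean_inner) (simp add: power2_eq_square)

lemma has_bochner_integral_gaussian:
  "has_bochner_integral lborel (\<lambda>x::'a::euclidean_space. exp (- (norm x)\<^sup>2 / 2)) (sqrt (2 * pi) ^ DIM('a))"
proof (rule has_bochner_integral_nn_integral)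
  have 1: "(\<integral>\<^sup>+x. ennreal (exp (- (x::real)\<^sup>2 / 2)) \<partial>lborel) = ennreal (sqrt (2 * pi))"
  proof -
    have "(\<integral>\<^sup>+x. ennreal (exp (- (x::real)\<^sup>2 / 2)) \<partial>lborel)
      = (\<integral>\<^sup>+x. ennreal (sqrt (2 * pi)) * ennreal (std_normal_density x) \<partial>lborel)"
      by (intro nn_integral_cong) (simp add: std_normal_density_def ennreal_mult'[symmetric])
    also have "\<dots> = ennreal (sqrt (2 * pi)) * (\<integral>\<^sup>+x. ennreal (std_normal_density x) \<partial>lborel)"
      by (simp add: nn_integral_cmult)
    also have "(\<integral>\<^sup>+x. ennreal (std_normal_density x) \<partial>lborel) = 1"
      by (subst nn_integral_eq_integral) auto
    finally show ?thesis by simp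
  qed
  have "(\<integral>\<^sup>+x. ennreal (exp (- (norm (x::'a))\<^sup>2 / 2)) \<partial>lborel)
    = (\<integral>\<^sup>+x. (\<Prod>b\<in>Basis. ennreal (exp (- ((x::'a) \<bullet> b)\<^sup>2 / 2))) \<partial>lborel)"
    by (intro nn_integral_cong)
      (simp add: prod_ennreal norm_sq_Basis exp_sum[symmetric] sum_negf sum_divide_distrib)
  also have "\<dots> = ennreal (sqrt (2 * pi) ^ DIM('a))"
    by (subst nn_integral_lborel_prod) (simp_all add: 1[simplified] ennreal_power)
  finally show "(\<integral>\<^sup>+x. ennreal (exp (- (norm (x::'a))\<^sup>2 / 2)) \<partial>lborel) = ennreal (sqrt (2 * pi) ^ DIM('a))" .
qed auto

lemma integrable_exp_neg_norm:
  assumes a: "a > 0"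
  shows "integrable lborel (\<lambda>x::'a::euclidean_space. exp (- a * norm x))"
proof -
  define k where "k = a / real DIM('a)"
  have k: "k > 0" using a by (simp add: k_def)
  have 1: "(\<integral>\<^sup>+x. ennreal (exp (- k * \<bar>x::real\<bar>)) \<partial>lborel) < \<infinity>"
  proof -
    have "(\<integral>\<^sup>+x. ennreal (exp (- k * \<bar>x::real\<bar>)) \<partial>lborel)
      \<le> (\<integral>\<^sup>+x. ennreal (exponential_density k x / k) + ennreal (exponential_density k (-x) / k) \<partial>lborel)"
      using k by (intro nn_integral_mono) (auto simp: exponential_density_def)
    also have "\<dots> < \<infinity>"
    proof -
      have i: "integrable lborel (exponential_density k)"
        using prob_space_exponential_density[OF k]
        by (intro integrableI_nonneg) (auto simp: prob_space_def prob_space_axioms_def emeasure_density exponential_density_nonneg k less_imp_le)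
      then have "integrable lborel (\<lambda>x. exponential_density k (-x))"
        using lborel_integrable_real_affine[of "exponential_density k" "-1" 0] by simp
      then have "integrable lborel (\<lambda>x. exponential_density k x / k + exponential_density k (-x) / k)"
        using i by simp
      then have "(\<integral>\<^sup>+x. ennreal (exponential_density k x / k + exponential_density k (-x) / k) \<partial>lborel) < \<infinity>"
        using k by (subst nn_integral_eq_integral) (auto simp: exponential_density_nonneg less_imp_le)
      then show ?thesis using k by (simp add: ennreal_plus exponential_density_nonneg)
    qed
    finally show ?thesis .
  qed
  have "(\<integral>\<^sup>+x. ennreal (exp (- a * norm (x::'a))) \<partial>lborel)
    \<le> (\<integral>\<^sup>+x. (\<Prod>b\<in>Basis. ennreal (exp (- k * \<bar>(x::'a) \<bullet> b\<bar>))) \<partial>lborel)"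
  proof (intro nn_integral_mono)
    fix x :: 'a
    have "(\<Sum>b\<in>Basis. \<bar>x \<bullet> b\<bar>) \<le> (\<Sum>b\<in>(Basis::'a set). norm x)"
      by (intro sum_mono Basis_le_norm)
    then have "k * (\<Sum>b\<in>Basis. \<bar>x \<bullet> b\<bar>) \<le> a * norm x"
      using k mult_left_mono[of "(\<Sum>b\<in>Basis. \<bar>x \<bullet> b\<bar>)" "real DIM('a) * norm x" k]
      by (simp add: k_def)
    then show "ennreal (exp (- a * norm x)) \<le> (\<Prod>b\<in>Basis. ennreal (exp (- k * \<bar>x \<bullet> b\<bar>)))"
      by (simp add: prod_ennreal exp_sum[symmetric] sum_negf sum_distrib_left)
  qed
  also have "\<dots> < \<infinity>"
    using 1 by (subst nn_integral_lborel_prod) (auto simp: less_top[symmetric] power_eq_top_ennreal)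
  finally show ?thesis by (intro integrableI_nonneg) auto
qed

lemma power_le_exp:
  fixes t :: real assumes "t \<ge> 0" "a > 0" shows "t ^ k \<le> fact k / a ^ k * exp (a * t)"
proof -
  have "(a * t) ^ k / fact k \<le> exp (a * t)"
    using sum_le_suminf[OF summable_exp_generic, of "{k}" "a * t"] assms
    by (simp add: exp_def divide_inverse mult.commute)
  then show ?thesis using assms by (simp add: field_simps power_mult_distrib)
qed

lemma integrable_norm_power_exp:
  assumes a: "a > 0"
  shows "integrable lborel (\<lambda>x::'a::euclidean_space. norm x ^ k * exp (- a * norm x))"
proof (rule Bochner_Integration.integrable_bound)
  show "integrable lborel (\<lambda>x::'a. fact k / (a/2) ^ k * exp (- (a/2) * norm x))"
    using a by (intro integrable_mult_right integrable_exp_neg_norm) auto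
  show "AE x in lborel. norm (norm x ^ k * exp (- a * norm (x::'a)))
      \<le> norm (fact k / (a/2) ^ k * exp (- (a/2) * norm x))"
  proof (rule AE_I2)
    fix x :: 'a
    have "norm x ^ k * exp (- a * norm x) \<le> (fact k / (a/2) ^ k * exp ((a/2) * norm x)) * exp (- a * norm x)"
      using a by (intro mult_right_mono power_le_exp) auto
    also have "\<dots> = fact k / (a/2) ^ k * exp (- (a/2) * norm x)"
      by (simp add: mult.assoc exp_add[symmetric])
    finally show "norm (norm x ^ k * exp (- a * norm x)) \<le> norm (fact k / (a/2) ^ k * exp (- (a/2) * norm x))"
      using a by simp
  qed
qed simp

section \<open>Differential calculus with directional derivatives\<close>

lemma has_derivative_D1:
  assumes "f differentiable_on UNIV"
  shows "(f has_derivative D1 f x) (at x)"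
proof -
  have "f differentiable (at x)" using assms by (simp add: differentiable_on_def)
  then show ?thesis by (simp add: frechet_derivative_works D1_def[abs_def])
qed

lemma D1_eqI: "(f has_derivative F) (at x) \<Longrightarrow> D1 f x u = F u"
  by (simp add: D1_def frechet_derivative_at[symmetric])

lemma differentiable_on_UNIV_I: "(\<And>x. (f has_derivative F x) (at x)) \<Longrightarrow> f differentiable_on UNIV"
  by (auto simp: differentiable_on_def differentiable_def)

lemma linear_D1: "f differentiable_on UNIV \<Longrightarrow> linear (D1 f x)"
  using has_derivative_D1 has_derivative_linear by blast

lemma continuous_on_UNIV_differentiable: "f differentiable_on UNIV \<Longrightarrow> continuous_on UNIV f"
  by (rule differentiable_imp_continuous_on)

lemma
  fixes f g :: "real^'p \<Rightarrow> real"
  assumes "f differentiable_on UNIV" "g differentiable_on UNIV"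
  shows differentiable_lincomb: "(\<lambda>x. a * f x + b * g x) differentiable_on UNIV"
    and D1_lincomb: "D1 (\<lambda>x. a * f x + b * g x) x u = a * D1 f x u + b * D1 g x u"
proof -
  have *: "((\<lambda>x. a * f x + b * g x) has_derivative (\<lambda>u. a * D1 f x u + b * D1 g x u)) (at x)" for x
    by (auto intro!: derivative_eq_intros has_derivative_D1 assms)
  show "(\<lambda>x. a * f x + b * g x) differentiable_on UNIV" using * by (rule differentiable_on_UNIV_I)
  show "D1 (\<lambda>x. a * f x + b * g x) x u = a * D1 f x u + b * D1 g x u" using * by (rule D1_eqI)
qed

lemma
  fixes f :: "real^'p \<Rightarrow> real" and A :: "real^'p^'p"
  assumes "f differentiable_on UNIV"
  shows differentiable_affine: "(\<lambda>y. f (m + A *v y)) differentiable_on UNIV"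
    and D1_affine: "D1 (\<lambda>y. f (m + A *v y)) y u = D1 f (m + A *v y) (A *v u)"
proof -
  have *: "((\<lambda>y. f (m + A *v y)) has_derivative (\<lambda>u. D1 f (m + A *v y) (A *v u))) (at y)" for y
  proof -
    have "((\<lambda>y. m + A *v y) has_derivative (\<lambda>u. A *v u)) (at y)"
      by (auto intro!: derivative_eq_intros linear_imp_has_derivative)
    from diff_chain_at[OF this has_derivative_D1[OF assms]] show ?thesis by (simp add: o_def)
  qed
  show "(\<lambda>y. f (m + A *v y)) differentiable_on UNIV" using * by (rule differentiable_on_UNIV_I)
  show "D1 (\<lambda>y. f (m + A *v y)) y u = D1 f (m + A *v y) (A *v u)" using * by (rule D1_eqI)
qed

lemma three_times_differentiableD:
  assumes "three_times_differentiable f"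
  shows "f differentiable_on UNIV" "(\<lambda>x. D1 f x u) differentiable_on UNIV"
    "(\<lambda>x. D2 f x u v) differentiable_on UNIV"
  using assms by (auto simp: three_times_differentiable_def)

lemma D2_eq_D1: "D2 f x u v = D1 (\<lambda>y. D1 f y u) x v"
  by (simp add: D1_def D2_def)

lemma D3_eq_D1: "D3 f x u v w = D1 (\<lambda>y. D2 f y u v) x w"
  by (simp add: D1_def D3_def)

lemma
  fixes f :: "real^'p \<Rightarrow> real" and A :: "real^'p^'p"
  assumes f: "three_times_differentiable f"
  shows three_times_differentiable_affine: "three_times_differentiable (\<lambda>y. f (m + A *v y))"
    and D2_affine: "D2 (\<lambda>y. f (m + A *v y)) y u v = D2 f (m + A *v y) (A *v u) (A *v v)"
proof -
  note d = three_times_differentiableD[OF f]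
  have 1: "D1 (\<lambda>y. f (m + A *v y)) y u = D1 f (m + A *v y) (A *v u)" for y u
    by (rule D1_affine[OF d(1)])
  have 2: "D2 (\<lambda>y. f (m + A *v y)) y u v = D2 f (m + A *v y) (A *v u) (A *v v)" for y u v
    unfolding D2_eq_D1 1 by (rule D1_affine[OF d(2)])
  show "D2 (\<lambda>y. f (m + A *v y)) y u v = D2 f (m + A *v y) (A *v u) (A *v v)" by (rule 2)
  show "three_times_differentiable (\<lambda>y. f (m + A *v y))"
    unfolding three_times_differentiable_def 1 2
    by (auto intro: differentiable_affine d)
qed

lemma
  assumes f: "three_times_differentiable f" and g: "three_times_differentiable g"
  shows three_times_differentiable_add: "three_times_differentiable (\<lambda>x. f x + g x)"
    and D1_add: "D1 (\<lambda>x. f x + g x) x u = D1 f x u + D1 g x u"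
    and D2_add: "D2 (\<lambda>x. f x + g x) x u v = D2 f x u v + D2 g x u v"
proof -
  note d = three_times_differentiableD[OF f] three_times_differentiableD[OF g]
  have 1: "D1 (\<lambda>x. f x + g x) x u = D1 f x u + D1 g x u" for x u
    using D1_lincomb[OF d(1,4), of 1 1] by simp
  have 2: "D2 (\<lambda>x. f x + g x) x u v = D2 f x u v + D2 g x u v" for x u v
    unfolding D2_eq_D1 1 using D1_lincomb[OF d(2,5), of 1 _ 1] by simp
  show "D1 (\<lambda>x. f x + g x) x u = D1 f x u + D1 g x u" by (rule 1)
  show "D2 (\<lambda>x. f x + g x) x u v = D2 f x u v + D2 g x u v" by (rule 2)
  show "three_times_differentiable (\<lambda>x. f x + g x)"
    unfolding three_times_differentiable_def 1 2
    by (auto intro!: derivative_intros d)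
qed

lemma linear_D2:
  assumes f: "three_times_differentiable f"
  shows "linear (\<lambda>v. D2 f x u v)" "linear (\<lambda>u. D2 f x u v)"
proof -
  note d = three_times_differentiableD[OF f]
  show "linear (\<lambda>v. D2 f x u v)"
    unfolding D2_eq_D1 by (rule linear_D1[OF d(2)])
  have "D1 f y (a *\<^sub>R u + b *\<^sub>R u') = a * D1 f y u + b * D1 f y u'" for y a b u u'
    using linear_D1[OF d(1), of y] by (simp add: linear_add linear_scale)
  then have *: "D2 f x (a *\<^sub>R u + b *\<^sub>R u') v = a * D2 f x u v + b * D2 f x u' v" for a b u u'
    unfolding D2_eq_D1 by (simp add: D1_lincomb d)
  show "linear (\<lambda>u. D2 f x u v)"
    using *[of 1 _ 1] *[of _ _ 0] by (intro linearI) simp_all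
qed

lemma vec_axis_expansion: "u = (\<Sum>i\<in>UNIV. u $ i *\<^sub>R axis i 1)" for u :: "real^'p"
  by (simp add: vec_eq_iff axis_def if_distrib[of "\<lambda>a. _ * a"] cong: if_cong)

lemma D1_eq_grad:
  assumes "f differentiable_on UNIV"
  shows "D1 f x u = grad f x \<bullet> u"
proof -
  have "D1 f x u = (\<Sum>i\<in>UNIV. u $ i * D1 f x (axis i 1))"
    by (subst (1) vec_axis_expansion) (simp add: linear_sum linear_scale linear_D1[OF assms])
  then show ?thesis by (simp add: grad_def inner_vec_def mult.commute)
qed

lemma D2_eq_hessian:
  assumes f: "three_times_differentiable f"
  shows "D2 f x u v = u \<bullet> (hessian f x *v v)"
proof -
  have "D2 f x u v = (\<Sum>i\<in>UNIV. u $ i * D2 f x (axis i 1) v)"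
    by (subst (1) vec_axis_expansion[of u]) (simp add: linear_sum[OF linear_D2(2)[OF f]] linear_scale[OF linear_D2(2)[OF f]])
  also have "\<dots> = (\<Sum>i\<in>UNIV. u $ i * (\<Sum>j\<in>UNIV. v $ j * D2 f x (axis i 1) (axis j 1)))"
    by (subst (1) vec_axis_expansion[of v]) (simp add: linear_sum[OF linear_D2(1)[OF f]] linear_scale[OF linear_D2(1)[OF f]])
  finally show ?thesis
    by (simp add: hessian_def inner_vec_def matrix_vector_mult_def mult.commute)
qed

lemma has_real_derivative_ray:
  fixes g :: "real^'p \<Rightarrow> real"
  assumes "g differentiable_on UNIV"
  shows "((\<lambda>t. g (x + t *\<^sub>R w)) has_real_derivative D1 g (x + t *\<^sub>R w) w) (at t)"
proof -
  have "((\<lambda>t. x + t *\<^sub>R w) has_derivative (\<lambda>s. s *\<^sub>R w)) (at t)"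
    by (auto intro!: derivative_eq_intros)
  from diff_chain_at[OF this has_derivative_D1[OF assms]]
  have "((\<lambda>t. g (x + t *\<^sub>R w)) has_derivative (\<lambda>s. D1 g (x + t *\<^sub>R w) (s *\<^sub>R w))) (at t)"
    by (simp add: o_def)
  moreover have "(\<lambda>s. D1 g (x + t *\<^sub>R w) (s *\<^sub>R w)) = (*) (D1 g (x + t *\<^sub>R w) w)"
    using linear_D1[OF assms] by (auto simp: linear_scale mult.commute)
  ultimately show ?thesis by (simp add: has_field_derivative_def)
qed

lemma difference_quotient_tendsto_D1:
  fixes g :: "real^'p \<Rightarrow> real"
  assumes "g differentiable_on UNIV"
  shows "((\<lambda>t. (g (x + t *\<^sub>R w) - g x) / t) \<longlongrightarrow> D1 g x w) (at 0)"
  using has_real_derivative_ray[OF assms, of x w 0] by (simp add: DERIV_def)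

definition forward_diff :: "real^'p \<Rightarrow> (real^'p \<Rightarrow> real) \<Rightarrow> real^'p \<Rightarrow> real" where
  "forward_diff u f x = f (x + u) - f x"

lemma
  fixes f :: "real^'p \<Rightarrow> real"
  assumes "f differentiable_on UNIV"
  shows differentiable_forward_diff: "forward_diff u f differentiable_on UNIV"
    and D1_forward_diff: "D1 (forward_diff u f) x w = forward_diff u (\<lambda>x. D1 f x w) x"
proof -
  have shift: "(\<lambda>x. f (x + u)) differentiable_on UNIV" "D1 (\<lambda>x. f (x + u)) x w = D1 f (x + u) w" for x
    using differentiable_affine[OF assms, of u "mat 1"] D1_affine[OF assms, of u "mat 1"]
    by (simp_all add: add.commute)
  show "forward_diff u f differentiable_on UNIV"
    using differentiable_lincomb[OF shift(1) assms, of 1 "-1"] by (simp add: forward_diff_def[abs_def])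
  show "D1 (forward_diff u f) x w = forward_diff u (\<lambda>x. D1 f x w) x"
    using D1_lincomb[OF shift(1) assms, of 1 "-1"] by (simp add: forward_diff_def[abs_def] shift(2))
qed

lemma forward_diff_mvt:
  fixes g :: "real^'p \<Rightarrow> real"
  assumes "g differentiable_on UNIV"
  shows "\<exists>s\<in>{0<..<1}. forward_diff w g x = D1 g (x + s *\<^sub>R w) w"
  using MVT2[of 0 1 "\<lambda>t. g (x + t *\<^sub>R w)" "\<lambda>t. D1 g (x + t *\<^sub>R w) w"] has_real_derivative_ray[OF assms]
  by (auto simp: forward_diff_def)

lemma forward_diff_bound:
  fixes g :: "real^'p \<Rightarrow> real"
  assumes "g differentiable_on UNIV" "\<And>y. \<bar>D1 g y w\<bar> \<le> c"
  shows "\<bar>forward_diff w g x\<bar> \<le> c"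
  using forward_diff_mvt[OF assms(1)] assms(2) by metis

lemma D1_bound:
  fixes g :: "real^'p \<Rightarrow> real"
  assumes g: "g differentiable_on UNIV" and b: "\<And>t. t > 0 \<Longrightarrow> \<bar>forward_diff (t *\<^sub>R w) g x\<bar> \<le> c * t"
  shows "\<bar>D1 g x w\<bar> \<le> c"
proof (rule tendsto_upperbound)
  show "((\<lambda>t. \<bar>(g (x + t *\<^sub>R w) - g x) / t\<bar>) \<longlongrightarrow> \<bar>D1 g x w\<bar>) (at_right 0)"
    by (intro tendsto_rabs tendsto_within_subset[OF difference_quotient_tendsto_D1[OF g]] subset_UNIV)
  show "\<forall>\<^sub>F t in at_right 0. \<bar>(g (x + t *\<^sub>R w) - g x) / t\<bar> \<le> c"
    using eventually_at_right_less[of 0]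
  proof eventually_elim
    case (elim t)
    then show ?case using b[of t] by (simp add: forward_diff_def abs_divide divide_le_eq)
  qed
qed simp

definition third_diff :: "(real^'p \<Rightarrow> real) \<Rightarrow> real^'p \<Rightarrow> real^'p \<Rightarrow> real^'p \<Rightarrow> real^'p \<Rightarrow> real" where
  "third_diff f x u v w = forward_diff w (forward_diff v (forward_diff u f)) x"

text \<open>Third differences are used in place of third derivatives because they are linear functionals of
  the values of \<open>f\<close>, hence behave well under sums and affine substitutions and are measurable in \<open>f\<close>.\<close>

definition third_bounded :: "(real^'p \<Rightarrow> real) \<Rightarrow> real \<Rightarrow> bool" where
  "third_bounded f L \<longleftrightarrow> (\<forall>x u v w. \<bar>third_diff f x u v w\<bar> \<le> L * (norm u * norm v * norm w))"

text \<open>Third derivatives and third differences control each other: three applications of the mean value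
  theorem in one direction, three limits of difference quotients in the other. The order of the
  arguments is reversed in each passage, which is harmless as the bound is symmetric.\<close>

lemma third_bounded_if_D3_bounded:
  assumes f: "three_times_differentiable f"
    and b: "\<And>x u v w. \<bar>D3 f x u v w\<bar> \<le> L * (norm u * norm v * norm w)"
  shows "third_bounded f L"
proof -
  note d = three_times_differentiableD[OF f]
  have "\<bar>third_diff f x u v w\<bar> \<le> L * (norm w * norm v * norm u)" for x u v w
    unfolding third_diff_def
    by (intro forward_diff_bound differentiable_forward_diff d)
      (simp add: D1_forward_diff differentiable_forward_diff d,
        intro forward_diff_bound differentiable_forward_diff d,
        simp add: D1_forward_diff d D2_eq_D1[symmetric],
        intro forward_diff_bound d, simp add: D3_eq_D1[symmetric] b)
  then show ?thesis by (simp add: third_bounded_def mult_ac)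
qed

lemma third_bounded_imp:
  assumes f: "three_times_differentiable f" and b: "third_bounded f L"
  shows forward_diff_D2_bounded: "\<bar>forward_diff u (\<lambda>x. D2 f x w v) x\<bar> \<le> L * (norm u * norm v * norm w)"
    and D3_bounded: "\<bar>D3 f x w v u\<bar> \<le> L * (norm u * norm v * norm w)"
proof -
  note d = three_times_differentiableD[OF f]
  have 1: "\<bar>forward_diff v (forward_diff u (\<lambda>x. D1 f x w)) x\<bar> \<le> L * (norm u * norm v * norm w)" for x u v w
  proof -
    have "\<bar>D1 (forward_diff v (forward_diff u f)) x w\<bar> \<le> L * (norm u * norm v * norm w)"
    proof (rule D1_bound)
      fix t :: real assume "t > 0"
      then show "\<bar>forward_diff (t *\<^sub>R w) (forward_diff v (forward_diff u f)) x\<bar> \<le> L * (norm u * norm v * norm w) * t"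
        using b[unfolded third_bounded_def, rule_format, of x u v "t *\<^sub>R w"]
        by (simp add: third_diff_def mult_ac)
    qed (intro differentiable_forward_diff d)
    then show ?thesis by (simp add: D1_forward_diff differentiable_forward_diff d)
  qed
  have 2: "\<bar>forward_diff u (\<lambda>x. D2 f x w v) x\<bar> \<le> L * (norm u * norm v * norm w)" for x u v w
  proof -
    have "\<bar>D1 (forward_diff u (\<lambda>x. D1 f x w)) x v\<bar> \<le> L * (norm u * norm v * norm w)"
    proof (rule D1_bound)
      fix t :: real assume "t > 0"
      then show "\<bar>forward_diff (t *\<^sub>R v) (forward_diff u (\<lambda>x. D1 f x w)) x\<bar> \<le> L * (norm u * norm v * norm w) * t"
        using 1[of "t *\<^sub>R v" u w x] by (simp add: mult_ac)
    qed (intro differentiable_forward_diff d)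
    then show ?thesis by (simp add: D1_forward_diff d D2_eq_D1)
  qed
  show "\<bar>forward_diff u (\<lambda>x. D2 f x w v) x\<bar> \<le> L * (norm u * norm v * norm w)" by (rule 2)
  show "\<bar>D3 f x w v u\<bar> \<le> L * (norm u * norm v * norm w)"
    unfolding D3_eq_D1
  proof (rule D1_bound)
    fix t :: real assume "t > 0"
    then show "\<bar>forward_diff (t *\<^sub>R u) (\<lambda>x. D2 f x w v) x\<bar> \<le> L * (norm u * norm v * norm w) * t"
      using 2[of "t *\<^sub>R u" w v x] by (simp add: mult_ac)
  qed (intro d)
qed

lemma third_bounded_affine:
  fixes f :: "real^'p \<Rightarrow> real" and A :: "real^'p^'p"
  assumes b: "third_bounded f L" and L: "L \<ge> 0" and A: "\<And>y. norm (A *v y) \<le> k * norm y"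
  shows "third_bounded (\<lambda>y. f (m + A *v y)) (L * k ^ 3)"
  unfolding third_bounded_def
proof (intro allI)
  fix x u v w
  have "third_diff (\<lambda>y. f (m + A *v y)) x u v w = third_diff f (m + A *v x) (A *v u) (A *v v) (A *v w)"
    by (simp add: third_diff_def forward_diff_def matrix_vector_right_distrib add.assoc)
  then have "\<bar>third_diff (\<lambda>y. f (m + A *v y)) x u v w\<bar> \<le> L * (norm (A *v u) * norm (A *v v) * norm (A *v w))"
    using b by (simp add: third_bounded_def)
  also have "\<dots> \<le> L * ((k * norm u) * (k * norm v) * (k * norm w))"
  proof -
    have "0 \<le> k * norm (axis undefined 1 :: real^'p)" using A norm_ge_zero order_trans by blast
    then have "k \<ge> 0" by simp
    then show ?thesis by (intro mult_left_mono[OF _ L] mult_mono A mult_nonneg_nonneg) auto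
  qed
  finally show "\<bar>third_diff (\<lambda>y. f (m + A *v y)) x u v w\<bar> \<le> L * k ^ 3 * (norm u * norm v * norm w)"
    by (simp add: power3_eq_cube mult_ac)
qed

lemma third_bounded_add:
  assumes "third_bounded f a" "third_bounded g b"
  shows "third_bounded (\<lambda>x. f x + g x) (a + b)"
  unfolding third_bounded_def
proof (intro allI)
  fix x u v w
  have "third_diff (\<lambda>x. f x + g x) x u v w = third_diff f x u v w + third_diff g x u v w"
    by (simp add: third_diff_def forward_diff_def)
  then have "\<bar>third_diff (\<lambda>x. f x + g x) x u v w\<bar> \<le> \<bar>third_diff f x u v w\<bar> + \<bar>third_diff g x u v w\<bar>"
    by simp
  also have "\<dots> \<le> a * (norm u * norm v * norm w) + b * (norm u * norm v * norm w)"
    using assms unfolding third_bounded_def by (intro add_mono) blast+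
  finally show "\<bar>third_diff (\<lambda>x. f x + g x) x u v w\<bar> \<le> (a + b) * (norm u * norm v * norm w)"
    by (simp add: distrib_right)
qed

lemma third_bounded_mono:
  "third_bounded f a \<Longrightarrow> a \<le> b \<Longrightarrow> third_bounded f b"
  unfolding third_bounded_def
  by (meson mult_right_mono mult_nonneg_nonneg norm_ge_zero order_trans)

lemma forward_diff_commute: "forward_diff v (forward_diff u f) x = forward_diff u (forward_diff v f) x"
  by (simp add: forward_diff_def algebra_simps)

lemma second_diff_mvt:
  assumes f: "three_times_differentiable f"
  shows "\<exists>z. norm z \<le> norm u + norm v \<and> forward_diff v (forward_diff u f) x = D2 f (x + z) v u"
proof -
  note d = three_times_differentiableD[OF f]
  obtain s where s: "s \<in> {0<..<1}" "forward_diff v (forward_diff u f) x = forward_diff u (\<lambda>x. D1 f x v) (x + s *\<^sub>R v)"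
    using forward_diff_mvt[OF differentiable_forward_diff[OF d(1)]] D1_forward_diff[OF d(1)] by metis
  obtain r where r: "r \<in> {0<..<1}" "forward_diff u (\<lambda>x. D1 f x v) (x + s *\<^sub>R v) = D2 f (x + s *\<^sub>R v + r *\<^sub>R u) v u"
    using forward_diff_mvt[OF d(2)] unfolding D2_eq_D1 by metis
  have "norm (s *\<^sub>R v + r *\<^sub>R u) \<le> s * norm v + r * norm u"
    using s(1) r(1) norm_triangle_ineq[of "s *\<^sub>R v" "r *\<^sub>R u"] by simp
  also have "\<dots> \<le> norm u + norm v"
    using s(1) r(1) by (simp add: add.commute add_mono mult_left_le_one_le)
  finally show ?thesis using s r by (metis add.assoc)
qed

text \<open>The second difference is symmetric in its two increments and is a value of the second derivative at
  a nearby point, with either order of the increments. The third-difference bound makes the second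
  derivative Lipschitz, so shrinking the increments gives symmetry at the point itself.\<close>

lemma D2_symmetric:
  assumes f: "three_times_differentiable f" and b: "third_bounded f L"
  shows "D2 f x u v = D2 f x v u"
proof -
  define c where "c = 2 * L * (norm u * norm v * (norm u + norm v))"
  have L: "L \<ge> 0"
    using order_trans[OF abs_ge_zero b[unfolded third_bounded_def, rule_format, of x "axis undefined 1" "axis undefined 1" "axis undefined 1"]] by simp
  have near: "\<bar>forward_diff v (forward_diff u f) x - D2 f x v u\<bar> \<le> L * (norm u * norm v * (norm u + norm v))" for u v
  proof -
    obtain z where z: "norm z \<le> norm u + norm v" "forward_diff v (forward_diff u f) x = D2 f (x + z) v u"
      using second_diff_mvt[OF f] by blast
    have "\<bar>D2 f (x + z) v u - D2 f x v u\<bar> \<le> L * (norm z * norm u * norm v)"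
      using forward_diff_D2_bounded[OF f b, of z v u x] by (simp add: forward_diff_def)
    also have "\<dots> \<le> L * ((norm u + norm v) * norm u * norm v)"
      using L z(1) by (intro mult_left_mono mult_right_mono) auto
    finally show ?thesis using z(2) by (simp add: mult_ac)
  qed
  have "\<bar>D2 f x v u - D2 f x u v\<bar> \<le> c * t" if "t > 0" for t
  proof -
    have "\<bar>D2 f x (t *\<^sub>R v) (t *\<^sub>R u) - D2 f x (t *\<^sub>R u) (t *\<^sub>R v)\<bar>
      \<le> L * (norm (t *\<^sub>R u) * norm (t *\<^sub>R v) * (norm (t *\<^sub>R u) + norm (t *\<^sub>R v)))
       + L * (norm (t *\<^sub>R v) * norm (t *\<^sub>R u) * (norm (t *\<^sub>R v) + norm (t *\<^sub>R u)))"
      using near[of "t *\<^sub>R v" "t *\<^sub>R u"] near[of "t *\<^sub>R u" "t *\<^sub>R v"]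
        forward_diff_commute[of "t *\<^sub>R v" "t *\<^sub>R u" f x] by linarith
    also have "\<dots> = t^2 * (c * t)"
      using that by (simp add: c_def power2_eq_square algebra_simps)
    finally have "t^2 * \<bar>D2 f x v u - D2 f x u v\<bar> \<le> t^2 * (c * t)"
      using that by (simp add: linear_scale[OF linear_D2(1)[OF f]] linear_scale[OF linear_D2(2)[OF f]]
          right_diff_distrib[symmetric] abs_mult power2_eq_square mult.assoc)
    then show ?thesis using that by simp
  qed
  moreover have "((\<lambda>t. c * t) \<longlongrightarrow> c * 0) (at_right 0)"
    by (intro tendsto_intros)
  ultimately have "\<bar>D2 f x v u - D2 f x u v\<bar> \<le> c * 0"
    by (intro tendsto_lowerbound[of "\<lambda>t. c * t" _ "at_right 0"]) (auto simp: eventually_at_filter)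
  then show ?thesis by simp
qed

lemma taylor_third_order:
  assumes f: "three_times_differentiable f"
    and M: "\<And>t. t \<in> {0..1} \<Longrightarrow> \<bar>D3 f (x + t *\<^sub>R u) u u u\<bar> \<le> M"
  shows "\<bar>f (x + u) - (f x + D1 f x u + D2 f x u u / 2)\<bar> \<le> M / 6"
proof -
  note d = three_times_differentiableD[OF f]
  define D where "D = (\<lambda>(m::nat) t. (if m = 0 then f (x + t *\<^sub>R u) else if m = 1 then D1 f (x + t *\<^sub>R u) u
    else if m = 2 then D2 f (x + t *\<^sub>R u) u u else D3 f (x + t *\<^sub>R u) u u u))"
  have "\<forall>m t. m < 3 \<and> 0 \<le> t \<and> t \<le> 1 \<longrightarrow> (D m has_real_derivative D (Suc m) t) (at t)"
  proof (intro allI impI)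
    fix m :: nat and t :: real assume "m < 3 \<and> 0 \<le> t \<and> t \<le> 1"
    then have "m = 0 \<or> m = 1 \<or> m = 2" by auto
    then show "(D m has_real_derivative D (Suc m) t) (at t)"
      using has_real_derivative_ray[OF d(1), of x u t] has_real_derivative_ray[where x=x and w=u and t=t, OF d(2)[of u]]
        has_real_derivative_ray[where x=x and w=u and t=t, OF d(3)[of u u]]
      by (auto simp: D_def D2_eq_D1[symmetric] D3_eq_D1[symmetric])
  qed
  then obtain t where t: "0 < t" "t < 1"
      "D 0 1 = (\<Sum>m<3. D m 0 / fact m * 1 ^ m) + D 3 t / fact 3 * 1 ^ 3"
    using Maclaurin[of 1 3 D "D 0"] by auto
  have "f (x + u) = f x + D1 f x u + D2 f x u u / 2 + D3 f (x + t *\<^sub>R u) u u u / 6"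
    using t(3) by (simp add: D_def numeral_3_eq_3 fact_numeral)
  then show ?thesis using M[of t] t by simp
qed

lemma convex_gradient_ineq:
  fixes f :: "real^'p \<Rightarrow> real"
  assumes c: "convex_on UNIV f" and d: "f differentiable_on UNIV"
  shows "f (x + u) \<ge> f x + D1 f x u"
proof -
  have "D1 f x u \<le> f (x + u) - f x"
  proof (rule tendsto_upperbound)
    show "((\<lambda>t. (f (x + t *\<^sub>R u) - f x) / t) \<longlongrightarrow> D1 f x u) (at_right 0)"
      using difference_quotient_tendsto_D1[OF d] by (rule tendsto_within_subset) simp
    show "\<forall>\<^sub>F t in at_right 0. (f (x + t *\<^sub>R u) - f x) / t \<le> f (x + u) - f x"
      using eventually_at_right_real[of 0 1, simplified]
    proof eventually_elim
      case (elim t)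
      have "f ((1 - t) *\<^sub>R x + t *\<^sub>R (x + u)) \<le> (1 - t) * f x + t * f (x + u)"
        using elim by (intro convex_onD[OF c]) auto
      then have "f (x + t *\<^sub>R u) - f x \<le> (f (x + u) - f x) * t" by (simp add: algebra_simps)
      then show ?case using elim by (simp add: divide_le_eq)
    qed
  qed simp
  then show ?thesis by simp
qed

lemma convex_D2_nonneg:
  assumes c: "convex_on UNIV f" and f: "three_times_differentiable f"
  shows "D2 f x u u \<ge> 0"
proof (rule tendsto_lowerbound)
  note d = three_times_differentiableD[OF f]
  show "((\<lambda>t. (D1 f (x + t *\<^sub>R u) u - D1 f x u) / t) \<longlongrightarrow> D2 f x u u) (at_right 0)"
    unfolding D2_eq_D1
    using difference_quotient_tendsto_D1[OF d(2)] by (rule tendsto_within_subset) simp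
  show "\<forall>\<^sub>F t in at_right 0. 0 \<le> (D1 f (x + t *\<^sub>R u) u - D1 f x u) / t"
    using eventually_at_right_real[of 0 1, simplified]
  proof eventually_elim
    case (elim t)
    have "0 \<le> t * (D1 f (x + t *\<^sub>R u) u - D1 f x u)"
      using convex_gradient_ineq[OF c d(1), of x "t *\<^sub>R u"]
        convex_gradient_ineq[OF c d(1), of "x + t *\<^sub>R u" "- (t *\<^sub>R u)"]
        linear_D1[OF d(1)] by (simp add: linear_scale linear_neg right_diff_distrib)
    then show ?case using elim by (simp add: zero_le_mult_iff)
  qed
qed simp

section \<open>Kullback-Leibler divergence of the Laplace approximation\<close>

lemma third_sup_le_iff:
  assumes "L \<ge> 0"
  shows "third_sup T \<le> ennreal L \<longleftrightarrow>
    (\<forall>x u v w. u \<noteq> 0 \<longrightarrow> v \<noteq> 0 \<longrightarrow> w \<noteq> 0 \<longrightarrow> \<bar>T x u v w\<bar> \<le> L * (norm u * norm v * norm w))"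
proof -
  have "third_sup T \<le> ennreal L \<longleftrightarrow> (\<forall>x u v w. u \<noteq> 0 \<longrightarrow> v \<noteq> 0 \<longrightarrow> w \<noteq> 0 \<longrightarrow>
      ennreal (\<bar>T x u v w\<bar> / (norm u * norm v * norm w)) \<le> ennreal L)"
    unfolding third_sup_def SUP_le_iff by auto
  also have "\<dots> \<longleftrightarrow> (\<forall>x u v w. u \<noteq> 0 \<longrightarrow> v \<noteq> 0 \<longrightarrow> w \<noteq> 0 \<longrightarrow> \<bar>T x u v w\<bar> \<le> L * (norm u * norm v * norm w))"
    using assms by (simp add: divide_le_eq)
  finally show ?thesis .
qed

text \<open>Second-order in \<open>r\<close> and with at most the growth of \<open>exp(-r)\<close>; both cases follow from
  \<open>1 + t \<le> exp t\<close>.\<close>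

lemma exp_remainder_le: "exp (- r) - 1 + r \<le> r\<^sup>2 * (1 + exp (- r))" for r :: real
proof (cases "r \<ge> 0")
  case True
  have "exp (- r) \<le> 1 / (1 + r)"
    using exp_ge_add_one_self[of r] True by (simp add: exp_minus field_simps)
  also have "\<dots> \<le> 1 - r + r\<^sup>2"
    using True by (simp add: field_simps power2_eq_square)
  also have "\<dots> \<le> 1 - r + r\<^sup>2 * (1 + exp (- r))"
    by (intro add_left_mono) (simp add: distrib_left)
  finally show ?thesis by simp
next
  case False
  have "(1 - r) * (1 + r) \<le> (1 - r) * exp r"
    using exp_ge_add_one_self[of r] False by (intro mult_left_mono) auto
  then have "exp (- r) * (1 - r\<^sup>2) \<le> exp (- r) * ((1 - r) * exp r)"
    by (intro mult_left_mono) (auto simp: algebra_simps power2_eq_square)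
  also have "\<dots> = 1 - r" by (simp add: exp_minus)
  finally show ?thesis by (simp add: algebra_simps)
      (smt (verit) zero_le_power2)
qed

text \<open>Jensen's inequality and \<open>ln x \<le> x - 1\<close>, for the expression that the divergence of the Laplace
  approximation turns out to be.\<close>

lemma (in prob_space) log_mgf_bounds:
  fixes r :: "'a \<Rightarrow> real"
  assumes r: "integrable M r" and e: "integrable M (\<lambda>x. exp (- r x))"
  shows "0 < expectation (\<lambda>x. exp (- r x))"
    and "0 \<le> expectation r + ln (expectation (\<lambda>x. exp (- r x)))"
    and "expectation r + ln (expectation (\<lambda>x. exp (- r x))) \<le> expectation (\<lambda>x. exp (- r x) - 1 + r x)"
proof -
  define c where "c = expectation r"
  define E where "E = expectation (\<lambda>x. exp (- r x))"
  have "expectation (\<lambda>x. exp (- c) * (1 + c - r x)) \<le> E"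
    unfolding E_def
  proof (rule integral_mono)
    fix x
    have "exp (- c) * (1 + (c - r x)) \<le> exp (- c) * exp (c - r x)"
      by (intro mult_left_mono exp_ge_add_one_self) auto
    then show "exp (- c) * (1 + c - r x) \<le> exp (- r x)"
      by (simp add: exp_add[symmetric] algebra_simps)
  qed (use r e in auto)
  then have E: "exp (- c) \<le> E" using r by (simp add: prob_space c_def)
  show pos: "0 < expectation (\<lambda>x. exp (- r x))" using E exp_gt_zero[of "-c"] unfolding E_def by linarith
  then have "- c \<le> ln E" using E by (simp add: E_def ln_ge_iff)
  then show "0 \<le> expectation r + ln (expectation (\<lambda>x. exp (- r x)))" by (simp add: c_def E_def)
  have "ln E \<le> E - 1" using pos by (intro ln_le_minus_one) (simp add: E_def)
  then show "expectation r + ln (expectation (\<lambda>x. exp (- r x))) \<le> expectation (\<lambda>x. exp (- r x) - 1 + r x)"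
    using r e by (simp add: E_def prob_space)
qed

lemma minimiser_D1_zero:
  assumes d: "f differentiable_on UNIV" and min: "\<And>y. f m \<le> f y"
  shows "D1 f m u = 0"
proof -
  have nonneg: "D1 f m u \<ge> 0" for u
  proof (rule tendsto_lowerbound)
    show "((\<lambda>t. (f (m + t *\<^sub>R u) - f m) / t) \<longlongrightarrow> D1 f m u) (at_right 0)"
      using difference_quotient_tendsto_D1[OF d] by (rule tendsto_within_subset) simp
    show "\<forall>\<^sub>F t in at_right 0. 0 \<le> (f (m + t *\<^sub>R u) - f m) / t"
      using eventually_at_right_less[of 0] by eventually_elim (simp add: min)
  qed simp
  from nonneg[of u] nonneg[of "- u"] show ?thesis
    using linear_D1[OF d] by (simp add: linear_neg)
qed

lemma convex_on_affine:
  fixes f :: "real^'p \<Rightarrow> real" and A :: "real^'p^'p"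
  assumes "convex_on UNIV f"
  shows "convex_on UNIV (\<lambda>y. f (m + A *v y))"
proof (rule convex_onI)
  fix t :: real and x y assume t: "0 < t" "t < 1"
  have "m + A *v ((1 - t) *\<^sub>R x + t *\<^sub>R y) = (1 - t) *\<^sub>R (m + A *v x) + t *\<^sub>R (m + A *v y)"
    by (simp add: matrix_vector_right_distrib matrix_vector_mult_scaleR algebra_simps)
  then show "f (m + A *v ((1 - t) *\<^sub>R x + t *\<^sub>R y)) \<le> (1 - t) * f (m + A *v x) + t * f (m + A *v y)"
    using convex_onD[OF assms, of t "m + A *v x" "m + A *v y"] t by simp
qed simp

text \<open>In standardised coordinates the gradient vanishes at the origin and the Hessian there is the
  identity, so the remainder is cubic. The linear lower bound comes from convexity: on the unit sphere
  the increment is at least \<open>1/2 - \<delta>/6 \<ge> 1/3\<close>, and along a ray it grows at least linearly from there on;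
  inside the unit ball the bound is negative.\<close>

lemma standardized_facts:
  fixes \<phi> :: "real^'p \<Rightarrow> real"
  assumes f: "three_times_differentiable \<phi>" and c: "convex_on UNIV \<phi>" and lap: "laplace_defined \<phi>"
    and \<delta>: "Delta3 \<phi> \<le> ennreal \<delta>" "0 \<le> \<delta>"
  shows "standardized \<phi> 0 \<le> standardized \<phi> y"
    and "\<bar>standardized \<phi> y - standardized \<phi> 0 - (norm y)\<^sup>2 / 2\<bar> \<le> \<delta> * norm y ^ 3"
    and "\<delta> \<le> 1 \<Longrightarrow> standardized \<phi> y - standardized \<phi> 0 \<ge> norm y / 3 - 1"
proof -
  define m where "m = lap_mean \<phi>"
  define H where "H = hessian \<phi> m"
  define B where "B = msqrt (matrix_inv H)"
  define \<psi> where "\<psi> = standardized \<phi>"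
  have \<psi>_eq: "\<psi> = (\<lambda>y. \<phi> (m + B *v y))"
    by (simp add: \<psi>_def standardized_def fun_eq_iff m_def B_def lap_cov_def H_def)
  have H: "pos_def H" and "is_arg_min \<phi> (\<lambda>_. True) m"
    using lap by (auto simp: laplace_defined_def H_def m_def unique_arg_min_def)
  then have min: "\<phi> m \<le> \<phi> x" for x by (simp add: is_arg_min_linorder)
  have \<psi>f: "three_times_differentiable \<psi>" unfolding \<psi>_eq by (rule three_times_differentiable_affine[OF f])
  have min0: "\<psi> 0 \<le> \<psi> y" for y using min by (simp add: \<psi>_eq)
  have d1: "D1 \<psi> 0 y = 0" for y
    by (rule minimiser_D1_zero[OF three_times_differentiableD(1)[OF \<psi>f] min0])
  have d2: "D2 \<psi> 0 y y = (norm y)\<^sup>2" for y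
    unfolding \<psi>_eq D2_affine[OF f] D2_eq_hessian[OF f]
    using msqrt_inv_whitens[OF H, of y y] by (simp add: H_def[symmetric] B_def power2_norm_eq_inner)
  have d3: "\<bar>D3 \<psi> x y y y\<bar> \<le> \<delta> * norm y ^ 3" if "y \<noteq> 0" for x y
  proof -
    have "\<forall>x u v w. u \<noteq> 0 \<longrightarrow> v \<noteq> 0 \<longrightarrow> w \<noteq> 0 \<longrightarrow> \<bar>D3 \<psi> x u v w\<bar> \<le> \<delta> * (norm u * norm v * norm w)"
      using \<delta> third_sup_le_iff[of \<delta> "D3 \<psi>"] by (simp add: Delta3_def \<psi>_def)
    with that show ?thesis by (simp add: power3_eq_cube)
  qed
  have rem: "\<bar>\<psi> y - \<psi> 0 - (norm y)\<^sup>2 / 2\<bar> \<le> \<delta> * norm y ^ 3 / 6" for y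
  proof (cases "y = 0")
    case False
    then have "\<bar>\<psi> (0 + y) - (\<psi> 0 + D1 \<psi> 0 y + D2 \<psi> 0 y y / 2)\<bar> \<le> \<delta> * norm y ^ 3 / 6"
      by (intro taylor_third_order[OF \<psi>f] d3)
    then show ?thesis by (simp only: d1 d2 add_0 add_0_right diff_diff_eq)
  qed simp
  show "standardized \<phi> 0 \<le> standardized \<phi> y" using min0 by (simp add: \<psi>_def)
  have "\<delta> * norm y ^ 3 / 6 \<le> \<delta> * norm y ^ 3" using \<delta>(2) by simp
  with rem[of y] show "\<bar>standardized \<phi> y - standardized \<phi> 0 - (norm y)\<^sup>2 / 2\<bar> \<le> \<delta> * norm y ^ 3"
    by (simp add: \<psi>_def)
  show "standardized \<phi> y - standardized \<phi> 0 \<ge> norm y / 3 - 1" if "\<delta> \<le> 1"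
  proof (cases "norm y \<le> 1")
    case True
    then show ?thesis using min0[of y] by (simp add: \<psi>_def)
  next
    case False
    define e where "e = y /\<^sub>R norm y"
    have "y \<noteq> 0" using False by auto
    then have ne: "norm e = 1" by (simp add: e_def)
    have "\<bar>\<psi> e - \<psi> 0 - 1 / 2\<bar> \<le> \<delta> / 6" using rem[of e] by (simp only: ne) simp
    then have "\<psi> e - \<psi> 0 \<ge> 1 / 2 - \<delta> / 6" by arith
    then have e3: "\<psi> e - \<psi> 0 \<ge> 1 / 3" using that by simp
    have "\<psi> ((1 - 1 / norm y) *\<^sub>R 0 + (1 / norm y) *\<^sub>R y) \<le> (1 - 1 / norm y) * \<psi> 0 + 1 / norm y * \<psi> y"
      using False convex_on_affine[OF c, of m B]
      by (intro convex_onD) (auto simp: \<psi>_eq divide_le_eq)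
    then have "\<psi> e - \<psi> 0 \<le> (\<psi> y - \<psi> 0) / norm y"
      by (simp add: e_def inverse_eq_divide algebra_simps diff_divide_distrib)
    then have "1 / 3 \<le> (\<psi> y - \<psi> 0) / norm y" using e3 by linarith
    then have "1 / 3 * norm y \<le> \<psi> y - \<psi> 0" using False by (simp only: le_divide_eq split: if_splits)
    then show ?thesis by (simp add: \<psi>_def)
  qed
qed

text \<open>The integral dominates the sixth moment produced by \<open>r\<^sup>2 \<le> \<delta>\<^sup>2 |y|\<^sup>6\<close>; \<open>exp(1 - |y|/3)\<close> bounds both the
  Gaussian weight and its perturbation by \<open>exp(-r)\<close>, whence the factor \<open>2\<close>.\<close>

definition KL_const :: "'p::finite itself \<Rightarrow> real" where
  "KL_const _ = 2 * exp 1 / sqrt (2 * pi) ^ CARD('p) *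
     (\<integral>y. norm y ^ 6 * exp (- (1/3) * norm (y :: real^'p)) \<partial>lborel)"

text \<open>With \<open>\<gamma>\<close> the standard normal law, the substitution \<open>\<theta> = m + B y\<close> turns the divergence into
  \<open>E\<^sub>\<gamma> r + ln E\<^sub>\<gamma> exp(-r)\<close>. The cubic bound on \<open>r\<close> and the exponential decay of \<open>exp(-|y|\<^sup>2/2 - r(y))\<close> then make
  this \<open>O(\<delta>\<^sup>2)\<close>.\<close>

theorem KL_laplace_bound:
  fixes \<phi> :: "real^'p \<Rightarrow> real"
  assumes f: "three_times_differentiable \<phi>" and c: "convex_on UNIV \<phi>" and lap: "laplace_defined \<phi>"
    and \<delta>: "Delta3 \<phi> \<le> ennreal \<delta>" "0 \<le> \<delta>" "\<delta> \<le> 1"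
  shows "proper_posterior \<phi>"
    and "KL_finite (laplace_density \<phi>) (posterior_density \<phi>)"
    and "0 \<le> KL (laplace_density \<phi>) (posterior_density \<phi>)"
    and "KL (laplace_density \<phi>) (posterior_density \<phi>) \<le> KL_const TYPE('p) * \<delta>\<^sup>2"
proof -
  define m where "m = lap_mean \<phi>"
  define S where "S = lap_cov \<phi>"
  define B where "B = msqrt S"
  define \<psi> where "\<psi> = standardized \<phi>"
  have \<psi>_eq: "\<psi> y = \<phi> (m + B *v y)" for y by (simp add: \<psi>_def standardized_def m_def B_def S_def)
  have H: "pos_def (hessian \<phi> m)" using lap by (simp add: laplace_defined_def m_def)
  have S: "pos_def S" unfolding S_def lap_cov_def m_def[symmetric] by (rule pos_def_matrix_inv[OF H])
  note root = msqrt_root[OF S, folded B_def]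
  have symB: "transpose B = B" using root(1) by (simp add: pos_semidef_def)
  have invB: "invertible B" using msqrt_invertible[OF S] by (simp add: B_def)
  define b where "b = \<bar>det B\<bar>"
  have b: "b > 0" using invB by (simp add: b_def invertible_det_nz)
  have quad: "(B *v y) \<bullet> (matrix_inv S *v (B *v y)) = (norm y)\<^sup>2" for y
  proof -
    have "matrix_inv S = hessian \<phi> m"
      using matrix_inv_inverse[OF pos_def_invertible[OF S]] matrix_inv_inverse[OF pos_def_invertible[OF H]]
      unfolding S_def lap_cov_def m_def[symmetric]
      by (metis matrix_mul_assoc matrix_mul_lid matrix_mul_rid)
    then show ?thesis
      using msqrt_inv_whitens[OF H, of y y]
      by (simp add: B_def S_def lap_cov_def m_def power2_norm_eq_inner)
  qed
  have m\<phi>[measurable]: "\<phi> \<in> borel_measurable borel"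
    using continuous_on_UNIV_differentiable[OF three_times_differentiableD(1)[OF f]]
    by (rule borel_measurable_continuous_onI)
  have m\<psi>[measurable]: "\<psi> \<in> borel_measurable borel"
    unfolding \<psi>_eq[abs_def]
    using continuous_on_UNIV_differentiable[OF differentiable_affine[OF three_times_differentiableD(1)[OF f]]]
    by (rule borel_measurable_continuous_onI)
  note std = standardized_facts[OF f c lap \<delta>(1,2), folded \<psi>_def]
  define r where "r = (\<lambda>y. \<psi> y - \<psi> 0 - (norm y)\<^sup>2 / 2)"
  have mr[measurable]: "r \<in> borel_measurable borel" by (simp add: r_def)
  have r3: "\<bar>r y\<bar> \<le> \<delta> * norm y ^ 3" for y using std(2) by (simp add: r_def)
  define s where "s = sqrt (2 * pi) ^ CARD('p)"
  have s: "s > 0" by (simp add: s_def)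
  define G where "G = (\<lambda>y::real^'p. exp (- (norm y)\<^sup>2 / 2) / s)"
  have mG[measurable]: "G \<in> borel_measurable borel" by (simp add: G_def)
  have G0: "G y > 0" for y using s by (simp add: G_def)
  have iG: "integrable lborel G" "integral\<^sup>L lborel G = 1"
    using has_bochner_integral_gaussian[where 'a="real^'p"] s
    by (auto simp: G_def s_def has_bochner_integral_iff)
  define \<gamma> where "\<gamma> = density lborel G"
  interpret \<gamma>: prob_space \<gamma>
  proof
    show "emeasure \<gamma> (space \<gamma>) = 1"
      using iG G0 by (simp add: \<gamma>_def emeasure_density nn_integral_eq_integral less_imp_le)
  qed
  have int_\<gamma>: "integrable \<gamma> h \<longleftrightarrow> integrable lborel (\<lambda>y. G y * h y)"
    "integral\<^sup>L \<gamma> h = (\<integral>y. G y * h y \<partial>lborel)" if "h \<in> borel_measurable borel" for h :: "real^'p \<Rightarrow> real"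
    using that G0 by (auto simp: \<gamma>_def integrable_density integral_density less_imp_le)
  define T where "T = (\<lambda>y::real^'p. exp 1 * exp (- (1/3) * norm y))"
  have G_T: "s * G y \<le> T y" for y
  proof -
    have "- (norm y)\<^sup>2 / 2 \<le> 1 + - (1/3) * norm y"
      using zero_le_power2[of "norm y - 1/3"] by (simp add: power2_eq_square algebra_simps)
    then have "exp (- (norm y)\<^sup>2 / 2) \<le> exp (1 + - (1/3) * norm y)" by simp
    then show ?thesis using s by (simp only: exp_add) (simp add: T_def G_def)
  qed
  have Ge_eq: "s * (G y * exp (- r y)) = exp (- (\<psi> y - \<psi> 0))" for y
    using s by (simp add: G_def r_def exp_add[symmetric])
  have Ge_T: "s * (G y * exp (- r y)) \<le> T y" for y
  proof -
    have "exp (- (\<psi> y - \<psi> 0)) \<le> exp (1 + - (1/3) * norm y)" using std(3)[OF \<delta>(3), of y] by simp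
    then show ?thesis unfolding Ge_eq exp_add T_def .
  qed
  have iT: "integrable lborel (\<lambda>y::real^'p. norm y ^ k * T y)" for k
    using integrable_mult_right[OF integrable_norm_power_exp[where a="1/3" and k=k and 'a="real^'p"], of "exp 1"]
    by (simp add: T_def mult_ac)
  have int_r: "integrable \<gamma> r"
  proof -
    have "integrable lborel (\<lambda>y. G y * r y)"
    proof (rule Bochner_Integration.integrable_bound)
      show "integrable lborel (\<lambda>y. \<delta> / s * (norm y ^ 3 * T (y::real^'p)))" by (intro integrable_mult_right iT)
      have "\<bar>G y * r y\<bar> \<le> \<bar>\<delta> / s * (norm y ^ 3 * T y)\<bar>" for y
      proof -
        have "(s * G y) * \<bar>r y\<bar> \<le> T y * (\<delta> * norm y ^ 3)"
          using s G0[of y] by (intro mult_mono G_T r3) (auto simp: T_def)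
        then show ?thesis using s G0[of y] \<delta>(2)
          by (simp add: abs_mult T_def) (simp add: field_simps)
      qed
      then show "AE y in lborel. norm (G y * r y) \<le> norm (\<delta> / s * (norm y ^ 3 * T y))" by simp
    qed simp
    then show ?thesis by (simp add: int_\<gamma>)
  qed
  have int_e: "integrable \<gamma> (\<lambda>y. exp (- r y))"
  proof -
    have "integrable lborel (\<lambda>y. G y * exp (- r y))"
    proof (rule Bochner_Integration.integrable_bound)
      show "integrable lborel (\<lambda>y. 1 / s * (norm y ^ 0 * T (y::real^'p)))" by (intro integrable_mult_right iT)
      have "G y * exp (- r y) \<le> 1 / s * T y" for y
        using Ge_T[of y] s by (simp add: field_simps)
      then show "AE y in lborel. norm (G y * exp (- r y)) \<le> norm (1 / s * (norm y ^ 0 * T y))"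
        using G0 s by (simp add: less_imp_le T_def)
    qed simp
    then show ?thesis by (simp add: int_\<gamma>)
  qed
  note mgf = \<gamma>.log_mgf_bounds[OF int_r int_e]
  define E where "E = integral\<^sup>L \<gamma> (\<lambda>y. exp (- r y))"
  have E: "E > 0" using mgf(1) by (simp add: E_def)
  \<comment> \<open>The factor between \<open>exp (- \<psi>)\<close> and the normal density tilted by \<open>exp (- r)\<close>.\<close>
  define k where "k = s * exp (- \<psi> 0)"
  have exp_\<psi>: "exp (- \<psi> y) = k * (G y * exp (- r y))" for y
    using Ge_eq[of y] by (simp add: k_def exp_diff exp_minus field_simps)
  have i\<psi>: "integrable lborel (\<lambda>y. exp (- \<psi> y))"
    unfolding exp_\<psi> using int_e by (simp add: int_\<gamma>)
  then have i\<phi>: "integrable lborel (\<lambda>\<theta>. exp (- \<phi> \<theta>))"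
    by (subst integrable_symmetric_affine[OF symB invB, of _ m]) (simp_all add: \<psi>_eq)
  then show "proper_posterior \<phi>" by (simp add: proper_posterior_def)
  define Z where "Z = (\<integral>\<theta>. exp (- \<phi> \<theta>) \<partial>lborel)"
  have Z: "Z = b * s * exp (- \<psi> 0) * E"
  proof -
    have "Z = b * (\<integral>y. exp (- \<psi> y) \<partial>lborel)"
      unfolding Z_def b_def by (subst integral_symmetric_affine[OF symB invB, of _ m]) (simp_all add: \<psi>_eq)
    also have "(\<integral>y. exp (- \<psi> y) \<partial>lborel) = k * E"
      unfolding exp_\<psi> by (simp add: E_def int_\<gamma>)
    finally show ?thesis by (simp add: k_def)
  qed
  have Zpos: "Z > 0" using b s E by (simp add: Z)
  define g where "g = laplace_density \<phi>"
  define h where "h = posterior_density \<phi>"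
  have W: "sqrt ((2 * pi) ^ CARD('p) * det S) = s * b"
  proof -
    have "det S = b\<^sup>2" using root(2) by (metis b_def det_mul power2_abs power2_eq_square)
    then have "sqrt ((2 * pi) ^ CARD('p) * det S) = sqrt ((2 * pi) ^ CARD('p)) * b"
      using b real_sqrt_mult[of "(2 * pi) ^ CARD('p)" "det S"] by (metis real_sqrt_abs abs_of_pos)
    then show ?thesis by (simp only: real_sqrt_power s_def)
  qed
  have g_eq: "g \<theta> = exp (- ((\<theta> - m) \<bullet> (matrix_inv S *v (\<theta> - m))) / 2) / (s * b)" for \<theta>
    unfolding g_def laplace_density_def gaussian_density_def m_def[symmetric] S_def[symmetric] W ..
  have mg[measurable]: "g \<in> borel_measurable borel"
  proof -
    have [measurable]: "(*v) (matrix_inv S) \<in> borel_measurable borel"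
      by (intro borel_measurable_continuous_onI linear_continuous_on) (simp add: linear_linear)
    show ?thesis unfolding g_eq[abs_def] by measurable
  qed
  have mh[measurable]: "h \<in> borel_measurable borel" by (simp add: h_def posterior_density_def[abs_def])
  have gpos: "g \<theta> > 0" for \<theta> using s b by (simp add: g_eq)
  have h_eq: "h \<theta> = exp (- \<phi> \<theta>) / Z" for \<theta> by (simp add: h_def posterior_density_def Z_def)
  have hpos: "h \<theta> > 0" for \<theta> using Zpos by (simp add: h_eq)
  have gy: "g (m + B *v y) = G y / b" for y
    by (simp add: g_eq quad G_def)
  have ratio: "ln (g (m + B *v y) / h (m + B *v y)) = r y + ln E" for y
  proof -
    have "g (m + B *v y) / h (m + B *v y) = exp (r y) * E"
    proof -
      have key: "exp (- (norm y)\<^sup>2 / 2) * exp (- \<psi> 0) / exp (- \<psi> y) = exp (r y)"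
        by (simp add: r_def exp_diff[symmetric] exp_add[symmetric])
      have "g (m + B *v y) / h (m + B *v y) = exp (- (norm y)\<^sup>2 / 2) * exp (- \<psi> 0) / exp (- \<psi> y) * E"
        using b s by (simp add: gy h_eq \<psi>_eq[symmetric] Z G_def)
      then show ?thesis by (simp only: key)
    qed
    then show ?thesis using E by (simp add: ln_mult)
  qed
  have mB[measurable]: "(\<lambda>y. m + B *v y) \<in> borel_measurable borel"
    by (intro borel_measurable_continuous_onI continuous_intros linear_continuous_on) (simp add: linear_linear)
  have pull: "g (m + B *v y) * ln (g (m + B *v y) / h (m + B *v y)) = 1 / b * (G y * (r y + ln E))" for y
    by (simp only: ratio) (simp add: gy)
  have "integrable \<gamma> (\<lambda>y. r y + ln E)" using int_r by simp
  then have "integrable lborel (\<lambda>y. G y * (r y + ln E))" by (simp add: int_\<gamma>)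
  then have "integrable lborel (\<lambda>\<theta>. g \<theta> * ln (g \<theta> / h \<theta>))"
    using b by (subst integrable_symmetric_affine[OF symB invB, of _ m]) (simp, simp only: pull, simp)
  then show fin: "KL_finite (laplace_density \<phi>) (posterior_density \<phi>)"
    unfolding KL_finite_def g_def[symmetric] h_def[symmetric]
    using gpos by (simp add: integrable_density less_imp_le)
  have "KL g h = (\<integral>\<theta>. g \<theta> * ln (g \<theta> / h \<theta>) \<partial>lborel)"
    using gpos hpos by (subst KL_eq_expectation) (simp_all add: integral_density less_imp_le)
  also have "\<dots> = (\<integral>y. G y * (r y + ln E) \<partial>lborel)"
    using b by (subst integral_symmetric_affine[OF symB invB, of _ m]) (simp, simp only: pull, simp add: b_def)
  also have "\<dots> = integral\<^sup>L \<gamma> (\<lambda>y. r y + ln E)" by (simp add: int_\<gamma>)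
  also have "\<dots> = integral\<^sup>L \<gamma> r + ln E" using int_r by (simp add: \<gamma>.prob_space)
  finally have KL: "KL g h = integral\<^sup>L \<gamma> r + ln E" .
  show "0 \<le> KL (laplace_density \<phi>) (posterior_density \<phi>)"
    using mgf(2) by (simp add: g_def[symmetric] h_def[symmetric] KL E_def)
  have "KL g h \<le> integral\<^sup>L \<gamma> (\<lambda>y. exp (- r y) - 1 + r y)"
    using mgf(3) by (simp add: KL E_def)
  also have "\<dots> = (\<integral>y. G y * (exp (- r y) - 1 + r y) \<partial>lborel)" by (simp add: int_\<gamma>)
  also have "\<dots> \<le> (\<integral>y. (2 * \<delta>\<^sup>2 / s) * (norm y ^ 6 * T (y::real^'p)) \<partial>lborel)"
  proof (rule integral_mono)
    have "integrable \<gamma> (\<lambda>y. exp (- r y) - 1 + r y)" using int_r int_e by simp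
    then show "integrable lborel (\<lambda>y. G y * (exp (- r y) - 1 + r y))" by (simp add: int_\<gamma>)
    show "integrable lborel (\<lambda>y. (2 * \<delta>\<^sup>2 / s) * (norm y ^ 6 * T (y::real^'p)))"
      by (intro integrable_mult_right iT)
    fix y :: "real^'p"
    have "(r y)\<^sup>2 \<le> (\<delta> * norm y ^ 3)\<^sup>2" using r3[of y] by (metis abs_ge_zero power2_abs power_mono)
    then have r6: "(r y)\<^sup>2 \<le> \<delta>\<^sup>2 * norm y ^ 6" by (simp add: power_mult_distrib)
    have "s * (G y * (exp (- r y) - 1 + r y)) \<le> s * (G y * ((r y)\<^sup>2 * (1 + exp (- r y))))"
      using s G0[of y] by (intro mult_left_mono exp_remainder_le) auto
    also have "\<dots> = (r y)\<^sup>2 * (s * G y + s * (G y * exp (- r y)))" by (simp add: algebra_simps)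
    also have "\<dots> \<le> (\<delta>\<^sup>2 * norm y ^ 6) * (T y + T y)"
      using s G0[of y] by (intro mult_mono r6 add_mono G_T Ge_T) auto
    finally show "G y * (exp (- r y) - 1 + r y) \<le> (2 * \<delta>\<^sup>2 / s) * (norm y ^ 6 * T y)"
      using s by (simp add: field_simps)
  qed
  also have "\<dots> = KL_const TYPE('p) * \<delta>\<^sup>2"
    by (simp add: KL_const_def T_def s_def mult.left_commute[of _ "exp 1"])
  finally show "KL (laplace_density \<phi>) (posterior_density \<phi>) \<le> KL_const TYPE('p) * \<delta>\<^sup>2"
    by (simp add: g_def h_def)
qed

section \<open>Deterministic conditions for a regular Laplace approximation\<close>

lemma pos_def_lower_bound:
  fixes A :: "real^'p^'p"
  assumes "pos_def A"
  shows "\<exists>c>0. \<forall>x. x \<bullet> (A *v x) \<ge> c * (norm x)\<^sup>2"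
proof -
  have "continuous_on (sphere 0 1) (\<lambda>x. x \<bullet> (A *v x))"
    by (intro continuous_intros linear_continuous_on) (simp add: linear_linear)
  moreover have "axis undefined 1 \<in> (sphere 0 1 :: (real^'p) set)" by simp
  ultimately obtain e where e: "norm e = 1" and min: "\<And>x. norm x = 1 \<Longrightarrow> e \<bullet> (A *v e) \<le> x \<bullet> (A *v x)"
    using continuous_attains_inf[of "sphere 0 1" "\<lambda>x. x \<bullet> (A *v x)"]
    by (metis compact_sphere empty_iff mem_sphere_0)
  define c where "c = e \<bullet> (A *v e)"
  have "e \<noteq> 0" using e by auto
  then have "c > 0" using assms by (simp add: c_def pos_def_def)
  moreover have "x \<bullet> (A *v x) \<ge> c * (norm x)\<^sup>2" for x
  proof (cases "x = 0")
    case False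
    then have "c \<le> (x /\<^sub>R norm x) \<bullet> (A *v (x /\<^sub>R norm x))"
      unfolding c_def by (intro min) simp
    also have "\<dots> = (x \<bullet> (A *v x)) / (norm x)\<^sup>2"
      by (simp add: matrix_vector_mult_scaleR power2_eq_square divide_inverse mult_ac)
    finally show ?thesis using False by (simp add: le_divide_eq)
  qed simp
  ultimately show ?thesis by blast
qed

lemma quadratic_form_perturbation:
  fixes A B :: "real^'p^'p"
  assumes "\<And>i j. \<bar>A $ i $ j - B $ i $ j\<bar> \<le> d"
  shows "\<bar>u \<bullet> (A *v u) - u \<bullet> (B *v u)\<bar> \<le> (real CARD('p))\<^sup>2 * d * (norm u)\<^sup>2"
proof -
  have "u \<bullet> (A *v u) - u \<bullet> (B *v u) = (\<Sum>i\<in>UNIV. \<Sum>j\<in>UNIV. u $ i * ((A $ i $ j - B $ i $ j) * u $ j))"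
    by (simp add: inner_vec_def matrix_vector_mult_def sum_subtractf[symmetric] sum_distrib_left
        algebra_simps)
  also have "\<bar>\<dots>\<bar> \<le> (\<Sum>i\<in>(UNIV::'p set). \<Sum>j\<in>(UNIV::'p set). norm u * (d * norm u))"
  proof (intro order_trans[OF sum_abs] sum_mono)
    fix i j
    show "\<bar>u $ i * ((A $ i $ j - B $ i $ j) * u $ j)\<bar> \<le> norm u * (d * norm u)"
      unfolding abs_mult
      using assms[of i j] order_trans[OF abs_ge_zero assms[of i j]]
      by (intro mult_mono component_le_norm_cart) auto
  qed
  finally show ?thesis by (simp add: power2_eq_square mult_ac)
qed

lemma third_bounded_nonneg:
  assumes "third_bounded f L" shows "L \<ge> 0"
  using order_trans[OF abs_ge_zero assms[unfolded third_bounded_def, rule_format,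
    of undefined "axis undefined 1" "axis undefined 1" "axis undefined 1"]] by simp

lemma taylor_lower_bound:
  assumes f: "three_times_differentiable f" and b: "third_bounded f L"
  shows "f (x + u) \<ge> f x + D1 f x u + D2 f x u u / 2 - L * norm u ^ 3 / 6"
proof -
  have "\<bar>f (x + u) - (f x + D1 f x u + D2 f x u u / 2)\<bar> \<le> L * norm u ^ 3 / 6"
    using D3_bounded[OF f b] by (intro taylor_third_order[OF f]) (simp add: power3_eq_cube)
  then show ?thesis by linarith
qed

text \<open>On the sphere of radius \<open>r = a / (2 L)\<close>, the quadratic term \<open>a r\<^sup>2 / 2\<close> beats the cubic remainder, at most
  \<open>a r\<^sup>2 / 12\<close>, and the linear term, at most \<open>a r\<^sup>2 / 4\<close>. So a minimum over the ball is interior, hence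
  global by convexity, and at distance less than \<open>r\<close> the Hessian has lost at most \<open>a / 2\<close>. Uniqueness: a
  second minimiser would, by convexity, force \<open>f\<close> to be constant on a segment issuing from the first, against
  the positive Hessian there.\<close>

lemma convex_minimiser_near:
  fixes f :: "real^'p \<Rightarrow> real"
  assumes f: "three_times_differentiable f" and c: "convex_on UNIV f"
    and b: "third_bounded f L" and L: "L > 0" and a: "a > 0"
    and hess: "\<And>u. D2 f x0 u u \<ge> a * (norm u)\<^sup>2"
    and grad: "norm (grad f x0) < a\<^sup>2 / (8 * L)"
  shows "\<exists>m. unique_arg_min f m \<and> (\<forall>u. D2 f m u u \<ge> a / 2 * (norm u)\<^sup>2)"
proof -
  note d = three_times_differentiableD[OF f]
  define r where "r = a / (2 * L)"
  have r: "r > 0" using a L by (simp add: r_def)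
  have Lr: "L * r = a / 2" using L by (simp add: r_def)
  have sphere: "f (x0 + z) > f x0" if z: "norm z = r" for z
  proof -
    have "norm (grad f x0) < a * r / 4"
      using grad by (simp add: r_def power2_eq_square)
    moreover have "\<bar>D1 f x0 z\<bar> \<le> norm (grad f x0) * r"
      unfolding D1_eq_grad[OF d(1)] z[symmetric] by (rule Cauchy_Schwarz_ineq2)
    ultimately have "\<bar>D1 f x0 z\<bar> < a * r / 4 * r"
      using r by (smt (verit) mult_strict_right_mono)
    moreover have "f (x0 + z) \<ge> f x0 + D1 f x0 z + D2 f x0 z z / 2 - L * norm z ^ 3 / 6"
      by (rule taylor_lower_bound[OF f b])
    moreover have "D2 f x0 z z \<ge> a * r\<^sup>2" using hess[of z] z by simp
    moreover have "L * norm z ^ 3 = a / 2 * r\<^sup>2"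
      using z Lr by (simp add: power2_eq_square power3_eq_cube mult.assoc[symmetric])
    moreover have "a * r\<^sup>2 > 0" using a r by simp
    ultimately show ?thesis by (simp add: power2_eq_square)
  qed
  have cont: "continuous_on (cball x0 r) f"
    using continuous_on_UNIV_differentiable[OF d(1)] continuous_on_subset by blast
  obtain m where m: "m \<in> cball x0 r" and m_min: "\<And>y. y \<in> cball x0 r \<Longrightarrow> f m \<le> f y"
    using continuous_attains_inf[OF compact_cball _ cont] r by (metis cball_eq_empty not_less_iff_gr_or_eq)
  have "norm (m - x0) \<noteq> r"
    using sphere[of "m - x0"] m_min[of x0] r by auto
  then have mr: "norm (m - x0) < r" using m by (simp add: dist_norm norm_minus_commute)
  have glob: "f m \<le> f y" for y
  proof -
    have "\<forall>y\<in>ball m (r - norm (m - x0)). f m \<le> f y"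
    proof
      fix y assume "y \<in> ball m (r - norm (m - x0))"
      then have "dist x0 y \<le> r"
        using dist_triangle[of x0 y m] by (simp add: dist_norm norm_minus_commute)
      then show "f m \<le> f y" by (intro m_min) simp
    qed
    then show ?thesis
      using convex_local_global_minimum[of "r - norm (m - x0)" UNIV f m] mr c by auto
  qed
  have hm: "D2 f m u u \<ge> a / 2 * (norm u)\<^sup>2" for u
  proof -
    have "\<bar>D2 f m u u - D2 f x0 u u\<bar> \<le> L * (norm (m - x0) * norm u * norm u)"
      using forward_diff_D2_bounded[OF f b, of "m - x0" u u x0] by (simp add: forward_diff_def)
    also have "\<dots> \<le> L * (r * norm u * norm u)"
      using L mr by (intro mult_left_mono mult_right_mono) auto
    also have "\<dots> = a / 2 * (norm u)\<^sup>2"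
      using Lr by (simp add: power2_eq_square mult.assoc[symmetric])
    finally show ?thesis using hess[of u] by linarith
  qed
  have strict: "y = m" if y: "f y \<le> f m" for y
  proof (rule ccontr)
    assume "y \<noteq> m"
    define k where "k = norm (y - m)"
    have k: "k > 0" using \<open>y \<noteq> m\<close> by (simp add: k_def)
    \<comment> \<open>Short enough a step for the quadratic term to dominate the cubic remainder.\<close>
    define t where "t = min 1 (r / k)"
    have t: "0 < t" "t \<le> 1" "t * k \<le> r"
      using r k by (auto simp: t_def min_def field_simps)
    define u where "u = t *\<^sub>R (y - m)"
    have nu: "norm u = t * k" using t by (simp add: u_def k_def)
    have "f ((1 - t) *\<^sub>R m + t *\<^sub>R y) \<le> (1 - t) * f m + t * f y"
      using t by (intro convex_onD[OF c]) auto
    also have "\<dots> \<le> f m" using y t mult_left_mono[OF y, of t] by (simp add: algebra_simps)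
    also have "(1 - t) *\<^sub>R m + t *\<^sub>R y = m + u" by (simp add: u_def algebra_simps)
    finally have "f (m + u) \<le> f m" .
    moreover have "f (m + u) \<ge> f m + D1 f m u + D2 f m u u / 2 - L * norm u ^ 3 / 6"
      by (rule taylor_lower_bound[OF f b])
    moreover have "D1 f m u = 0" by (rule minimiser_D1_zero[OF d(1) glob])
    moreover have "L * norm u ^ 3 \<le> a / 2 * (norm u)\<^sup>2"
    proof -
      have "L * norm u * (norm u)\<^sup>2 \<le> L * r * (norm u)\<^sup>2"
        using t(3) nu L by (intro mult_right_mono) auto
      then show ?thesis using Lr by (simp add: power2_eq_square power3_eq_cube mult.assoc)
    qed
    moreover have "a * (norm u)\<^sup>2 > 0" using a t k nu by simp
    ultimately show False using hm[of u] by simp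
  qed
  have "unique_arg_min f m"
    unfolding unique_arg_min_def is_arg_min_linorder using glob strict by auto
  with hm show ?thesis by blast
qed

lemma lap_mean_eqI: "unique_arg_min f m \<Longrightarrow> lap_mean f = m"
  unfolding lap_mean_def arg_min_def unique_arg_min_def by (rule some_equality) auto

text \<open>Whitening with a Hessian of size at least \<open>a / 2\<close> rescales every argument of the third derivative
  by at most \<open>(a / 2)\<^sup>-\<^sup>1\<^sup>/\<^sup>2\<close>.\<close>

lemma laplace_regular:
  fixes f :: "real^'p \<Rightarrow> real"
  assumes f: "three_times_differentiable f" and c: "convex_on UNIV f"
    and b: "third_bounded f L" and L: "L > 0" and a: "a > 0"
    and hess: "\<And>u. D2 f x0 u u \<ge> a * (norm u)\<^sup>2"
    and grad: "norm (grad f x0) < a\<^sup>2 / (8 * L)"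
  shows "laplace_defined f" and "Delta3 f \<le> ennreal (L / sqrt (a / 2) ^ 3)"
proof -
  obtain m where m: "unique_arg_min f m" and hm: "\<And>u. D2 f m u u \<ge> a / 2 * (norm u)\<^sup>2"
    using convex_minimiser_near[OF assms] by blast
  have lm: "lap_mean f = m" using m by (rule lap_mean_eqI)
  have sym: "transpose (hessian f m) = hessian f m"
    using D2_symmetric[OF f b] by (simp add: transpose_def hessian_def vec_eq_iff)
  have lower: "z \<bullet> (hessian f m *v z) \<ge> a / 2 * (norm z)\<^sup>2" for z
    using hm[of z] by (simp add: D2_eq_hessian[OF f])
  have pd: "pos_def (hessian f m)"
    unfolding pos_def_def
  proof (intro conjI allI impI sym)
    fix x :: "real^'p" assume "x \<noteq> 0"
    then have "0 < a / 2 * (norm x)\<^sup>2" using a by simp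
    then show "0 < x \<bullet> (hessian f m *v x)" using lower[of x] by linarith
  qed
  show "laplace_defined f" using m pd by (simp add: laplace_defined_def lm)
  have "norm (msqrt (matrix_inv (hessian f m)) *v y) \<le> 1 / sqrt (a / 2) * norm y" for y
    using norm_msqrt_inv_le[OF pd _ lower] a by simp
  then have "third_bounded (\<lambda>y. f (m + msqrt (matrix_inv (hessian f m)) *v y)) (L * (1 / sqrt (a / 2)) ^ 3)"
    using L by (intro third_bounded_affine[OF b]) auto
  then have "third_bounded (standardized f) (L / sqrt (a / 2) ^ 3)"
    by (simp add: standardized_def[abs_def] lm lap_cov_def power_divide)
  moreover have "three_times_differentiable (standardized f)"
    unfolding standardized_def[abs_def] by (rule three_times_differentiable_affine[OF f])
  ultimately have "\<bar>D3 (standardized f) x u v w\<bar> \<le> L / sqrt (a / 2) ^ 3 * (norm u * norm v * norm w)" for x u v w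
    using D3_bounded[of "standardized f" "L / sqrt (a / 2) ^ 3" x u v w]
    by (simp only: mult.assoc mult.commute[of "norm w"] mult.left_commute)
  then show "Delta3 f \<le> ennreal (L / sqrt (a / 2) ^ 3)"
    unfolding Delta3_def using L a by (subst third_sup_le_iff) auto
qed

text \<open>The best constant in \<open>third_bounded\<close>, over a set of arguments. A countable dense set gives the same
  constant for continuous functions and makes the functional measurable. Quotients with a vanishing
  denominator are \<open>0\<close>, in agreement with third differences in a zero direction.\<close>

definition third_diff_const :: "((real^'p) \<times> (real^'p) \<times> (real^'p) \<times> (real^'p)) set \<Rightarrow> (real^'p \<Rightarrow> real) \<Rightarrow> ennreal" where
  "third_diff_const D f = (SUP (x, u, v, w)\<in>D. ennreal (\<bar>third_diff f x u v w\<bar> / (norm u * norm v * norm w)))"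

lemma third_diff_const_le:
  assumes "third_bounded f L"
  shows "third_diff_const D f \<le> ennreal L"
  unfolding third_diff_const_def
proof (intro SUP_least, clarify)
  fix x u v w
  have "\<bar>third_diff f x u v w\<bar> / (norm u * norm v * norm w) \<le> L"
    using assms third_bounded_nonneg[OF assms] unfolding third_bounded_def
    by (cases "norm u * norm v * norm w = 0") (auto simp: divide_le_eq)
  then show "ennreal (\<bar>third_diff f x u v w\<bar> / (norm u * norm v * norm w)) \<le> ennreal L"
    by (rule ennreal_leI)
qed

lemma third_bounded_third_diff_const:
  fixes f :: "real^'p \<Rightarrow> real"
  assumes cont: "continuous_on UNIV f" and dense: "closure D = UNIV" and fin: "third_diff_const D f < \<infinity>"
  shows "third_bounded f (enn2real (third_diff_const D f))"
proof -
  define L where "L = enn2real (third_diff_const D f)"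
  have LK: "ennreal L = third_diff_const D f" using fin by (simp add: L_def)
  have fcont: "continuous_on UNIV (\<lambda>z. f (h z))" if "continuous_on UNIV h" for h :: "((real^'p) \<times> (real^'p) \<times> (real^'p) \<times> (real^'p)) \<Rightarrow> real^'p"
    using continuous_on_compose2[OF cont that] by simp
  define S where "S = {(x, u, v, w). \<bar>third_diff f x u v w\<bar> \<le> L * (norm u * norm v * norm w)}"
  have "S = {z. \<bar>third_diff f (fst z) (fst (snd z)) (fst (snd (snd z))) (snd (snd (snd z)))\<bar>
      \<le> L * (norm (fst (snd z)) * norm (fst (snd (snd z))) * norm (snd (snd (snd z))))}"
    by (auto simp: S_def)
  also have "closed \<dots>"
    unfolding third_diff_def forward_diff_def
    by (intro closed_Collect_le continuous_intros fcont)
  finally have "closed S" .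
  moreover have "D \<subseteq> S"
  proof (clarsimp simp: S_def)
    fix x u v w assume D: "(x, u, v, w) \<in> D"
    show "\<bar>third_diff f x u v w\<bar> \<le> L * (norm u * norm v * norm w)"
    proof (cases "norm u * norm v * norm w = 0")
      case True
      then show ?thesis by (auto simp: third_diff_def forward_diff_def)
    next
      case False
      then have pos: "norm u * norm v * norm w > 0" by simp
      have "ennreal (\<bar>third_diff f x u v w\<bar> / (norm u * norm v * norm w)) \<le> ennreal L"
        unfolding LK third_diff_const_def using D by (intro SUP_upper2[of "(x, u, v, w)"]) auto
      then have "\<bar>third_diff f x u v w\<bar> / (norm u * norm v * norm w) \<le> L"
        by (simp add: L_def)
      then show ?thesis using pos by (simp only: divide_le_eq if_True)
    qed
  qed
  ultimately have "S = UNIV" using dense closure_minimal by blast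
  then have "(x, u, v, w) \<in> S" for x u v w by simp
  then show ?thesis unfolding third_bounded_def L_def[symmetric] by (simp add: S_def)
qed

text \<open>Bounds preconditioned by a fixed invertible matrix, such as \<open>J\<^sup>1\<^sup>/\<^sup>2\<close>, differ from plain ones by a constant factor
  only.\<close>

lemma third_bounded_if_preconditioned:
  fixes f :: "real^'p \<Rightarrow> real" and S :: "real^'p^'p"
  assumes f: "three_times_differentiable f" and S: "invertible S" and \<Delta>: "0 \<le> \<Delta>"
    and b: "third_sup (\<lambda>\<theta> v1 v2 v3. D3 f \<theta> (S *v v1) (S *v v2) (S *v v3)) \<le> ennreal \<Delta>"
    and k: "\<And>y. norm (matrix_inv S *v y) \<le> k * norm y" and k0: "k > 0"
  shows "third_bounded f (k ^ 3 * \<Delta>)"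
proof -
  define R where "R = matrix_inv S"
  have SR: "S *v (R *v y) = y" for y
    by (simp add: R_def matrix_vector_mul_assoc matrix_inv_inverse[OF S])
  note d = three_times_differentiableD[OF f]
  have zero: "D3 f x u v w = 0" if "u = 0 \<or> v = 0 \<or> w = 0" for x u v w
  proof -
    have "D2 f y u v = 0" if "u = 0 \<or> v = 0" for y
      using that linear_0[OF linear_D2(1)[OF f]] linear_0[OF linear_D2(2)[OF f]] by auto
    moreover have "D1 (\<lambda>_. 0 :: real) x w = 0" for x w :: "real^'p"
      by (rule D1_eqI[of _ "\<lambda>_. 0", simplified]) simp
    moreover have "D1 (\<lambda>y. D2 f y u v) x 0 = 0" by (rule linear_0[OF linear_D1[OF d(3)]])
    ultimately show ?thesis using that unfolding D3_eq_D1 by auto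
  qed
  have "\<bar>D3 f x u v w\<bar> \<le> k ^ 3 * \<Delta> * (norm u * norm v * norm w)" for x u v w
  proof (cases "u = 0 \<or> v = 0 \<or> w = 0")
    case True
    then show ?thesis using zero \<Delta> k0 by simp
  next
    case False
    then have "R *v u \<noteq> 0" "R *v v \<noteq> 0" "R *v w \<noteq> 0"
      using SR by (metis matrix_vector_mult_0_right)+
    then have "\<bar>D3 f x (S *v (R *v u)) (S *v (R *v v)) (S *v (R *v w))\<bar>
        \<le> \<Delta> * (norm (R *v u) * norm (R *v v) * norm (R *v w))"
      using b[unfolded third_sup_le_iff[OF \<Delta>]] by blast
    also have "\<dots> \<le> \<Delta> * ((k * norm u) * (k * norm v) * (k * norm w))"
      unfolding R_def using k0 by (intro mult_left_mono[OF _ \<Delta>] mult_mono k mult_nonneg_nonneg) auto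
    finally show ?thesis by (simp add: SR power3_eq_cube mult_ac)
  qed
  then show ?thesis by (rule third_bounded_if_D3_bounded[OF f])
qed

section \<open>Laws of large numbers in probability\<close>

lemma (in prob_space) prob_Int_ge:
  assumes A: "A \<in> events" "prob A \<ge> 1 - a" and B: "B \<in> events" "prob B \<ge> 1 - b"
  shows "prob (A \<inter> B) \<ge> 1 - (a + b)"
proof -
  have "prob A + prob B = prob (A \<union> B) + prob (A \<inter> B)"
    using A(1) B(1) by (simp add: measure_Un3 fmeasurable_eq_sets)
  then show ?thesis using A(2) B(2) prob_le_1[of "A \<union> B"] by linarith
qed

lemma (in prob_space) prob_tending_to_1_conj:
  assumes P: "with_prob_tending_to_1 M P" and Q: "with_prob_tending_to_1 M Q"
  shows "with_prob_tending_to_1 M (\<lambda>n \<omega>. P n \<omega> \<and> Q n \<omega>)"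
  unfolding with_prob_tending_to_1_def
proof (intro allI impI)
  fix \<epsilon> :: real assume "\<epsilon> > 0"
  then have e: "\<epsilon> / 2 > 0" by simp
  from P[unfolded with_prob_tending_to_1_def, rule_format, OF e]
    Q[unfolded with_prob_tending_to_1_def, rule_format, OF e]
  show "\<forall>\<^sub>F n in sequentially. \<exists>A\<in>events. prob A \<ge> 1 - \<epsilon> \<and> (\<forall>\<omega>\<in>A. P n \<omega> \<and> Q n \<omega>)"
  proof eventually_elim
    case (elim n)
    then obtain A B where A: "A \<in> events" "prob A \<ge> 1 - \<epsilon> / 2" "\<forall>\<omega>\<in>A. P n \<omega>"
      and B: "B \<in> events" "prob B \<ge> 1 - \<epsilon> / 2" "\<forall>\<omega>\<in>B. Q n \<omega>" by blast
    have "prob (A \<inter> B) \<ge> 1 - \<epsilon>" using prob_Int_ge[OF A(1,2) B(1,2)] by simp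
    with A B show ?case by (intro bexI[of _ "A \<inter> B"]) auto
  qed
qed

lemma (in prob_space) prob_tending_to_1_mono:
  assumes P: "with_prob_tending_to_1 M P"
    and PQ: "\<forall>\<^sub>F n in sequentially. \<forall>\<omega>\<in>space M. P n \<omega> \<longrightarrow> Q n \<omega>"
  shows "with_prob_tending_to_1 M Q"
  unfolding with_prob_tending_to_1_def
proof (intro allI impI)
  fix \<epsilon> :: real assume "\<epsilon> > 0"
  from P[unfolded with_prob_tending_to_1_def, rule_format, OF this] PQ
  show "\<forall>\<^sub>F n in sequentially. \<exists>A\<in>events. prob A \<ge> 1 - \<epsilon> \<and> (\<forall>\<omega>\<in>A. Q n \<omega>)"
  proof eventually_elim
    case (elim n)
    then obtain A where A: "A \<in> events" "prob A \<ge> 1 - \<epsilon>" "\<forall>\<omega>\<in>A. P n \<omega>" by blast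
    then show ?case using elim(2) sets.sets_into_space[OF A(1)] by (intro bexI[of _ A]) auto
  qed
qed

lemma (in prob_space) prob_tending_to_1_all:
  assumes "finite I" "\<And>i. i \<in> I \<Longrightarrow> with_prob_tending_to_1 M (P i)"
  shows "with_prob_tending_to_1 M (\<lambda>n \<omega>. \<forall>i\<in>I. P i n \<omega>)"
  using assms
proof (induction I rule: finite_induct)
  case empty
  show ?case
    unfolding with_prob_tending_to_1_def by (auto intro!: always_eventually bexI[of _ "space M"] simp: prob_space)
next
  case (insert i I)
  then show ?case using prob_tending_to_1_conj[of "P i" "\<lambda>n \<omega>. \<forall>i\<in>I. P i n \<omega>"] by simp
qed

locale iid_sequence = prob_space M for M :: "'w measure" +
  fixes N :: "'s measure" and X :: "nat \<Rightarrow> 'w \<Rightarrow> 's"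
  assumes indep: "indep_vars (\<lambda>_. N) X {1..}"
    and ident: "\<And>i. i \<ge> 1 \<Longrightarrow> distr M N (X i) = distr M N (X 1)"
begin

lemma measurable_term: "i \<ge> 1 \<Longrightarrow> X i \<in> measurable M N"
  using indep by (simp add: indep_vars_def)

lemma nn_integral_ident:
  assumes [measurable]: "h \<in> borel_measurable N" and i: "i \<ge> 1"
  shows "(\<integral>\<^sup>+\<omega>. h (X i \<omega>) \<partial>M) = (\<integral>\<^sup>+\<omega>. h (X 1 \<omega>) \<partial>M)"
  using ident[OF i] measurable_term[OF i] measurable_term[of 1] nn_integral_distr[of "X i" M N h] nn_integral_distr[of "X 1" M N h] by simp

lemma
  fixes h :: "'s \<Rightarrow> real"
  assumes [measurable]: "h \<in> borel_measurable N" and i: "i \<ge> 1"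
  shows integral_ident: "(\<integral>\<omega>. h (X i \<omega>) \<partial>M) = (\<integral>\<omega>. h (X 1 \<omega>) \<partial>M)"
    and integrable_ident: "integrable M (\<lambda>\<omega>. h (X i \<omega>)) \<longleftrightarrow> integrable M (\<lambda>\<omega>. h (X 1 \<omega>))"
  using ident[OF i] measurable_term[OF i] measurable_term[of 1] integral_distr[of "X i" M N h] integral_distr[of "X 1" M N h]
    integrable_distr_eq[of "X i" M N h] integrable_distr_eq[of "X 1" M N h] by simp_all

text \<open>Chebyshev's inequality: distinct terms are uncorrelated, so the centred sum has variance \<open>n v\<close>.\<close>

lemma weak_law:
  fixes h :: "'s \<Rightarrow> real"
  assumes h[measurable]: "h \<in> borel_measurable N"
    and sq: "integrable M (\<lambda>\<omega>. (h (X 1 \<omega>))\<^sup>2)" and \<eta>: "\<eta> > 0"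
  shows "with_prob_tending_to_1 M (\<lambda>n \<omega>.
    \<bar>(\<Sum>i=1..n. h (X i \<omega>)) - real n * (\<integral>\<omega>. h (X 1 \<omega>) \<partial>M)\<bar> \<le> \<eta> * real n)"
proof -
  define \<mu> where "\<mu> = (\<integral>\<omega>. h (X 1 \<omega>) \<partial>M)"
  define g where "g = (\<lambda>x. h x - \<mu>)"
  define Y where "Y = (\<lambda>i \<omega>. g (X i \<omega>))"
  have [measurable]: "g \<in> borel_measurable N" by (simp add: g_def)
  have Ymeas: "Y i \<in> borel_measurable M" if "i \<ge> 1" for i
    using measurable_term[OF that] by (simp add: Y_def)
  have h1: "integrable M (\<lambda>\<omega>. h (X 1 \<omega>))"
    using square_integrable_imp_integrable[OF _ sq] measurable_term[of 1] by simp
  have sq1: "integrable M (\<lambda>\<omega>. (g (X 1 \<omega>))\<^sup>2)"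
    using h1 sq by (simp add: g_def power2_diff)
  have g1: "integrable M (\<lambda>\<omega>. g (X 1 \<omega>))" "(\<integral>\<omega>. g (X 1 \<omega>) \<partial>M) = 0"
    using h1 by (simp_all add: g_def \<mu>_def prob_space)
  have Yint: "integrable M (Y i)" "integral\<^sup>L M (Y i) = 0" if "i \<ge> 1" for i
    using integrable_ident[of g i] integral_ident[of g i] g1 that by (simp_all add: Y_def)
  define v where "v = (\<integral>\<omega>. (g (X 1 \<omega>))\<^sup>2 \<partial>M)"
  have Yind: "indep_vars (\<lambda>_. borel) Y {1..}"
    unfolding Y_def by (rule indep_vars_compose2[OF indep]) simp
  have YY: "integrable M (\<lambda>\<omega>. Y i \<omega> * Y j \<omega>)"
      "(\<integral>\<omega>. Y i \<omega> * Y j \<omega> \<partial>M) = (if i = j then v else 0)" if "i \<ge> 1" "j \<ge> 1" for i j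
  proof -
    have "integrable M (\<lambda>\<omega>. Y i \<omega> * Y j \<omega>) \<and> (\<integral>\<omega>. Y i \<omega> * Y j \<omega> \<partial>M) = (if i = j then v else 0)"
    proof (cases "i = j")
      case True
      then show ?thesis
        using integrable_ident[of "\<lambda>x. (g x)\<^sup>2" i] integral_ident[of "\<lambda>x. (g x)\<^sup>2" i] sq1 that
        by (simp add: Y_def v_def power2_eq_square)
    next
      case False
      have ind: "indep_vars (\<lambda>_. borel) Y {i, j}"
        using that by (intro indep_vars_subset[OF Yind]) auto
      have "integrable M (\<lambda>\<omega>. \<Prod>k\<in>{i, j}. Y k \<omega>)"
        using that Yint by (intro indep_vars_integrable ind) auto
      moreover have "(\<integral>\<omega>. (\<Prod>k\<in>{i, j}. Y k \<omega>) \<partial>M) = (\<Prod>k\<in>{i, j}. integral\<^sup>L M (Y k))"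
        using that Yint by (intro indep_vars_lebesgue_integral ind) auto
      ultimately show ?thesis using False Yint[OF that(1)] by simp
    qed
    then show "integrable M (\<lambda>\<omega>. Y i \<omega> * Y j \<omega>)"
      "(\<integral>\<omega>. Y i \<omega> * Y j \<omega> \<partial>M) = (if i = j then v else 0)" by blast+
  qed
  have second: "integrable M (\<lambda>\<omega>. (\<Sum>i=1..n. Y i \<omega>)\<^sup>2)" "(\<integral>\<omega>. (\<Sum>i=1..n. Y i \<omega>)\<^sup>2 \<partial>M) = real n * v" for n
  proof -
    have eq: "(\<Sum>i=1..n. Y i \<omega>)\<^sup>2 = (\<Sum>i=1..n. \<Sum>j=1..n. Y i \<omega> * Y j \<omega>)" for \<omega>
      by (simp add: power2_eq_square sum_product)
    show "integrable M (\<lambda>\<omega>. (\<Sum>i=1..n. Y i \<omega>)\<^sup>2)"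
      unfolding eq by (intro Bochner_Integration.integrable_sum YY) auto
    have "(\<integral>\<omega>. (\<Sum>i=1..n. Y i \<omega>)\<^sup>2 \<partial>M) = (\<Sum>i=1..n. \<Sum>j=1..n. if i = j then v else 0)"
    proof -
      have "(\<integral>\<omega>. (\<Sum>i=1..n. \<Sum>j=1..n. Y i \<omega> * Y j \<omega>) \<partial>M)
          = (\<Sum>i=1..n. \<integral>\<omega>. (\<Sum>j=1..n. Y i \<omega> * Y j \<omega>) \<partial>M)"
        by (intro Bochner_Integration.integral_sum Bochner_Integration.integrable_sum YY) auto
      also have "\<dots> = (\<Sum>i=1..n. \<Sum>j=1..n. \<integral>\<omega>. Y i \<omega> * Y j \<omega> \<partial>M)"
        by (intro sum.cong refl Bochner_Integration.integral_sum YY) auto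
      also have "\<dots> = (\<Sum>i=1..n. \<Sum>j=1..n. if i = j then v else 0)"
        by (intro sum.cong refl YY) auto
      finally show ?thesis unfolding eq .
    qed
    then show "(\<integral>\<omega>. (\<Sum>i=1..n. Y i \<omega>)\<^sup>2 \<partial>M) = real n * v" by simp
  qed
  show ?thesis
    unfolding with_prob_tending_to_1_def
  proof (intro allI impI)
    fix \<epsilon> :: real assume \<epsilon>: "\<epsilon> > 0"
    have "\<forall>\<^sub>F n in sequentially. v / (\<eta>\<^sup>2 * \<epsilon>) \<le> real n"
      using filterlim_real_sequentially by (simp add: filterlim_at_top)
    then show "\<forall>\<^sub>F n in sequentially. \<exists>A\<in>events. prob A \<ge> 1 - \<epsilon> \<and>
        (\<forall>\<omega>\<in>A. \<bar>(\<Sum>i=1..n. h (X i \<omega>)) - real n * (\<integral>\<omega>. h (X 1 \<omega>) \<partial>M)\<bar> \<le> \<eta> * real n)"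
      using eventually_gt_at_top[of 0]
    proof eventually_elim
      case (elim n)
      define S where "S = (\<lambda>\<omega>. \<Sum>i=1..n. Y i \<omega>)"
      have [measurable]: "S \<in> borel_measurable M"
        unfolding S_def by (intro borel_measurable_sum Ymeas) auto
      define B where "B = {\<omega>\<in>space M. \<bar>S \<omega>\<bar> \<ge> \<eta> * real n}"
      have B: "B \<in> events" by (simp add: B_def)
      have "integrable M (\<lambda>\<omega>. (S \<omega>)\<^sup>2)" unfolding S_def by (rule second)
      then have "prob B \<le> integral\<^sup>L M (\<lambda>\<omega>. (S \<omega>)\<^sup>2) / (\<eta> * real n)\<^sup>2"
        unfolding B_def using \<eta> elim(2) by (intro second_moment_method) simp_all
      also have "\<dots> = v / (\<eta>\<^sup>2 * real n)"
      proof -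
        have "integral\<^sup>L M (\<lambda>\<omega>. (S \<omega>)\<^sup>2) = real n * v" unfolding S_def by (rule second)
        then show ?thesis using elim(2) by (simp add: power2_eq_square)
      qed
      also have "\<dots> \<le> \<epsilon>"
        using elim \<eta> \<epsilon> by (simp add: field_simps)
      finally have "prob (space M - B) \<ge> 1 - \<epsilon>" using prob_compl[OF B] by simp
      moreover have "\<bar>(\<Sum>i=1..n. h (X i \<omega>)) - real n * (\<integral>\<omega>. h (X 1 \<omega>) \<partial>M)\<bar> \<le> \<eta> * real n"
        if "\<omega> \<in> space M - B" for \<omega>
      proof -
        have "S \<omega> = (\<Sum>i=1..n. h (X i \<omega>)) - real n * \<mu>"
          by (simp add: S_def Y_def g_def sum_subtractf)
        then show ?thesis using that by (auto simp: B_def \<mu>_def)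
      qed
      ultimately show ?case using B by (intro bexI[of _ "space M - B"]) auto
    qed
  qed
qed

text \<open>Markov's inequality; the mean of the sum is \<open>n\<close> times that of the first term.\<close>

lemma sums_bounded_in_probability:
  fixes h :: "'s \<Rightarrow> ennreal"
  assumes h[measurable]: "h \<in> borel_measurable N"
    and fin: "(\<integral>\<^sup>+\<omega>. h (X 1 \<omega>) \<partial>M) < \<infinity>" and \<epsilon>: "\<epsilon> > 0"
  shows "\<exists>C>0. \<forall>n\<ge>1. \<exists>A\<in>events. prob A \<ge> 1 - \<epsilon> \<and> (\<forall>\<omega>\<in>A. (\<Sum>i=1..n. h (X i \<omega>)) \<le> ennreal (C * real n))"
proof -
  define \<kappa> where "\<kappa> = enn2real (\<integral>\<^sup>+\<omega>. h (X 1 \<omega>) \<partial>M)"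
  have \<kappa>: "(\<integral>\<^sup>+\<omega>. h (X 1 \<omega>) \<partial>M) = ennreal \<kappa>" "\<kappa> \<ge> 0" using fin by (simp_all add: \<kappa>_def)
  define C where "C = (\<kappa> + 1) / \<epsilon>"
  have C: "C > 0" using \<kappa>(2) \<epsilon> by (simp add: C_def)
  have "\<exists>A\<in>events. prob A \<ge> 1 - \<epsilon> \<and> (\<forall>\<omega>\<in>A. (\<Sum>i=1..n. h (X i \<omega>)) \<le> ennreal (C * real n))" if n: "n \<ge> 1" for n
  proof -
    define S where "S = (\<lambda>\<omega>. \<Sum>i=1..n. h (X i \<omega>))"
    have mS[measurable]: "S \<in> borel_measurable M"
      unfolding S_def by (intro borel_measurable_sum measurable_compose[OF measurable_term h]) auto
    have intS: "(\<integral>\<^sup>+\<omega>. S \<omega> \<partial>M) = ennreal (real n * \<kappa>)"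
    proof -
      have "(\<integral>\<^sup>+\<omega>. S \<omega> \<partial>M) = (\<Sum>i=1..n. \<integral>\<^sup>+\<omega>. h (X i \<omega>) \<partial>M)"
        unfolding S_def by (intro nn_integral_sum measurable_compose[OF measurable_term h]) auto
      also have "\<dots> = (\<Sum>i=1..n. ennreal \<kappa>)"
      proof (intro sum.cong refl)
        fix i assume "i \<in> {1..n}"
        then have "i \<ge> 1" by simp
        from nn_integral_ident[OF h this] show "(\<integral>\<^sup>+\<omega>. h (X i \<omega>) \<partial>M) = ennreal \<kappa>"
          by (simp only: \<kappa>(1))
      qed
      also have "\<dots> = ennreal (\<Sum>i=1..n. \<kappa>)" using \<kappa>(2) by (intro sum_ennreal) auto
      finally show ?thesis by simp
    qed
    have Cn: "C * real n > 0" using C n by simp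
    define B where "B = {\<omega>\<in>space M. 1 \<le> ennreal (1 / (C * real n)) * S \<omega>}"
    have B: "B \<in> events" by (simp add: B_def)
    have "emeasure M B \<le> ennreal (1 / (C * real n)) * (\<integral>\<^sup>+\<omega>. S \<omega> * indicator (space M) \<omega> \<partial>M)"
      unfolding B_def by (rule nn_integral_Markov_inequality) auto
    also have "(\<integral>\<^sup>+\<omega>. S \<omega> * indicator (space M) \<omega> \<partial>M) = (\<integral>\<^sup>+\<omega>. S \<omega> \<partial>M)"
      by (intro nn_integral_cong) simp
    also have "ennreal (1 / (C * real n)) * (\<integral>\<^sup>+\<omega>. S \<omega> \<partial>M) = ennreal (1 / (C * real n) * (real n * \<kappa>))"
      unfolding intS using Cn by (intro ennreal_mult'[symmetric]) simp
    also have "1 / (C * real n) * (real n * \<kappa>) = \<kappa> / C" using n by simp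
    also have "\<dots> \<le> ennreal \<epsilon>"
      using \<kappa>(2) \<epsilon> by (intro ennreal_leI) (simp add: C_def field_simps)
    finally have "prob B \<le> \<epsilon>" using \<epsilon> by (simp add: emeasure_eq_measure)
    then have "prob (space M - B) \<ge> 1 - \<epsilon>" using prob_compl[OF B] by simp
    moreover have "S \<omega> \<le> ennreal (C * real n)" if "\<omega> \<in> space M - B" for \<omega>
    proof -
      have lt: "ennreal (1 / (C * real n)) * S \<omega> < 1" using that by (simp add: B_def not_le)
      have "S \<omega> = ennreal (C * real n) * (ennreal (1 / (C * real n)) * S \<omega>)"
      proof -
        have "ennreal (C * real n) * ennreal (1 / (C * real n)) = ennreal (C * real n * (1 / (C * real n)))"
          using Cn by (intro ennreal_mult'[symmetric]) simp
        also have "C * real n * (1 / (C * real n)) = 1" using C n by simp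
        finally show ?thesis by (simp only: mult.assoc[symmetric] ennreal_1 mult_1)
      qed
      also have "\<dots> \<le> ennreal (C * real n) * 1"
        using lt by (intro mult_left_mono) auto
      finally show ?thesis by simp
    qed
    ultimately show ?thesis using B by (intro bexI[of _ "space M - B"]) (auto simp: S_def)
  qed
  then show ?thesis using C by blast
qed

end

section \<open>Derivatives as random variables\<close>

definition path_space :: "('a \<Rightarrow> real) measure" where
  "path_space = (\<Pi>\<^sub>M \<theta>\<in>UNIV. borel)"

lemma measurable_eval[measurable]: "(\<lambda>f. f x) \<in> borel_measurable path_space"
  unfolding path_space_def by simp

text \<open>As a function of an arbitrary path, the Frechet derivative need not be measurable. These sequential
  limits are, and agree with it on differentiable paths.\<close>

definition D1_lim :: "real^'p \<Rightarrow> real^'p \<Rightarrow> (real^'p \<Rightarrow> real) \<Rightarrow> real" where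
  "D1_lim x u f = lim (\<lambda>k. (f (x + (1 / real (Suc k)) *\<^sub>R u) - f x) / (1 / real (Suc k)))"

definition D2_lim :: "real^'p \<Rightarrow> real^'p \<Rightarrow> real^'p \<Rightarrow> (real^'p \<Rightarrow> real) \<Rightarrow> real" where
  "D2_lim x u v f = lim (\<lambda>k. (D1_lim (x + (1 / real (Suc k)) *\<^sub>R v) u f - D1_lim x u f) / (1 / real (Suc k)))"

lemma measurable_D1_lim[measurable]: "D1_lim x u \<in> borel_measurable path_space"
  unfolding D1_lim_def[abs_def] by measurable

lemma measurable_D2_lim[measurable]: "D2_lim x u v \<in> borel_measurable path_space"
  unfolding D2_lim_def[abs_def] by measurable

lemma difference_quotient_seq_tendsto:
  assumes "g differentiable_on UNIV"
  shows "(\<lambda>k. (g (x + (1 / real (Suc k)) *\<^sub>R u) - g x) / (1 / real (Suc k))) \<longlonglongrightarrow> D1 g x u"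
proof (rule filterlim_compose[OF difference_quotient_tendsto_D1[OF assms]])
  have "(\<lambda>k. 1 / real (Suc k)) \<longlonglongrightarrow> 0" using LIMSEQ_inverse_real_of_nat by (simp add: inverse_eq_divide)
  then show "filterlim (\<lambda>k. 1 / real (Suc k)) (at 0) sequentially"
    by (rule filterlim_atI) auto
qed

lemma D1_lim_eq: "g differentiable_on UNIV \<Longrightarrow> D1_lim x u g = D1 g x u"
  unfolding D1_lim_def by (rule limI[OF difference_quotient_seq_tendsto])

lemma D2_lim_eq: "three_times_differentiable f \<Longrightarrow> D2_lim x u v f = D2 f x u v"
  unfolding D2_lim_def D2_eq_D1
  by (simp only: D1_lim_eq[OF three_times_differentiableD(1)])
    (rule limI[OF difference_quotient_seq_tendsto], rule three_times_differentiableD)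

lemma measurable_third_diff_const:
  fixes D :: "((real^'p) \<times> (real^'p) \<times> (real^'p) \<times> (real^'p)) set"
  assumes "countable D"
  shows "third_diff_const D \<in> borel_measurable path_space"
  unfolding third_diff_const_def[abs_def] third_diff_def forward_diff_def
  by (intro borel_measurable_SUP assms) (simp split: prod.split, measurable)

lemma countable_dense_set_exists:
  "\<exists>D::'a::second_countable_topology set. countable D \<and> closure D = UNIV"
proof -
  obtain D :: "'a set" where D: "countable D" "\<And>X. open X \<Longrightarrow> X \<noteq> {} \<Longrightarrow> \<exists>d\<in>D. d \<in> X"
    using countable_dense_exists by blast
  have "closure D = UNIV"
  proof (rule ccontr)
    assume "closure D \<noteq> UNIV"
    then obtain d where "d \<in> D" "d \<in> - closure D"
      using D(2)[of "- closure D"] by auto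
    then show False using closure_subset by blast
  qed
  with D show ?thesis by blast
qed

section \<open>The negative log-posterior of a convex i.i.d. model\<close>

lemma neg_log_post_0: "neg_log_post \<phi>0 NLL 0 \<omega> = \<phi>0"
  by (simp add: neg_log_post_def fun_eq_iff)

lemma neg_log_post_Suc:
  "neg_log_post \<phi>0 NLL (Suc n) \<omega> = (\<lambda>\<theta>. neg_log_post \<phi>0 NLL n \<omega> \<theta> + NLL (Suc n) \<omega> \<theta>)"
  by (simp add: neg_log_post_def fun_eq_iff)

lemma
  assumes p: "three_times_differentiable \<phi>0" and l: "\<And>i. i \<ge> 1 \<Longrightarrow> three_times_differentiable (NLL i \<omega>)"
  shows three_times_differentiable_neg_log_post: "three_times_differentiable (neg_log_post \<phi>0 NLL n \<omega>)"
    and D1_neg_log_post: "D1 (neg_log_post \<phi>0 NLL n \<omega>) x u = D1 \<phi>0 x u + (\<Sum>i=1..n. D1 (NLL i \<omega>) x u)"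
    and D2_neg_log_post: "D2 (neg_log_post \<phi>0 NLL n \<omega>) x u v = D2 \<phi>0 x u v + (\<Sum>i=1..n. D2 (NLL i \<omega>) x u v)"
proof -
  have "three_times_differentiable (neg_log_post \<phi>0 NLL n \<omega>) \<and>
    D1 (neg_log_post \<phi>0 NLL n \<omega>) x u = D1 \<phi>0 x u + (\<Sum>i=1..n. D1 (NLL i \<omega>) x u) \<and>
    D2 (neg_log_post \<phi>0 NLL n \<omega>) x u v = D2 \<phi>0 x u v + (\<Sum>i=1..n. D2 (NLL i \<omega>) x u v)"
  proof (induction n)
    case 0
    then show ?case using p by (simp add: neg_log_post_0)
  next
    case (Suc n)
    have "three_times_differentiable (NLL (Suc n) \<omega>)" by (rule l) simp
    with Suc show ?case
      unfolding neg_log_post_Suc by (simp add: three_times_differentiable_add D1_add D2_add)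
  qed
  then show "three_times_differentiable (neg_log_post \<phi>0 NLL n \<omega>)"
    "D1 (neg_log_post \<phi>0 NLL n \<omega>) x u = D1 \<phi>0 x u + (\<Sum>i=1..n. D1 (NLL i \<omega>) x u)"
    "D2 (neg_log_post \<phi>0 NLL n \<omega>) x u v = D2 \<phi>0 x u v + (\<Sum>i=1..n. D2 (NLL i \<omega>) x u v)"
    by blast+
qed

lemma convex_neg_log_post:
  assumes "convex_on UNIV \<phi>0" "\<And>i. i \<ge> 1 \<Longrightarrow> convex_on UNIV (NLL i \<omega>)"
  shows "convex_on UNIV (neg_log_post \<phi>0 NLL n \<omega>)"
proof (induction n)
  case (Suc n)
  then show ?case using assms(2)[of "Suc n"] unfolding neg_log_post_Suc by (intro convex_on_add) auto
qed (use assms(1) in \<open>simp add: neg_log_post_0\<close>)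

lemma third_bounded_neg_log_post:
  assumes "third_bounded \<phi>0 L0" "\<And>i. 1 \<le> i \<Longrightarrow> i \<le> n \<Longrightarrow> third_bounded (NLL i \<omega>) (L i)"
  shows "third_bounded (neg_log_post \<phi>0 NLL n \<omega>) (L0 + (\<Sum>i=1..n. L i))"
  using assms(2)
proof (induction n)
  case 0
  then show ?case using assms(1) by (simp add: neg_log_post_0)
next
  case (Suc n)
  then have "third_bounded (neg_log_post \<phi>0 NLL (Suc n) \<omega>) ((L0 + (\<Sum>i=1..n. L i)) + L (Suc n))"
    unfolding neg_log_post_Suc by (intro third_bounded_add) auto
  then show ?case by (simp add: add.assoc)
qed

lemma quadratic_form_sum:
  fixes A :: "'i \<Rightarrow> real^'p^'p"
  shows "u \<bullet> ((\<Sum>i\<in>I. A i) *v u) = (\<Sum>i\<in>I. u \<bullet> (A i *v u))"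
  by (induction I rule: infinite_finite_induct)
    (auto simp: matrix_vector_mult_add_rdistrib inner_add_right)

locale convex_likelihood = iid_sequence M "path_space" NLL
  for M :: "'w measure" and NLL :: "nat \<Rightarrow> 'w \<Rightarrow> real^'p \<Rightarrow> real" +
  fixes \<theta>0 :: "real^'p" and J :: "real^'p^'p"
  assumes diff_NLL: "\<And>i \<omega>. i \<ge> 1 \<Longrightarrow> \<omega> \<in> space M \<Longrightarrow> three_times_differentiable (NLL i \<omega>)"
    and convex_NLL: "\<And>i \<omega>. i \<ge> 1 \<Longrightarrow> \<omega> \<in> space M \<Longrightarrow> convex_on UNIV (NLL i \<omega>)"
    and int_NLL: "\<And>\<theta>. integrable M (\<lambda>\<omega>. NLL 1 \<omega> \<theta>)"
    and argmin: "unique_arg_min (\<lambda>\<theta>. \<integral>\<omega>. NLL 1 \<omega> \<theta> \<partial>M) \<theta>0"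
    and int_fisher: "integrable M (\<lambda>\<omega>. outer (grad (NLL 1 \<omega>) \<theta>0) (grad (NLL 1 \<omega>) \<theta>0))"
    and int_J: "integrable M (\<lambda>\<omega>. hessian (NLL 1 \<omega>) \<theta>0)"
    and J: "J = (\<integral>\<omega>. hessian (NLL 1 \<omega>) \<theta>0 \<partial>M)"
    and pd_J: "pos_def J"
begin

lemma measurable_D1_NLL: "i \<ge> 1 \<Longrightarrow> (\<lambda>\<omega>. D1 (NLL i \<omega>) \<theta> u) \<in> borel_measurable M"
  using measurable_compose[OF measurable_term measurable_D1_lim[of \<theta> u], of i]
    D1_lim_eq[OF three_times_differentiableD(1)[OF diff_NLL]]
  by (simp cong: measurable_cong)

text \<open>Differentiation under the expectation. By convexity, the difference quotients lie between the
  derivative and the quotient for step one, so dominated convergence applies with a dominating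
  function built from three integrable values of the likelihood. The expected quotients are nonnegative as
  \<open>\<theta>0\<close> minimises the expectation.\<close>

lemma expected_D1_nonneg:
  "integrable M (\<lambda>\<omega>. D1 (NLL 1 \<omega>) \<theta>0 u) \<and> (\<integral>\<omega>. D1 (NLL 1 \<omega>) \<theta>0 u \<partial>M) \<ge> 0"
proof -
  define q where "q = (\<lambda>k \<omega>. (NLL 1 \<omega> (\<theta>0 + (1 / real (Suc k)) *\<^sub>R u) - NLL 1 \<omega> \<theta>0) / (1 / real (Suc k)))"
  define w where "w = (\<lambda>\<omega>. \<bar>NLL 1 \<omega> (\<theta>0 + u) - NLL 1 \<omega> \<theta>0\<bar> + \<bar>NLL 1 \<omega> (\<theta>0 - u) - NLL 1 \<omega> \<theta>0\<bar>)"
  have w: "integrable M w" unfolding w_def by (intro Bochner_Integration.integrable_add integrable_abs Bochner_Integration.integrable_diff int_NLL)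
  have q: "integrable M (q k)" for k
    unfolding q_def by (intro integrable_divide Bochner_Integration.integrable_diff int_NLL)
  have lim: "(\<lambda>k. q k \<omega>) \<longlonglongrightarrow> D1 (NLL 1 \<omega>) \<theta>0 u" if "\<omega> \<in> space M" for \<omega>
    unfolding q_def by (intro difference_quotient_seq_tendsto three_times_differentiableD(1)[OF diff_NLL] that) simp
  have bound: "\<bar>q k \<omega>\<bar> \<le> w \<omega>" if "\<omega> \<in> space M" for k \<omega>
  proof -
    define f where "f = NLL 1 \<omega>"
    have c: "convex_on UNIV f" and d: "f differentiable_on UNIV"
      unfolding f_def using that by (auto intro!: convex_NLL three_times_differentiableD(1)[OF diff_NLL])
    define t where "t = 1 / real (Suc k)"
    have t: "0 < t" "t \<le> 1" by (auto simp: t_def)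
    have "f ((1 - t) *\<^sub>R \<theta>0 + t *\<^sub>R (\<theta>0 + u)) \<le> (1 - t) * f \<theta>0 + t * f (\<theta>0 + u)"
      using t by (intro convex_onD[OF c]) auto
    then have "f (\<theta>0 + t *\<^sub>R u) - f \<theta>0 \<le> (f (\<theta>0 + u) - f \<theta>0) * t" by (simp add: algebra_simps)
    moreover have q_eq: "q k \<omega> = (f (\<theta>0 + t *\<^sub>R u) - f \<theta>0) / t"
      by (simp only: q_def f_def t_def)
    ultimately have up: "q k \<omega> \<le> f (\<theta>0 + u) - f \<theta>0"
      using t by (simp add: divide_le_eq)
    have "f (\<theta>0 + t *\<^sub>R u) \<ge> f \<theta>0 + t * D1 f \<theta>0 u"
      using convex_gradient_ineq[OF c d, of \<theta>0 "t *\<^sub>R u"] linear_D1[OF d] by (simp add: linear_scale)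
    then have "D1 f \<theta>0 u \<le> q k \<omega>"
      using t by (simp add: q_eq le_divide_eq mult.commute)
    moreover have "f (\<theta>0 - u) \<ge> f \<theta>0 - D1 f \<theta>0 u"
      using convex_gradient_ineq[OF c d, of \<theta>0 "- u"] linear_D1[OF d] by (simp add: linear_neg)
    moreover have "w \<omega> = \<bar>f (\<theta>0 + u) - f \<theta>0\<bar> + \<bar>f (\<theta>0 - u) - f \<theta>0\<bar>"
      by (simp only: w_def f_def)
    ultimately show ?thesis using up by linarith
  qed
  have int: "integrable M (\<lambda>\<omega>. D1 (NLL 1 \<omega>) \<theta>0 u)"
    and conv: "(\<lambda>k. integral\<^sup>L M (q k)) \<longlonglongrightarrow> (\<integral>\<omega>. D1 (NLL 1 \<omega>) \<theta>0 u \<partial>M)"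
    using lim bound q w measurable_D1_NLL[of 1 \<theta>0 u]
    by (auto intro!: integrable_dominated_convergence[where s=q and w=w] integral_dominated_convergence[where w=w])
  have "integral\<^sup>L M (q k) \<ge> 0" for k
  proof -
    have "(\<integral>\<omega>. NLL 1 \<omega> \<theta>0 \<partial>M) \<le> (\<integral>\<omega>. NLL 1 \<omega> y \<partial>M)" for y
      using argmin by (auto simp: unique_arg_min_def is_arg_min_linorder)
    then show ?thesis
      by (simp only: q_def integral_divide_zero Bochner_Integration.integral_diff[OF int_NLL int_NLL]) simp
  qed
  then have "(\<integral>\<omega>. D1 (NLL 1 \<omega>) \<theta>0 u \<partial>M) \<ge> 0"
    using conv by (intro tendsto_lowerbound[OF conv]) auto
  with int show ?thesis by blast
qed

text \<open>Nonnegative in the direction \<open>u\<close> and in the direction \<open>-u\<close>.\<close>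

lemma expected_D1_zero: "(\<integral>\<omega>. D1 (NLL 1 \<omega>) \<theta>0 u \<partial>M) = 0"
proof -
  have "(\<integral>\<omega>. D1 (NLL 1 \<omega>) \<theta>0 (- u) \<partial>M) = (\<integral>\<omega>. - D1 (NLL 1 \<omega>) \<theta>0 u \<partial>M)"
    by (intro Bochner_Integration.integral_cong refl)
      (simp add: linear_neg[OF linear_D1[OF three_times_differentiableD(1)[OF diff_NLL]]])
  then show ?thesis using expected_D1_nonneg[of u] expected_D1_nonneg[of "- u"] by simp
qed

lemma score_sum_small:
  assumes \<eta>: "\<eta> > 0"
  shows "with_prob_tending_to_1 M (\<lambda>n \<omega>. \<bar>\<Sum>i=1..n. D1 (NLL i \<omega>) \<theta>0 (axis j 1)\<bar> \<le> \<eta> * real n)"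
proof -
  let ?h = "D1_lim \<theta>0 (axis j 1)"
  have eq: "?h (NLL i \<omega>) = D1 (NLL i \<omega>) \<theta>0 (axis j 1)" if "i \<ge> 1" "\<omega> \<in> space M" for i \<omega>
    by (rule D1_lim_eq[OF three_times_differentiableD(1)[OF diff_NLL[OF that]]])
  have "integrable M (\<lambda>\<omega>. outer (grad (NLL 1 \<omega>) \<theta>0) (grad (NLL 1 \<omega>) \<theta>0) $ j $ j)"
    by (intro integrable_bounded_linear[OF bounded_linear_vec_nth] int_fisher)
  then have "integrable M (\<lambda>\<omega>. (D1 (NLL 1 \<omega>) \<theta>0 (axis j 1))\<^sup>2)"
    by (simp add: outer_def grad_def power2_eq_square)
  then have sq: "integrable M (\<lambda>\<omega>. (?h (NLL 1 \<omega>))\<^sup>2)"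
    by (subst Bochner_Integration.integrable_cong[OF refl, of _ _ "\<lambda>\<omega>. (D1 (NLL 1 \<omega>) \<theta>0 (axis j 1))\<^sup>2"])
      (simp_all add: eq)
  have zero: "(\<integral>\<omega>. ?h (NLL 1 \<omega>) \<partial>M) = 0"
    using expected_D1_zero[of "axis j 1"]
    by (subst Bochner_Integration.integral_cong[OF refl, of _ _ "\<lambda>\<omega>. D1 (NLL 1 \<omega>) \<theta>0 (axis j 1)"])
      (simp_all add: eq)
  have "(\<Sum>i=1..n. ?h (NLL i \<omega>)) = (\<Sum>i=1..n. D1 (NLL i \<omega>) \<theta>0 (axis j 1))" if "\<omega> \<in> space M" for n \<omega>
    using that by (intro sum.cong refl eq) auto
  then show ?thesis
    by (intro prob_tending_to_1_mono[OF weak_law[OF measurable_D1_lim sq \<eta>]] always_eventually) (use zero in simp)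
qed

text \<open>Dominates the modulus of each Hessian entry. The Hessian is truncated as a whole, not entry by
  entry, so that the truncated matrix is either the Hessian or zero and stays positive semidefinite.\<close>

definition hess_bound :: "(real^'p \<Rightarrow> real) \<Rightarrow> real" where
  "hess_bound f = (\<Sum>j\<in>UNIV. \<Sum>k\<in>UNIV. \<bar>D2_lim \<theta>0 (axis j 1) (axis k 1) f\<bar>)"

definition trunc_hess :: "nat \<Rightarrow> 'p \<Rightarrow> 'p \<Rightarrow> (real^'p \<Rightarrow> real) \<Rightarrow> real" where
  "trunc_hess T j k f = (if hess_bound f \<le> real T then D2_lim \<theta>0 (axis j 1) (axis k 1) f else 0)"

lemma measurable_trunc_hess[measurable]: "trunc_hess T j k \<in> borel_measurable path_space"
  unfolding trunc_hess_def[abs_def] hess_bound_def by measurable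

lemma D2_lim_NLL: "i \<ge> 1 \<Longrightarrow> \<omega> \<in> space M \<Longrightarrow> D2_lim x u v (NLL i \<omega>) = D2 (NLL i \<omega>) x u v"
  by (intro D2_lim_eq diff_NLL)

lemma abs_D2_lim_le_hess_bound: "\<bar>D2_lim \<theta>0 (axis j 1) (axis k 1) f\<bar> \<le> hess_bound f"
proof -
  have "\<bar>D2_lim \<theta>0 (axis j 1) (axis k 1) f\<bar> \<le> (\<Sum>k\<in>UNIV. \<bar>D2_lim \<theta>0 (axis j 1) (axis k 1) f\<bar>)"
    by (rule member_le_sum) auto
  also have "\<dots> \<le> hess_bound f"
    unfolding hess_bound_def
    by (rule member_le_sum[where f="\<lambda>j. \<Sum>k\<in>UNIV. \<bar>D2_lim \<theta>0 (axis j 1) (axis k 1) f\<bar>"]) (auto intro: sum_nonneg)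
  finally show ?thesis .
qed

lemma trunc_hess_le: "\<bar>trunc_hess T j k f\<bar> \<le> real T"
  using abs_D2_lim_le_hess_bound[of j k f] by (auto simp: trunc_hess_def)

lemma trunc_hess_mean_tendsto: "(\<lambda>T. \<integral>\<omega>. trunc_hess T j k (NLL 1 \<omega>) \<partial>M) \<longlonglongrightarrow> J $ j $ k"
proof -
  have comp: "integrable M (\<lambda>\<omega>. hessian (NLL 1 \<omega>) \<theta>0 $ j $ k)"
    "(\<integral>\<omega>. hessian (NLL 1 \<omega>) \<theta>0 $ j $ k \<partial>M) = J $ j $ k"
    unfolding J using int_J
    by (auto intro!: integrable_bounded_linear[OF bounded_linear_vec_nth]
        simp: integral_bounded_linear[OF bounded_linear_vec_nth] integrable_bounded_linear[OF bounded_linear_vec_nth])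
  have eq: "D2_lim \<theta>0 (axis j 1) (axis k 1) (NLL 1 \<omega>) = hessian (NLL 1 \<omega>) \<theta>0 $ j $ k" if "\<omega> \<in> space M" for \<omega>
    using that by (simp add: D2_lim_NLL hessian_def)
  have "(\<lambda>T. \<integral>\<omega>. trunc_hess T j k (NLL 1 \<omega>) \<partial>M) \<longlonglongrightarrow> (\<integral>\<omega>. hessian (NLL 1 \<omega>) \<theta>0 $ j $ k \<partial>M)"
  proof (rule integral_dominated_convergence[where w="\<lambda>\<omega>. \<bar>hessian (NLL 1 \<omega>) \<theta>0 $ j $ k\<bar>"])
    show "(\<lambda>\<omega>. hessian (NLL 1 \<omega>) \<theta>0 $ j $ k) \<in> borel_measurable M" using comp(1) by simp
    show "(\<lambda>\<omega>. trunc_hess T j k (NLL 1 \<omega>)) \<in> borel_measurable M" for T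
      by (rule measurable_compose[OF measurable_term measurable_trunc_hess]) simp
    show "integrable M (\<lambda>\<omega>. \<bar>hessian (NLL 1 \<omega>) \<theta>0 $ j $ k\<bar>)" using comp(1) by simp
    show "AE \<omega> in M. (\<lambda>T. trunc_hess T j k (NLL 1 \<omega>)) \<longlonglongrightarrow> hessian (NLL 1 \<omega>) \<theta>0 $ j $ k"
    proof (rule AE_I2)
      fix \<omega> assume \<omega>: "\<omega> \<in> space M"
      have "\<forall>\<^sub>F T in sequentially. hess_bound (NLL 1 \<omega>) \<le> real T"
        using filterlim_real_sequentially by (simp add: filterlim_at_top)
      then have "\<forall>\<^sub>F T in sequentially. trunc_hess T j k (NLL 1 \<omega>) = hessian (NLL 1 \<omega>) \<theta>0 $ j $ k"
        by eventually_elim (use eq[OF \<omega>] in \<open>simp add: trunc_hess_def\<close>)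
      then show "(\<lambda>T. trunc_hess T j k (NLL 1 \<omega>)) \<longlonglongrightarrow> hessian (NLL 1 \<omega>) \<theta>0 $ j $ k"
        by (rule tendsto_eventually)
    qed
    show "AE \<omega> in M. norm (trunc_hess T j k (NLL 1 \<omega>)) \<le> \<bar>hessian (NLL 1 \<omega>) \<theta>0 $ j $ k\<bar>" for T
    proof (rule AE_I2)
      fix \<omega> assume "\<omega> \<in> space M"
      from eq[OF this] show "norm (trunc_hess T j k (NLL 1 \<omega>)) \<le> \<bar>hessian (NLL 1 \<omega>) \<theta>0 $ j $ k\<bar>"
        by (simp add: trunc_hess_def)
    qed
  qed
  then show ?thesis unfolding comp(2) .
qed

text \<open>Dropping the summands with large Hessians only decreases the sum, as all of them are positive
  semidefinite. The weak law for the bounded entries of the rest and a truncation level at which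
  their mean is close to \<open>J\<close> preserve at least half of a lower bound for the quadratic form of \<open>J\<close>.\<close>

lemma hessian_sum_lower_bound:
  "\<exists>\<alpha>>0. with_prob_tending_to_1 M (\<lambda>n \<omega>. \<forall>u. (\<Sum>i=1..n. D2 (NLL i \<omega>) \<theta>0 u u) \<ge> \<alpha> * real n * (norm u)\<^sup>2)"
proof -
  obtain c where c: "c > 0" "\<And>u. u \<bullet> (J *v u) \<ge> c * (norm u)\<^sup>2"
    using pos_def_lower_bound[OF pd_J] by blast
  define p where "p = real CARD('p)"
  have p: "p > 0" by (simp add: p_def)
  \<comment> \<open>Entrywise errors of size \<open>d\<close> perturb the quadratic form by at most a quarter of \<open>c\<close>; this is spent twice,
    on the truncation and on the fluctuation.\<close>
  define d where "d = c / (4 * p\<^sup>2)"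
  have d: "d > 0" "p\<^sup>2 * d = c / 4" using c(1) p by (simp_all add: d_def)
  have "\<forall>\<^sub>F T in sequentially. \<forall>j\<in>UNIV. \<forall>k\<in>UNIV. \<bar>(\<integral>\<omega>. trunc_hess T j k (NLL 1 \<omega>) \<partial>M) - J $ j $ k\<bar> < d"
    using tendstoD[OF trunc_hess_mean_tendsto d(1)]
    by (intro eventually_ball_finite ballI) (auto simp: dist_real_def)
  then obtain T where T: "\<And>j k. \<bar>(\<integral>\<omega>. trunc_hess T j k (NLL 1 \<omega>) \<partial>M) - J $ j $ k\<bar> < d"
    by (auto simp: eventually_sequentially)
  define E where "E = (\<chi> j k. \<integral>\<omega>. trunc_hess T j k (NLL 1 \<omega>) \<partial>M)"
  define S where "S = (\<lambda>n \<omega>. (\<chi> j k. (\<Sum>i=1..n. trunc_hess T j k (NLL i \<omega>))) :: real^'p^'p)"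
  have "with_prob_tending_to_1 M (\<lambda>n \<omega>. \<forall>j\<in>UNIV. \<forall>k\<in>UNIV. 
      \<bar>(\<Sum>i=1..n. trunc_hess T j k (NLL i \<omega>)) - real n * (\<integral>\<omega>. trunc_hess T j k (NLL 1 \<omega>) \<partial>M)\<bar> \<le> d * real n)"
  proof (intro prob_tending_to_1_all finite weak_law measurable_trunc_hess d(1))
    fix j k
    have "(\<lambda>\<omega>. trunc_hess T j k (NLL 1 \<omega>)) \<in> borel_measurable M"
      by (rule measurable_compose[OF measurable_term measurable_trunc_hess]) simp
    moreover have "norm ((trunc_hess T j k f)\<^sup>2) \<le> (real T)\<^sup>2" for f
      using power_mono[OF trunc_hess_le[of T j k f], of 2] by simp
    ultimately show "integrable M (\<lambda>\<omega>. (trunc_hess T j k (NLL 1 \<omega>))\<^sup>2)"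
      by (intro integrable_const_bound[of _ "(real T)\<^sup>2"]) auto
  qed
  then have "with_prob_tending_to_1 M (\<lambda>n \<omega>. \<forall>u. (\<Sum>i=1..n. D2 (NLL i \<omega>) \<theta>0 u u) \<ge> c / 2 * real n * (norm u)\<^sup>2)"
  proof (rule prob_tending_to_1_mono, intro always_eventually allI ballI impI)
    fix n \<omega> and u :: "real^'p"
    assume \<omega>: "\<omega> \<in> space M"
      and near: "\<forall>j\<in>UNIV. \<forall>k\<in>UNIV. \<bar>(\<Sum>i=1..n. trunc_hess T j k (NLL i \<omega>))
        - real n * (\<integral>\<omega>. trunc_hess T j k (NLL 1 \<omega>) \<partial>M)\<bar> \<le> d * real n"
    have "\<bar>u \<bullet> (S n \<omega> *v u) - u \<bullet> ((\<chi> j k. real n * E $ j $ k) *v u)\<bar> \<le> p\<^sup>2 * (d * real n) * (norm u)\<^sup>2"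
      unfolding p_def using near by (intro quadratic_form_perturbation) (simp add: S_def E_def)
    moreover have "u \<bullet> ((\<chi> j k. real n * E $ j $ k) *v u) = real n * (u \<bullet> (E *v u))"
      by (simp add: inner_vec_def matrix_vector_mult_def sum_distrib_left mult_ac)
    moreover have "\<bar>u \<bullet> (E *v u) - u \<bullet> (J *v u)\<bar> \<le> p\<^sup>2 * d * (norm u)\<^sup>2"
      unfolding p_def using T by (intro quadratic_form_perturbation) (simp add: E_def less_imp_le)
    ultimately have "u \<bullet> (S n \<omega> *v u) \<ge> c / 2 * real n * (norm u)\<^sup>2"
    proof -
      assume 1: "\<bar>u \<bullet> (S n \<omega> *v u) - u \<bullet> ((\<chi> j k. real n * E $ j $ k) *v u)\<bar> \<le> p\<^sup>2 * (d * real n) * (norm u)\<^sup>2"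
        and 2: "u \<bullet> ((\<chi> j k. real n * E $ j $ k) *v u) = real n * (u \<bullet> (E *v u))"
        and 3: "\<bar>u \<bullet> (E *v u) - u \<bullet> (J *v u)\<bar> \<le> p\<^sup>2 * d * (norm u)\<^sup>2"
      have "u \<bullet> (E *v u) \<ge> 3 * c / 4 * (norm u)\<^sup>2"
        using abs_ge_minus_self[of "u \<bullet> (E *v u) - u \<bullet> (J *v u)"] 3 c(2)[of u] unfolding d(2) by linarith
      then have "real n * (3 * c / 4 * (norm u)\<^sup>2) \<le> real n * (u \<bullet> (E *v u))"
        by (intro mult_left_mono) auto
      moreover have "real n * (3 * c / 4 * (norm u)\<^sup>2) = 3 * (c / 4 * real n * (norm u)\<^sup>2)" by simp
      moreover have "c / 2 * real n * (norm u)\<^sup>2 = 2 * (c / 4 * real n * (norm u)\<^sup>2)" by simp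
      moreover have "p\<^sup>2 * (d * real n) * (norm u)\<^sup>2 = c / 4 * real n * (norm u)\<^sup>2"
        by (simp add: d(2)[symmetric] mult_ac)
      ultimately show ?thesis using 1 2 by linarith
    qed
    also have "u \<bullet> (S n \<omega> *v u) \<le> (\<Sum>i=1..n. D2 (NLL i \<omega>) \<theta>0 u u)"
    proof -
      have "u \<bullet> (S n \<omega> *v u) = (\<Sum>i=1..n. u \<bullet> ((\<chi> j k. trunc_hess T j k (NLL i \<omega>)) *v u))"
      proof -
        have "S n \<omega> = (\<Sum>i=1..n. (\<chi> j k. trunc_hess T j k (NLL i \<omega>)))"
          by (simp add: S_def vec_eq_iff)
        then show ?thesis
          by (simp add: quadratic_form_sum)
      qed
      also have "\<dots> \<le> (\<Sum>i=1..n. D2 (NLL i \<omega>) \<theta>0 u u)"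
      proof (rule sum_mono)
        fix i assume "i \<in> {1..n}"
        then have i: "i \<ge> 1" by simp
        have f: "three_times_differentiable (NLL i \<omega>)" by (rule diff_NLL[OF i \<omega>])
        have "(\<chi> j k. trunc_hess T j k (NLL i \<omega>)) = (if hess_bound (NLL i \<omega>) \<le> real T then hessian (NLL i \<omega>) \<theta>0 else 0)"
          by (simp add: trunc_hess_def hessian_def vec_eq_iff D2_lim_NLL[OF i \<omega>])
        then show "u \<bullet> ((\<chi> j k. trunc_hess T j k (NLL i \<omega>)) *v u) \<le> D2 (NLL i \<omega>) \<theta>0 u u"
          using convex_D2_nonneg[OF convex_NLL[OF i \<omega>] f, of \<theta>0 u] by (simp add: D2_eq_hessian[OF f])
      qed
      finally show ?thesis .
    qed
    finally show "(\<Sum>i=1..n. D2 (NLL i \<omega>) \<theta>0 u u) \<ge> c / 2 * real n * (norm u)\<^sup>2" .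
  qed
  then show ?thesis using c(1) by (intro exI[of _ "c / 2"]) simp
qed

text \<open>The lower integral in the hypothesis is over a supremum of unknown measurability. It bounds the integral of
  a multiple of the measurable functional \<open>third_diff_const\<close>, to which Markov's inequality applies.\<close>

lemma third_diff_const_sums_bounded:
  assumes \<Delta>: "(\<integral>\<^sup>+\<omega>. third_sup (\<lambda>\<theta> v1 v2 v3.
      D3 (NLL 1 \<omega>) \<theta> (msqrt J *v v1) (msqrt J *v v2) (msqrt J *v v3)) \<partial>M) < \<infinity>"
    and D: "countable D" and \<epsilon>: "\<epsilon> > 0"
  shows "\<exists>C>0. \<forall>n\<ge>1. \<exists>A\<in>events. prob A \<ge> 1 - \<epsilon> \<and>
    (\<forall>\<omega>\<in>A. (\<Sum>i=1..n. third_diff_const D (NLL i \<omega>)) \<le> ennreal (C * real n))"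
proof (rule sums_bounded_in_probability[OF measurable_third_diff_const[OF D] _ \<epsilon>])
  define R where "R = matrix_inv (msqrt J)"
  obtain k where k: "k > 0" "\<And>y. norm (R *v y) \<le> k * norm y"
    using linear_bounded_pos[of "(*v) R"] by auto
  let ?T = "\<lambda>\<omega>. third_sup (\<lambda>\<theta> v1 v2 v3. D3 (NLL 1 \<omega>) \<theta> (msqrt J *v v1) (msqrt J *v v2) (msqrt J *v v3))"
  have le: "ennreal (1 / k ^ 3) * third_diff_const D (NLL 1 \<omega>) \<le> ?T \<omega>" if \<omega>: "\<omega> \<in> space M" for \<omega>
  proof (cases "?T \<omega>")
    case (real t)
    have "third_bounded (NLL 1 \<omega>) (k ^ 3 * t)"
      using real k diff_NLL[OF _ \<omega>, of 1] msqrt_invertible[OF pd_J]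
      by (intro third_bounded_if_preconditioned[where S="msqrt J"]) (auto simp: R_def)
    then have "ennreal (1 / k ^ 3) * third_diff_const D (NLL 1 \<omega>) \<le> ennreal (1 / k ^ 3) * ennreal (k ^ 3 * t)"
      by (intro mult_left_mono third_diff_const_le) auto
    also have "\<dots> = ennreal (1 / k ^ 3 * (k ^ 3 * t))"
      using k by (intro ennreal_mult'[symmetric]) simp
    also have "1 / k ^ 3 * (k ^ 3 * t) = t" using k by simp
    finally show ?thesis using real by simp
  qed simp
  have meas: "(\<lambda>\<omega>. third_diff_const D (NLL 1 \<omega>)) \<in> borel_measurable M"
    by (rule measurable_compose[OF measurable_term measurable_third_diff_const[OF D]]) simp
  have "ennreal (1 / k ^ 3) * (\<integral>\<^sup>+\<omega>. third_diff_const D (NLL 1 \<omega>) \<partial>M)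
      = (\<integral>\<^sup>+\<omega>. ennreal (1 / k ^ 3) * third_diff_const D (NLL 1 \<omega>) \<partial>M)"
    by (rule nn_integral_cmult[OF meas, symmetric])
  also have "\<dots> \<le> (\<integral>\<^sup>+\<omega>. ?T \<omega> \<partial>M)" using le by (intro nn_integral_mono)
  also have "\<dots> < \<infinity>" by (rule \<Delta>)
  finally have fin: "ennreal (1 / k ^ 3) * (\<integral>\<^sup>+\<omega>. third_diff_const D (NLL 1 \<omega>) \<partial>M) < \<top>" by simp
  moreover have "ennreal (1 / k ^ 3) \<noteq> 0" using k by simp
  ultimately show "(\<integral>\<^sup>+\<omega>. third_diff_const D (NLL 1 \<omega>) \<partial>M) < \<infinity>"
    by (auto simp: ennreal_mult_less_top)
qed

text \<open>On the intersection of three events (third differences of order \<open>n\<close>, gradient small compared to \<open>n\<close>,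
  Hessian at least \<open>\<alpha> n\<close>) the deterministic criterion applies. The allowance \<open>\<alpha>\<^sup>2 n / (8 L)\<close> for the gradient is
  split evenly between the prior, whose gradient is fixed, and the likelihood. The constant \<open>L\<close> depends on \<open>\<epsilon>\<close>
  through Markov's inequality and is chosen first, before the accuracy \<open>\<eta>\<close> of the gradient.\<close>

theorem laplace_regular_in_probability:
  assumes prior: "three_times_differentiable \<phi>0" "convex_on UNIV \<phi>0" "third_bounded \<phi>0 L0"
    and \<Delta>: "(\<integral>\<^sup>+\<omega>. third_sup (\<lambda>\<theta> v1 v2 v3.
      D3 (NLL 1 \<omega>) \<theta> (msqrt J *v v1) (msqrt J *v v2) (msqrt J *v v3)) \<partial>M) < \<infinity>"
    and \<epsilon>: "\<epsilon> > 0"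
  shows "\<exists>C>0. \<forall>\<^sub>F n in sequentially. \<exists>A\<in>events. prob A \<ge> 1 - \<epsilon> \<and>
    (\<forall>\<omega>\<in>A. laplace_defined (neg_log_post \<phi>0 NLL n \<omega>) \<and>
       Delta3 (neg_log_post \<phi>0 NLL n \<omega>) \<le> ennreal (C / sqrt (real n)))"
proof -
  obtain D :: "((real^'p) \<times> (real^'p) \<times> (real^'p) \<times> (real^'p)) set"
    where D: "countable D" "closure D = UNIV"
    using countable_dense_set_exists by blast
  have \<epsilon>2: "\<epsilon> / 2 > 0" using \<epsilon> by simp
  obtain K where K: "K > 0" "\<And>n. n \<ge> 1 \<Longrightarrow> \<exists>A\<in>events. prob A \<ge> 1 - \<epsilon> / 2 \<and>
      (\<forall>\<omega>\<in>A. (\<Sum>i=1..n. third_diff_const D (NLL i \<omega>)) \<le> ennreal (K * real n))"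
    using third_diff_const_sums_bounded[OF \<Delta> D(1) \<epsilon>2] by blast
  obtain \<alpha> where \<alpha>: "\<alpha> > 0"
    and hess: "with_prob_tending_to_1 M (\<lambda>n \<omega>. \<forall>u. (\<Sum>i=1..n. D2 (NLL i \<omega>) \<theta>0 u u) \<ge> \<alpha> * real n * (norm u)\<^sup>2)"
    using hessian_sum_lower_bound by blast
  define L where "L = L0 + K"
  have L0: "L0 \<ge> 0" using prior(3) by (rule third_bounded_nonneg)
  then have L: "L > 0" using K(1) by (simp add: L_def)
  define p where "p = real CARD('p)"
  have p: "p > 0" by (simp add: p_def)
  define \<eta> where "\<eta> = \<alpha>\<^sup>2 / (16 * L * p)"
  have \<eta>: "\<eta> > 0" "p * \<eta> = \<alpha>\<^sup>2 / (16 * L)" using \<alpha> L p by (simp_all add: \<eta>_def)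
  have score: "with_prob_tending_to_1 M
      (\<lambda>n \<omega>. \<forall>j\<in>UNIV. \<bar>\<Sum>i=1..n. D1 (NLL i \<omega>) \<theta>0 (axis j 1)\<bar> \<le> \<eta> * real n)"
    by (intro prob_tending_to_1_all score_sum_small \<eta>(1)) simp
  define C where "C = L / sqrt (\<alpha> / 2) ^ 3"
  have C: "C > 0" using L \<alpha> by (simp add: C_def)
  have "\<forall>\<^sub>F n in sequentially. norm (grad \<phi>0 \<theta>0) / (\<alpha>\<^sup>2 / (16 * L)) < real n"
    using filterlim_real_sequentially by (simp add: filterlim_at_top_dense)
  with prob_tending_to_1_conj[OF hess score, unfolded with_prob_tending_to_1_def, rule_format, OF \<epsilon>2]
    eventually_ge_at_top[of 1]
  have "\<forall>\<^sub>F n in sequentially. \<exists>A\<in>events. prob A \<ge> 1 - \<epsilon> \<and>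
    (\<forall>\<omega>\<in>A. laplace_defined (neg_log_post \<phi>0 NLL n \<omega>) \<and>
       Delta3 (neg_log_post \<phi>0 NLL n \<omega>) \<le> ennreal (C / sqrt (real n)))"
  proof eventually_elim
    case (elim n)
    obtain A where A: "A \<in> events" "prob A \<ge> 1 - \<epsilon> / 2"
      and A_hess: "\<And>\<omega> u. \<omega> \<in> A \<Longrightarrow> (\<Sum>i=1..n. D2 (NLL i \<omega>) \<theta>0 u u) \<ge> \<alpha> * real n * (norm u)\<^sup>2"
      and A_score: "\<And>\<omega> j. \<omega> \<in> A \<Longrightarrow> \<bar>\<Sum>i=1..n. D1 (NLL i \<omega>) \<theta>0 (axis j 1)\<bar> \<le> \<eta> * real n"
      using elim(1) by auto
    obtain A' where A': "A' \<in> events" "prob A' \<ge> 1 - \<epsilon> / 2"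
      and A'_third: "\<And>\<omega>. \<omega> \<in> A' \<Longrightarrow> (\<Sum>i=1..n. third_diff_const D (NLL i \<omega>)) \<le> ennreal (K * real n)"
      using K(2)[OF elim(2)] by blast
    have n: "real n \<ge> 1" using elim(2) by simp
    have prior_score: "norm (grad \<phi>0 \<theta>0) < \<alpha>\<^sup>2 / (16 * L) * real n"
    proof -
      have "\<alpha>\<^sup>2 / (16 * L) > 0" using \<alpha> L by simp
      then show ?thesis using elim(3) by (simp only: pos_divide_less_eq mult.commute)
    qed
    have "laplace_defined (neg_log_post \<phi>0 NLL n \<omega>) \<and>
       Delta3 (neg_log_post \<phi>0 NLL n \<omega>) \<le> ennreal (C / sqrt (real n))" if \<omega>: "\<omega> \<in> A \<inter> A'" for \<omega>
    proof -
      have sp: "\<omega> \<in> space M" using \<omega> A(1) sets.sets_into_space by blast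
      define f where "f = neg_log_post \<phi>0 NLL n \<omega>"
      note d = diff_NLL[OF _ sp]
      have f: "three_times_differentiable f"
        unfolding f_def by (rule three_times_differentiable_neg_log_post[of \<phi>0 NLL \<omega>, OF prior(1) d])
      have c: "convex_on UNIV f"
        unfolding f_def by (rule convex_neg_log_post[of \<phi>0 NLL \<omega>, OF prior(2) convex_NLL[OF _ sp]])
      define k where "k = (\<lambda>i. enn2real (third_diff_const D (NLL i \<omega>)))"
      have sum_fin: "(\<Sum>i=1..n. third_diff_const D (NLL i \<omega>)) \<le> ennreal (K * real n)" using A'_third \<omega> by simp
      have fin: "third_diff_const D (NLL i \<omega>) < \<infinity>" if "1 \<le> i" "i \<le> n" for i
      proof -
        have "third_diff_const D (NLL i \<omega>) \<le> (\<Sum>i=1..n. third_diff_const D (NLL i \<omega>))"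
          using that by (intro member_le_sum) auto
        also have "\<dots> < \<infinity>" using sum_fin by (simp add: le_less_trans)
        finally show ?thesis .
      qed
      have "third_bounded f (L0 + (\<Sum>i=1..n. k i))"
        unfolding f_def k_def
        by (intro third_bounded_neg_log_post[of \<phi>0 L0 n NLL \<omega>, OF prior(3)]
            third_bounded_third_diff_const[OF _ D(2) fin] continuous_on_UNIV_differentiable
            three_times_differentiableD(1)[OF d])
      moreover have "(\<Sum>i=1..n. k i) \<le> K * real n"
      proof -
        have "ennreal (\<Sum>i=1..n. k i) = (\<Sum>i=1..n. ennreal (k i))"
          by (intro sum_ennreal[symmetric]) (simp add: k_def)
        also have "\<dots> = (\<Sum>i=1..n. third_diff_const D (NLL i \<omega>))"
          by (intro sum.cong refl) (use fin in \<open>auto simp: k_def\<close>)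
        also have "\<dots> \<le> ennreal (K * real n)" by (rule sum_fin)
        finally show ?thesis using K(1) by (subst (asm) ennreal_le_iff) auto
      qed
      moreover have "L0 \<le> L0 * real n" using L0 n mult_left_mono[of 1 "real n" L0] by simp
      \<comment> \<open>The prior contributes one term only; \<open>n \<ge> 1\<close> absorbs it into the linear bound.\<close>
      ultimately have b: "third_bounded f (L * real n)"
        by (elim third_bounded_mono) (simp add: L_def distrib_right)
      have h: "D2 f \<theta>0 u u \<ge> \<alpha> * real n * (norm u)\<^sup>2" for u
      proof -
        have "D2 f \<theta>0 u u = D2 \<phi>0 \<theta>0 u u + (\<Sum>i=1..n. D2 (NLL i \<omega>) \<theta>0 u u)"
          unfolding f_def by (rule D2_neg_log_post[of \<phi>0 NLL \<omega>, OF prior(1) d])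
        then show ?thesis using A_hess[of \<omega> u] \<omega> convex_D2_nonneg[OF prior(2,1), of \<theta>0 u] by simp
      qed
      have g: "norm (grad f \<theta>0) < (\<alpha> * real n)\<^sup>2 / (8 * (L * real n))"
      proof -
        define s where "s = (\<chi> j. \<Sum>i=1..n. D1 (NLL i \<omega>) \<theta>0 (axis j 1))"
        have "grad f \<theta>0 = grad \<phi>0 \<theta>0 + s"
          unfolding f_def by (simp add: grad_def vec_eq_iff s_def D1_neg_log_post[of \<phi>0 NLL \<omega>, OF prior(1) d])
        then have "norm (grad f \<theta>0) \<le> norm (grad \<phi>0 \<theta>0) + norm s" by (simp add: norm_triangle_ineq)
        also have "norm s \<le> (\<Sum>j\<in>UNIV. \<bar>s $ j\<bar>)" by (rule norm_le_l1_cart)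
        also have "\<dots> \<le> (\<Sum>j\<in>(UNIV::'p set). \<eta> * real n)"
          using A_score \<omega> by (intro sum_mono) (simp add: s_def)
        also have "\<dots> = p * \<eta> * real n" by (simp add: p_def)
        also have "norm (grad \<phi>0 \<theta>0) + p * \<eta> * real n < \<alpha>\<^sup>2 / (8 * L) * real n"
          unfolding \<eta>(2) using prior_score by simp
        also have "\<dots> = (\<alpha> * real n)\<^sup>2 / (8 * (L * real n))"
          using n by (simp add: power2_eq_square)
        finally show ?thesis by simp
      qed
      have pos: "L * real n > 0" "\<alpha> * real n > 0" using L \<alpha> n by auto
      have "L * real n / sqrt (\<alpha> * real n / 2) ^ 3 = C / sqrt (real n)"
      proof -
        have "sqrt (\<alpha> * real n / 2) = sqrt (\<alpha> / 2) * sqrt (real n)"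
          by (simp add: real_sqrt_mult[symmetric])
        moreover have "sqrt (real n) ^ 3 = real n * sqrt (real n)"
          by (simp add: power3_eq_cube)
        ultimately show ?thesis using n by (simp add: C_def power_mult_distrib)
      qed
      then show ?thesis
        using laplace_regular[OF f c b pos h g] unfolding f_def by simp
    qed
    moreover have "prob (A \<inter> A') \<ge> 1 - \<epsilon>" using prob_Int_ge[OF A A'] by simp
    ultimately show ?case using A(1) A'(1) by (intro bexI[of _ "A \<inter> A'"]) auto
  qed
  then show ?thesis using C by blast
qed

end

theorem corollary6:
  fixes M :: "'w measure"
    and \<phi>0 :: "real^'p \<Rightarrow> real"
    and NLL :: "nat \<Rightarrow> 'w \<Rightarrow> real^'p \<Rightarrow> real"
    and \<theta>0 :: "real^'p"
    and J :: "real^'p^'p"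
  assumes "prob_space M"
    and iid_indep: "prob_space.indep_vars M (\<lambda>_. \<Pi>\<^sub>M \<theta>\<in>UNIV. borel) NLL {1..}"
    and iid_distr: "\<And>i. i \<ge> 1 \<Longrightarrow>
      distr M (\<Pi>\<^sub>M \<theta>\<in>UNIV. borel) (NLL i) = distr M (\<Pi>\<^sub>M \<theta>\<in>UNIV. borel) (NLL 1)"
    and diff_prior: "three_times_differentiable \<phi>0"
    and diff_NLL: "\<And>i \<omega>. i \<ge> 1 \<Longrightarrow> \<omega> \<in> space M \<Longrightarrow> three_times_differentiable (NLL i \<omega>)"
    and int_NLL: "\<And>\<theta>. integrable M (\<lambda>\<omega>. NLL 1 \<omega> \<theta>)"
    and argmin: "unique_arg_min (\<lambda>\<theta>. \<integral>\<omega>. NLL 1 \<omega> \<theta> \<partial>M) \<theta>0"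
    and int_fisher: "integrable M
      (\<lambda>\<omega>. outer (grad (NLL 1 \<omega>) \<theta>0) (grad (NLL 1 \<omega>) \<theta>0))"
    and pd_fisher: "pos_def
      (\<integral>\<omega>. outer (grad (NLL 1 \<omega>) \<theta>0) (grad (NLL 1 \<omega>) \<theta>0) \<partial>M)"
    and int_J: "integrable M (\<lambda>\<omega>. hessian (NLL 1 \<omega>) \<theta>0)"
    and J: "J = (\<integral>\<omega>. hessian (NLL 1 \<omega>) \<theta>0 \<partial>M)"
    and pd_J: "pos_def J"
    and convex_prior: "convex_on UNIV \<phi>0"
    and convex_NLL: "\<And>i \<omega>. i \<ge> 1 \<Longrightarrow> \<omega> \<in> space M \<Longrightarrow> convex_on UNIV (NLL i \<omega>)"
    and Delta_prior: "third_sup (\<lambda>\<theta> v1 v2 v3.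
      D3 \<phi>0 \<theta> (msqrt J *v v1) (msqrt J *v v2) (msqrt J *v v3)) < \<infinity>"
    and Delta_NLL: "\<And>i. i \<ge> 1 \<Longrightarrow> (\<integral>\<^sup>+\<omega>. third_sup (\<lambda>\<theta> v1 v2 v3.
      D3 (NLL i \<omega>) \<theta> (msqrt J *v v1) (msqrt J *v v2) (msqrt J *v v3)) \<partial>M) < \<infinity>"
  defines "\<phi> \<equiv> neg_log_post \<phi>0 NLL"
  shows "with_prob_tending_to_1 M (\<lambda>n \<omega>.
           laplace_defined (\<phi> n \<omega>) \<and> proper_posterior (\<phi> n \<omega>) \<and>
           KL_finite (laplace_density (\<phi> n \<omega>)) (posterior_density (\<phi> n \<omega>)))
    \<and> bigO_P M
           (\<lambda>n \<omega>. enn2ereal (Delta3 (\<phi> n \<omega>) * ennreal (real CARD('p) powr (3/2))))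
           (\<lambda>n. 1 / sqrt (real n))
    \<and> bigO_P M
           (\<lambda>n \<omega>. ereal (KL (laplace_density (\<phi> n \<omega>)) (posterior_density (\<phi> n \<omega>))))
           (\<lambda>n. 1 / real n)"
proof -
  interpret prob_space M by fact
  interpret iid_sequence M path_space NLL
    by unfold_locales (fact iid_indep[folded path_space_def] iid_distr[folded path_space_def])+
  interpret convex_likelihood M NLL \<theta>0 J
    by unfold_locales (fact diff_NLL convex_NLL int_NLL argmin int_fisher int_J J pd_J)+
  obtain L0 where prior3: "third_bounded \<phi>0 L0"
  proof -
    obtain k where k: "k > 0" "\<And>y. norm (matrix_inv (msqrt J) *v y) \<le> k * norm y"
      using linear_bounded_pos[of "(*v) (matrix_inv (msqrt J))"] by auto
    obtain t where t: "0 \<le> t" "third_sup (\<lambda>\<theta> v1 v2 v3.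
        D3 \<phi>0 \<theta> (msqrt J *v v1) (msqrt J *v v2) (msqrt J *v v3)) = ennreal t"
      using Delta_prior by (metis ennreal_cases infinity_ennreal_def less_irrefl)
    then show thesis
      using third_bounded_if_preconditioned[OF diff_prior msqrt_invertible[OF pd_J] t(1) _ k(2,1)] that[of "k ^ 3 * t"] by simp
  qed
  note regular = laplace_regular_in_probability[OF diff_prior convex_prior prior3 Delta_NLL[OF order_refl], folded \<phi>_def]
  have \<phi>_diff: "three_times_differentiable (\<phi> n \<omega>)" and \<phi>_convex: "convex_on UNIV (\<phi> n \<omega>)"
    if "\<omega> \<in> space M" for n \<omega>
    unfolding \<phi>_def using that diff_prior convex_prior diff_NLL convex_NLL
    by (auto intro!: three_times_differentiable_neg_log_post convex_neg_log_post)
  have large: "\<forall>\<^sub>F n in sequentially. n \<ge> 1 \<and> 0 \<le> C / sqrt (real n) \<and> C / sqrt (real n) \<le> 1" if "C > 0" for C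
  proof -
    \<comment> \<open>The bound on the divergence needs \<open>\<Delta>\<^sub>3 \<le> 1\<close>.\<close>
    have "\<forall>\<^sub>F n in sequentially. C\<^sup>2 \<le> real n"
      using filterlim_real_sequentially by (simp add: filterlim_at_top)
    then show ?thesis
      using eventually_ge_at_top[of 1]
    proof eventually_elim
      case (elim n)
      then have "C \<le> sqrt (real n)" by (simp add: real_le_rsqrt)
      then show ?case using elim \<open>C > 0\<close> by (simp add: divide_le_eq)
    qed
  qed
  define controlled where "controlled C n \<omega> \<longleftrightarrow> laplace_defined (\<phi> n \<omega>) \<and> proper_posterior (\<phi> n \<omega>) \<and>
      KL_finite (laplace_density (\<phi> n \<omega>)) (posterior_density (\<phi> n \<omega>)) \<and>
      Delta3 (\<phi> n \<omega>) \<le> ennreal (C / sqrt (real n)) \<and>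
      \<bar>KL (laplace_density (\<phi> n \<omega>)) (posterior_density (\<phi> n \<omega>))\<bar> \<le> KL_const TYPE('p) * (C / sqrt (real n))\<^sup>2" for C n \<omega>
  have main: "\<exists>C>0. \<forall>\<^sub>F n in sequentially. \<exists>A\<in>events. prob A \<ge> 1 - \<epsilon> \<and> (\<forall>\<omega>\<in>A. controlled C n \<omega>)"
    if \<epsilon>: "\<epsilon> > 0" for \<epsilon> :: real
  proof -
    obtain C where C: "C > 0" "\<forall>\<^sub>F n in sequentially. \<exists>A\<in>events. prob A \<ge> 1 - \<epsilon> \<and>
        (\<forall>\<omega>\<in>A. laplace_defined (\<phi> n \<omega>) \<and> Delta3 (\<phi> n \<omega>) \<le> ennreal (C / sqrt (real n)))"
      using regular[OF \<epsilon>] by blast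
    from C(2) large[OF C(1)]
    have "\<forall>\<^sub>F n in sequentially. \<exists>A\<in>events. prob A \<ge> 1 - \<epsilon> \<and> (\<forall>\<omega>\<in>A. controlled C n \<omega>)"
    proof eventually_elim
      case (elim n)
      then obtain A where A: "A \<in> events" "prob A \<ge> 1 - \<epsilon>"
        "\<And>\<omega>. \<omega> \<in> A \<Longrightarrow> laplace_defined (\<phi> n \<omega>)"
        "\<And>\<omega>. \<omega> \<in> A \<Longrightarrow> Delta3 (\<phi> n \<omega>) \<le> ennreal (C / sqrt (real n))" by blast
      show ?case
      proof (intro bexI[OF _ A(1)] conjI ballI A(2))
        fix \<omega> assume \<omega>: "\<omega> \<in> A"
        then have sp: "\<omega> \<in> space M" using A(1) sets.sets_into_space by blast
        have ev: "0 \<le> C / sqrt (real n)" "C / sqrt (real n) \<le> 1" using elim(2) by auto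
        note KL = KL_laplace_bound[OF \<phi>_diff[OF sp] \<phi>_convex[OF sp] A(3,4)[OF \<omega>] ev]
        show "controlled C n \<omega>"
          unfolding controlled_def using KL A(3,4)[OF \<omega>] by simp
      qed
    qed
    with C(1) show ?thesis by blast
  qed
  define s where "s = real CARD('p) powr (3/2)"
  have weaken: "\<forall>\<^sub>F n in sequentially. \<exists>A\<in>events. prob A \<ge> 1 - \<epsilon> \<and> (\<forall>\<omega>\<in>A. R n \<omega>)"
    if "\<forall>\<^sub>F n in sequentially. \<exists>A\<in>events. prob A \<ge> 1 - \<epsilon> \<and> (\<forall>\<omega>\<in>A. controlled C n \<omega>)"
      and "\<And>n \<omega>. controlled C n \<omega> \<Longrightarrow> R n \<omega>" for \<epsilon> C R
    using that(1) by (rule eventually_mono) (use that(2) in blast)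
  have "with_prob_tending_to_1 M (\<lambda>n \<omega>.
           laplace_defined (\<phi> n \<omega>) \<and> proper_posterior (\<phi> n \<omega>) \<and>
           KL_finite (laplace_density (\<phi> n \<omega>)) (posterior_density (\<phi> n \<omega>)))"
    unfolding with_prob_tending_to_1_def
  proof (intro allI impI)
    fix \<epsilon> :: real assume "\<epsilon> > 0"
    from main[OF this] obtain C where C: "\<forall>\<^sub>F n in sequentially. \<exists>A\<in>events. prob A \<ge> 1 - \<epsilon> \<and> (\<forall>\<omega>\<in>A. controlled C n \<omega>)"
      by blast
    show "\<forall>\<^sub>F n in sequentially. \<exists>A\<in>events. 1 - \<epsilon> \<le> prob A \<and>
        (\<forall>\<omega>\<in>A. laplace_defined (\<phi> n \<omega>) \<and> proper_posterior (\<phi> n \<omega>) \<and>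
           KL_finite (laplace_density (\<phi> n \<omega>)) (posterior_density (\<phi> n \<omega>)))"
      by (rule weaken[OF C]) (simp add: controlled_def)
  qed
  moreover have "bigO_P M (\<lambda>n \<omega>. enn2ereal (Delta3 (\<phi> n \<omega>) * ennreal s)) (\<lambda>n. 1 / sqrt (real n))"
    unfolding bigO_P_def
  proof (intro allI impI)
    fix \<epsilon> :: real assume "\<epsilon> > 0"
    from main[OF this] obtain C where C: "C > 0"
      "\<forall>\<^sub>F n in sequentially. \<exists>A\<in>events. prob A \<ge> 1 - \<epsilon> \<and> (\<forall>\<omega>\<in>A. controlled C n \<omega>)"
      by blast
    have "\<bar>enn2ereal (Delta3 (\<phi> n \<omega>) * ennreal s)\<bar> \<le> ereal (C * s * (1 / sqrt (real n)))"
      if "controlled C n \<omega>" for n \<omega>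
    proof -
      have "Delta3 (\<phi> n \<omega>) * ennreal s \<le> ennreal (C / sqrt (real n)) * ennreal s"
        using that by (intro mult_right_mono) (simp_all add: controlled_def)
      also have "\<dots> = ennreal (C / sqrt (real n) * s)"
        using C(1) by (intro ennreal_mult'[symmetric]) simp
      also have "C / sqrt (real n) * s = C * s * (1 / sqrt (real n))" by simp
      finally have "enn2ereal (Delta3 (\<phi> n \<omega>) * ennreal s) \<le> enn2ereal (ennreal (C * s * (1 / sqrt (real n))))"
        by (simp only: less_eq_ennreal.rep_eq)
      also have "\<dots> = ereal (C * s * (1 / sqrt (real n)))"
        using C(1) by (intro enn2ereal_ennreal) (simp add: s_def)
      finally show ?thesis by simp
    qed
    then show "\<exists>C. \<forall>\<^sub>F n in sequentially. \<exists>A\<in>events. 1 - \<epsilon> \<le> prob A \<and>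
        (\<forall>\<omega>\<in>A. \<bar>enn2ereal (Delta3 (\<phi> n \<omega>) * ennreal s)\<bar> \<le> ereal (C * (1 / sqrt (real n))))"
      by (intro exI[of _ "C * s"] weaken[OF C(2)])
  qed
  moreover have "bigO_P M (\<lambda>n \<omega>. ereal (KL (laplace_density (\<phi> n \<omega>)) (posterior_density (\<phi> n \<omega>)))) (\<lambda>n. 1 / real n)"
    unfolding bigO_P_def
  proof (intro allI impI)
    fix \<epsilon> :: real assume "\<epsilon> > 0"
    from main[OF this] obtain C where C: "\<forall>\<^sub>F n in sequentially. \<exists>A\<in>events. prob A \<ge> 1 - \<epsilon> \<and> (\<forall>\<omega>\<in>A. controlled C n \<omega>)"
      by blast
    have "\<bar>ereal (KL (laplace_density (\<phi> n \<omega>)) (posterior_density (\<phi> n \<omega>)))\<bar>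
        \<le> ereal (KL_const TYPE('p) * C\<^sup>2 * (1 / real n))" if "controlled C n \<omega>" for n \<omega>
      using that by (simp add: controlled_def power_divide)
    then show "\<exists>C. \<forall>\<^sub>F n in sequentially. \<exists>A\<in>events. 1 - \<epsilon> \<le> prob A \<and>
        (\<forall>\<omega>\<in>A. \<bar>ereal (KL (laplace_density (\<phi> n \<omega>)) (posterior_density (\<phi> n \<omega>)))\<bar> \<le> ereal (C * (1 / real n)))"
      by (intro exI[of _ "KL_const TYPE('p) * C\<^sup>2"] weaken[OF C])
  qed
  ultimately show ?thesis unfolding s_def by blast
qed

end
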